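(* Let $d\ge1$ be an integer, $\lambda>1$, and let $\omega(\boldsymbol z)=(\lambda-1)^d\prod_{j=1}^d(1-|z_j|^2)^{\lambda-2}$ on the polydisc $\mathbb D^d$. Let $\boldsymbol s:\mathbb C^d\to\mathbb C^d$ be the symmetrization map, $\mathbb G_d=\boldsymbol s(\mathbb D^d)$, and let $\widetilde\omega:\mathbb G_d\to(0,\infty)$ be the continuous function with $\omega=\widetilde\omega\circ\boldsymbol s$. Let $N=\{\boldsymbol z\in\mathbb D^d:z_i=z_j\text{ for some }i\ne j\}$ and let $\widetilde\omega_1:\mathbb G_d\setminus\boldsymbol s(N)\to(0,\infty)$ be the continuous function defined by $$\widetilde\omega_1(\boldsymbol s(\boldsymbol z))=\frac{1}{\prod_{i<j}|z_i-z_j|^2}\,\widetilde\omega(\boldsymbol s(\boldsymbol z)).$$ The reproducing kernel $\mathcal B_{\widetilde\omega_1}$ of the weighted Bergman space $\mathbb A^2_{\widetilde\omega_1}(\mathbb G_d)$ is given by $$\mathcal B_{\widetilde\omega_1}(\boldsymbol s(\boldsymbol z),\boldsymbol s(\boldsymbol w))=\mathrm{perm}\big((1-z_i\overline{w_j})^{-\lambda}\big)_{i,j=1}^d,\qquad\boldsymbol z,\boldsymbol w\in\mathbb D^d,$$ where $\mathrm{perm}\,A$ denotes the permanent of the matrix $A$.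
   Context: $\mathbb D^d=\{\boldsymbol z\in\mathbb C^d:|z_1|,\dots,|z_d|<1\}$. $\boldsymbol s=(s_1,\dots,s_d)$, where $s_k$ is the elementary symmetric polynomial of degree $k$ in $d$ variables; $\mathbb G_d$ is the symmetrized polydisc. $\mathbb A^2_{\widetilde\omega_1}(\mathbb G_d)$ is the Hilbert space of holomorphic $f$ on $\mathbb G_d$ with $\int_{\mathbb G_d\setminus\boldsymbol s(N)}|f|^2\widetilde\omega_1\,dV<\infty$ ($\boldsymbol s(N)$ has measure zero). $dV$ is the multiple of Lebesgue measure with $V(\mathbb D^d)=1$; the same multiple is used on $\mathbb G_d$. With this normalization the reproducing kernel of $\mathbb A^2_\omega(\mathbb D^d)$ is $\prod_{j=1}^d(1-z_j\overline{w_j})^{-\lambda}$, where powers use the principal branch. *)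

theory Defs
  imports "HOL-Analysis.Analysis" "HOL-Combinatorics.Permutations"
begin

text \<open>
  Points of $d$-dimensional complex space are vectors indexed by a finite linearly ordered
  type \<open>'n\<close> with \<open>CARD('n) = d\<close>. The order numbers the coordinates: the index \<open>k\<close> is the
  \<open>card {..k}\<close>-th one.
\<close>

definition polydisc :: "(complex ^ 'n) set" where
  "polydisc = {z. \<forall>i. norm (z $ i) < 1}"

definition elem_sym :: "nat \<Rightarrow> complex ^ 'n \<Rightarrow> complex" where
  "elem_sym k z = (\<Sum>A | card A = k. \<Prod>i\<in>A. z $ i)"

definition symmetrization ::
    "complex ^ 'n::{finite,linorder} \<Rightarrow> complex ^ 'n::{finite,linorder}" where
  "symmetrization z = (\<chi> k. elem_sym (card {..k}) z)"

definition symmetrized_polydisc :: "(complex ^ 'n::{finite,linorder}) set" where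
  "symmetrized_polydisc = symmetrization ` polydisc"

definition diagonals :: "(complex ^ 'n) set" where
  "diagonals = {z \<in> polydisc. \<exists>i j. i \<noteq> j \<and> z $ i = z $ j}"

definition polydisc_weight :: "real \<Rightarrow> complex ^ 'n \<Rightarrow> real" where
  "polydisc_weight lam z = (lam - 1) ^ CARD('n) * (\<Prod>j\<in>UNIV. (1 - (norm (z $ j))\<^sup>2) powr (lam - 2))"

definition permanent :: "'a::comm_semiring_1 ^ 'n ^ 'n \<Rightarrow> 'a" where
  "permanent A = (\<Sum>p | p permutes UNIV. \<Prod>i\<in>UNIV. A $ i $ p i)"

definition normalized_volume :: "(complex ^ 'n) measure" where
  "normalized_volume =
     scale_measure (1 / emeasure lborel (polydisc :: (complex ^ 'n) set)) lborel"

lemma emeasure_normalized_volume_polydisc: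
  "emeasure normalized_volume (polydisc :: (complex ^ 'n) set) = 1"
proof -
  let ?D = "polydisc :: (complex ^ 'n) set"
  have "open (\<Inter>i. {z :: complex ^ 'n. norm (z $ i) < 1})"
    by (intro open_INT ballI open_Collect_less continuous_intros) simp
  moreover have "(\<Inter>i. {z. norm (z $ i) < 1}) = ?D"
    by (auto simp: polydisc_def)
  ultimately have op: "open ?D"
    by (simp only:)
  have bd: "bounded ?D"
  proof (rule boundedI)
    fix z :: "complex ^ 'n"
    assume "z \<in> polydisc"
    then have "(\<Sum>i\<in>UNIV. norm (z $ i)) \<le> (\<Sum>i\<in>(UNIV :: 'n set). 1)"
      by (intro sum_mono) (auto simp: polydisc_def less_imp_le)
    then show "norm z \<le> real CARD('n)"
      using L2_set_le_sum[of UNIV "\<lambda>i. norm (z $ i)"] by (simp add: norm_vec_def)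
  qed
  have "0 \<in> ?D"
    by (simp add: polydisc_def)
  then have "emeasure lborel ?D \<noteq> 0"
    using op open_not_negligible[of ?D] by (auto simp: negligible_iff_null_sets null_sets_def)
  moreover have "emeasure lborel ?D \<noteq> \<infinity>"
    using emeasure_bounded_finite[OF bd] by simp
  ultimately show ?thesis
    by (simp add: normalized_volume_def ennreal_divide_times ennreal_divide_self less_top)
qed

text \<open>Complex Frechet differentiability at every point; the intended \<open>S\<close> are open.\<close>

definition vec_holomorphic_on :: "(complex ^ 'n \<Rightarrow> complex) \<Rightarrow> (complex ^ 'n) set \<Rightarrow> bool"
    (infixl "vec'_holomorphic'_on" 50) where
  "f vec_holomorphic_on S \<longleftrightarrow>
     (\<forall>z\<in>S. \<exists>D. (f has_derivative D) (at z) \<and> (\<forall>c v. D (c *s v) = c * D v))"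

text \<open>
  The weighted Bergman space on \<open>\<Omega>\<close>, for a weight \<open>\<rho>\<close> that need only be defined off a null set
  \<open>E\<close>. Its elements are functions on \<open>\<Omega>\<close>, so total functions that agree on \<open>\<Omega>\<close> represent the
  same element; all notions below ignore the values off \<open>\<Omega>\<close>.
\<close>

definition bergman_space ::
    "(complex ^ 'n) set \<Rightarrow> (complex ^ 'n) set \<Rightarrow> (complex ^ 'n \<Rightarrow> real) \<Rightarrow> (complex ^ 'n \<Rightarrow> complex) set"
  where
  "bergman_space \<Omega> E \<rho> =
     {f. f vec_holomorphic_on \<Omega> \<and>
         (\<integral>\<^sup>+ z \<in> \<Omega> - E. ennreal ((norm (f z))\<^sup>2 * \<rho> z) \<partial>normalized_volume) < \<infinity>}"

definition bergman_inner ::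
    "(complex ^ 'n) set \<Rightarrow> (complex ^ 'n) set \<Rightarrow> (complex ^ 'n \<Rightarrow> real) \<Rightarrow>
     (complex ^ 'n \<Rightarrow> complex) \<Rightarrow> (complex ^ 'n \<Rightarrow> complex) \<Rightarrow> complex"
  where
  "bergman_inner \<Omega> E \<rho> f g =
     (LINT z : \<Omega> - E | normalized_volume. f z * cnj (g z) * complex_of_real (\<rho> z))"

definition is_reproducing_kernel ::
    "'a set \<Rightarrow> ('a \<Rightarrow> complex) set \<Rightarrow> (('a \<Rightarrow> complex) \<Rightarrow> ('a \<Rightarrow> complex) \<Rightarrow> complex) \<Rightarrow>
     ('a \<Rightarrow> 'a \<Rightarrow> complex) \<Rightarrow> bool"
  where
  "is_reproducing_kernel X H ip K \<longleftrightarrow>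
     (\<forall>w\<in>X. (\<lambda>z. K z w) \<in> H \<and> (\<forall>f\<in>H. f w = ip f (\<lambda>z. K z w)))"

definition is_bergman_kernel ::
    "(complex ^ 'n) set \<Rightarrow> (complex ^ 'n) set \<Rightarrow> (complex ^ 'n \<Rightarrow> real) \<Rightarrow>
     (complex ^ 'n \<Rightarrow> complex ^ 'n \<Rightarrow> complex) \<Rightarrow> bool"
  where
  "is_bergman_kernel \<Omega> E \<rho> K \<longleftrightarrow>
     is_reproducing_kernel \<Omega> (bergman_space \<Omega> E \<rho>) (bergman_inner \<Omega> E \<rho>) K"

end

theory Submission
  imports Defs "HOL-Complex_Analysis.Cauchy_Integral_Formula"
    "HOL-Computational_Algebra.Fundamental_Theorem_Algebra"
begin

text \<open>
Write \<open>d\<close> for the number of coordinates, \<open>s\<close> for the symmetrization, \<open>D\<close> for the polydisc, \<open>G\<close> for the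
symmetrized polydisc and \<open>N\<close> for the diagonals. Off \<open>N\<close> the map \<open>s\<close> is a \<open>d!\<close>-sheeted covering, and
its absolute Jacobian determinant, as a map of real vectors, is the product of the \<open>|z\<^sub>i - z\<^sub>j|\<^sup>2\<close> over \<open>i < j\<close>.
The weight on \<open>G\<close> is the weight on \<open>D\<close> divided by exactly this product, so \<open>s\<close> pushes the weighted
measure of \<open>D\<close> forward to \<open>d!\<close> times the weighted measure of \<open>G\<close> (lemma \<open>distr_symmetrization\<close>).
Composition with \<open>s\<close> therefore sends the Bergman space of \<open>G\<close> into the symmetric functions in the
Bergman space of \<open>D\<close>, multiplying inner products by \<open>d!\<close>.

The permanent is the sum of the kernel of \<open>D\<close> over all permutations of the coordinates of \<open>w\<close>.
Pairing \<open>f \<circ> s\<close> with each summand gives the value of \<open>f \<circ> s\<close> at a permutation of \<open>w\<close>, which is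
\<open>f (s w)\<close>; the \<open>d!\<close> equal values cancel the factor \<open>d!\<close> of the inner product. So the permanent
reproduces, provided that it is a holomorphic function of \<open>s z\<close>.

Three facts carry this argument.

\<^item> The Jacobian determinant (\<open>rdet_symmetrization_deriv\<close>): composing the derivative of \<open>s\<close> with the
  evaluation of polynomials at the points \<open>z\<^sub>i\<close> makes it diagonal, and in Newton's basis this
  evaluation is triangular.

\<^item> The permanent is a holomorphic function of \<open>s z\<close> (\<open>descends_permanent\<close>): it is a polynomial in
  power sums \<open>\<Sum>i. h (z\<^sub>i)\<close>, and such a sum is a contour integral of \<open>h\<close> times the logarithmic
  derivative of the polynomial with roots \<open>z\<^sub>i\<close>, whose coefficients are the coordinates of \<open>s z\<close> up
  to sign.

\<^item> The kernel of the polydisc (\<open>polydisc_kernel_reproducing\<close>): at \<open>w = 0\<close> the claim is the mean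
  value property, and the automorphism of \<open>D\<close> that exchanges \<open>0\<close> and \<open>w\<close> carries it to every \<open>w\<close>.

Uniqueness is formal: two reproducing kernels reproduce each other.
\<close>

section \<open>Real determinants of complex-linear maps and change of variables\<close>

text \<open>
A permutation with a nonzero term in the Leibniz formula raises the rank of no index. As it
preserves the sum of the ranks, it preserves each rank, and so it is the identity.
\<close>

lemma det_triangular_by_rank:
  fixes A :: "'a::comm_ring_1 ^ 'm ^ 'm" and r :: "'m \<Rightarrow> nat"
  assumes tri: "\<And>i j. A $ i $ j \<noteq> 0 \<Longrightarrow> j = i \<or> r j < r i"
  shows "det A = (\<Prod>i\<in>UNIV. A $ i $ i)"
proof -
  let ?t = "\<lambda>p. of_int (sign p) * (\<Prod>i\<in>UNIV. A $ i $ p i)"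
  have vanish: "?t p = 0" if p: "p permutes UNIV" and "p \<noteq> id" for p
  proof (rule ccontr)
    assume "?t p \<noteq> 0"
    then have nz: "A $ i $ p i \<noteq> 0" for i
      by (metis (no_types, lifting) UNIV_I finite mult_zero_right prod_zero)
    have le: "r (p i) \<le> r i" for i
      using tri[OF nz[of i]] by auto
    have eq: "(\<Sum>i\<in>UNIV. r (p i)) = (\<Sum>i\<in>UNIV. r i)"
      using sum.permute[OF p, of r] by (simp add: o_def)
    have "r (p i) = r i" for i
    proof (rule ccontr)
      assume "r (p i) \<noteq> r i"
      then have "(\<Sum>i\<in>UNIV. r (p i)) < (\<Sum>i\<in>UNIV. r i)"
        by (intro sum_strict_mono_ex1) (use le in \<open>auto intro!: exI[of _ i] le_neq_trans\<close>)
      with eq show False by simp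
    qed
    then have "p i = i" for i
      using tri[OF nz[of i]] by auto
    with \<open>p \<noteq> id\<close> show False by auto
  qed
  have "det A = (\<Sum>p | p permutes UNIV. if p = id then ?t p else 0)"
    unfolding det_def by (intro sum.cong refl) (use vanish in auto)
  also have "\<dots> = ?t id"
    by (simp add: permutes_id)
  finally show ?thesis by (simp add: sign_id)
qed

text \<open>
The change-of-variables formula concerns real vectors over a well-ordered index type. This type
indexes the real and imaginary parts of a complex vector; an injection into the naturals orders it.
\<close>

datatype 'n coord = Re_coord 'n | Im_coord 'n

lemma UNIV_coord: "UNIV = range Re_coord \<union> range Im_coord"
  by (metis (no_types, lifting) UNIV_eq_I UnCI coord.exhaust rangeI)

instance coord :: (finite) finite
  by standard (simp add: UNIV_coord)

definition coord_index :: "'n::finite coord \<Rightarrow> nat" where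
  "coord_index = (SOME f. inj f)"

lemma inj_coord_index: "inj coord_index"
  unfolding coord_index_def by (rule someI_ex[of inj]) (rule finite_imp_inj_to_nat_seg[of UNIV, simplified, THEN ex_forward], auto)

instantiation coord :: (finite) wellorder
begin
definition "c \<le> c' \<longleftrightarrow> coord_index c \<le> coord_index c'"
definition "c < c' \<longleftrightarrow> coord_index c < coord_index c'"
instance
proof
  fix P :: "'a coord \<Rightarrow> bool" and a
  assume step: "\<And>x. (\<And>y. y < x \<Longrightarrow> P y) \<Longrightarrow> P x"
  show "P a"
    by (induction a rule: measure_induct_rule[of coord_index]) (auto intro: step simp: less_coord_def)
qed (auto simp: less_eq_coord_def less_coord_def dest: injD[OF inj_coord_index])
end

definition realify :: "complex ^ 'n::finite \<Rightarrow> real ^ 'n::finite coord" where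
  "realify z = (\<chi> c. case c of Re_coord i \<Rightarrow> Re (z $ i) | Im_coord i \<Rightarrow> Im (z $ i))"

definition complexify :: "real ^ 'n::finite coord \<Rightarrow> complex ^ 'n::finite" where
  "complexify x = (\<chi> i. Complex (x $ Re_coord i) (x $ Im_coord i))"

lemma realify_nth [simp]:
  "realify z $ Re_coord i = Re (z $ i)" "realify z $ Im_coord i = Im (z $ i)"
  by (simp_all add: realify_def)

lemma complexify_nth [simp]: "complexify x $ i = Complex (x $ Re_coord i) (x $ Im_coord i)"
  by (simp add: complexify_def)

lemma coord_vec_eqI:
  "(\<And>i. x $ Re_coord i = y $ Re_coord i) \<Longrightarrow> (\<And>i. x $ Im_coord i = y $ Im_coord i) \<Longrightarrow> x = y"
  by (metis coord.exhaust vec_eq_iff)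

lemma complexify_realify [simp]: "complexify (realify z) = z"
  by (simp add: vec_eq_iff)

lemma realify_complexify [simp]: "realify (complexify x) = x"
  by (rule coord_vec_eqI) auto

lemma linear_realify: "linear realify"
  by (rule linearI) (rule coord_vec_eqI; simp)+

lemma linear_complexify: "linear complexify"
  by (rule linearI) (simp_all add: vec_eq_iff complex_eq_iff)

lemma continuous_realify: "continuous_on A realify"
  by (simp add: linear_continuous_on linear_realify linear_linear linear_conv_bounded_linear[symmetric])

lemma continuous_complexify: "continuous_on A complexify"
  by (simp add: linear_continuous_on linear_complexify linear_conv_bounded_linear[symmetric])

lemma measurable_realify [measurable]: "realify \<in> borel_measurable borel"
  by (intro borel_measurable_continuous_onI continuous_realify)

lemma measurable_complexify [measurable]: "complexify \<in> borel_measurable borel"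
  by (intro borel_measurable_continuous_onI continuous_complexify)

lemma prod_coord:
  fixes f :: "'n::finite coord \<Rightarrow> 'a::comm_monoid_mult"
  shows "(\<Prod>c\<in>UNIV. f c) = (\<Prod>i\<in>UNIV. f (Re_coord i) * f (Im_coord i))"
  unfolding UNIV_coord
  by (subst prod.union_disjoint) (auto simp: prod.reindex inj_on_def prod.distrib)

lemma Basis_vec_complex: "(Basis :: (complex ^ 'n) set) = range (\<lambda>i. axis i 1) \<union> range (\<lambda>i. axis i \<i>)"
  by (auto simp: Basis_vec_def Basis_complex_def)

lemma prod_Basis_complex_vec:
  "(\<Prod>b\<in>(Basis :: (complex ^ 'n) set). f b) = (\<Prod>i\<in>UNIV. f (axis i 1) * f (axis i \<i>))"
  for f :: "_ \<Rightarrow> 'a::comm_monoid_mult"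
  unfolding Basis_vec_complex
  by (subst prod.union_disjoint) (auto simp: prod.reindex inj_on_def prod.distrib axis_eq_axis)

lemma distr_realify: "distr lborel borel realify = (lborel :: (real ^ 'n::finite coord) measure)"
proof (rule lborel_eqI[symmetric])
  fix l u :: "real ^ 'n::finite coord"
  assume le: "\<And>b. b \<in> Basis \<Longrightarrow> l \<bullet> b \<le> u \<bullet> b"
  have lu: "l $ c \<le> u $ c" for c
    using le[of "axis c 1"] by (simp add: axis_in_Basis_iff inner_axis)
  have pre: "realify -` box l u = box (complexify l) (complexify u)"
  proof (rule set_eqI)
    fix z
    have "z \<in> realify -` box l u \<longleftrightarrow> (\<forall>c. l $ c < realify z $ c \<and> realify z $ c < u $ c)"
      by (simp only: vimage_eq mem_box_cart)
    also have "\<dots> \<longleftrightarrow> (\<forall>i. l $ Re_coord i < Re (z $ i) \<and> Re (z $ i) < u $ Re_coord i \<and>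
        l $ Im_coord i < Im (z $ i) \<and> Im (z $ i) < u $ Im_coord i)"
      by (metis coord.exhaust realify_nth)
    also have "\<dots> \<longleftrightarrow> z \<in> box (complexify l) (complexify u)"
      by (simp add: mem_box Basis_vec_complex ball_Un inner_axis inner_complex_def all_conj_distrib conj_ac)
    finally show "z \<in> realify -` box l u \<longleftrightarrow> z \<in> box (complexify l) (complexify u)" .
  qed
  have "emeasure (distr lborel borel realify) (box l u) = emeasure lborel (box (complexify l) (complexify u))"
    by (subst emeasure_distr) (auto simp: pre)
  also have "\<dots> = ennreal (\<Prod>b\<in>Basis. (complexify u - complexify l) \<bullet> b)"
    by (subst emeasure_lborel_box)
       (auto simp: Basis_vec_complex inner_axis inner_complex_def lu)
  also have "(\<Prod>b\<in>Basis. (complexify u - complexify l) \<bullet> b) = (\<Prod>c\<in>UNIV. (u - l) $ c)"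
    by (simp add: prod_coord prod_Basis_complex_vec inner_axis inner_complex_def)
  also have "(\<Prod>c\<in>UNIV. (u - l) $ c) = (\<Prod>b\<in>Basis. (u - l) \<bullet> b)"
    unfolding Basis_vec_def
    by (simp add: UNION_singleton_eq_range prod.reindex inj_on_def axis_eq_axis inner_axis)
  finally show "emeasure (distr lborel borel realify) (box l u) = ennreal (\<Prod>b\<in>Basis. (u - l) \<bullet> b)"
    .
qed simp

text \<open>
The factor by which a real-linear map scales volume.
\<close>

definition rdet :: "(complex ^ 'n \<Rightarrow> complex ^ 'n) \<Rightarrow> real" where
  "rdet L = \<bar>det (matrix (realify \<circ> L \<circ> complexify))\<bar>"

lemma rdet_compose:
  assumes "linear L" "linear M"
  shows "rdet (L \<circ> M) = rdet L * rdet M"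
proof -
  have "realify \<circ> (L \<circ> M) \<circ> complexify = (realify \<circ> L \<circ> complexify) \<circ> (realify \<circ> M \<circ> complexify)"
    by (auto simp: fun_eq_iff)
  then show ?thesis
    unfolding rdet_def using assms
    by (simp only:) (simp add: matrix_compose linear_compose linear_complexify linear_realify det_mul abs_mult)
qed

lemma linear_matrix_vector_mult: "linear ((*v) (M :: complex ^ 'n ^ 'm))"
  by (rule linearI)
     (simp_all add: vec_eq_iff matrix_vector_mult_def algebra_simps sum.distrib scaleR_sum_right)

lemma linear_coordinatewise: "linear (\<lambda>z::complex^'n. \<chi> i. a i * z $ i)"
  by (rule linearI) (simp_all add: vec_eq_iff algebra_simps)

text \<open>
A nonzero entry of \<open>M\<close> becomes a block of two rows and two columns of the real matrix. Off the diagonal,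
both rows have a larger rank than both columns; on the diagonal, the entry \<open>1\<close> becomes the unit
block. So the real matrix is unitriangular for the rank of the underlying complex coordinate.
\<close>

lemma rdet_unitriangular:
  fixes M :: "complex ^ 'n ^ 'n" and r :: "'n \<Rightarrow> nat"
  assumes tri: "\<And>i j. M $ i $ j \<noteq> 0 \<Longrightarrow> j = i \<or> r j < r i" and unit: "\<And>i. M $ i $ i = 1"
  shows "rdet ((*v) M) = 1"
proof -
  let ?A = "matrix (realify \<circ> (*v) M \<circ> complexify)"
  let ?r = "case_coord r r"
  have ent: "(M *v complexify (axis (Re_coord j) 1)) $ i = M $ i $ j"
     "(M *v complexify (axis (Im_coord j) 1)) $ i = M $ i $ j * \<i>" for i j
  proof -
    have "complexify (axis (Re_coord j) 1) = axis j 1" "complexify (axis (Im_coord j) 1) = axis j \<i>"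
      by (auto simp: vec_eq_iff axis_def complex_eq_iff)
    then show "(M *v complexify (axis (Re_coord j) 1)) $ i = M $ i $ j"
     "(M *v complexify (axis (Im_coord j) 1)) $ i = M $ i $ j * \<i>"
      by (simp_all add: matrix_vector_mult_def axis_def if_distrib cong: if_cong)
  qed
  have "det ?A = (\<Prod>c\<in>UNIV. ?A $ c $ c)"
  proof (rule det_triangular_by_rank[where r = ?r])
    fix c c' assume nz: "?A $ c $ c' \<noteq> 0"
    show "c' = c \<or> ?r c' < ?r c"
    proof (cases c; cases c')
      fix i j assume c: "c = Re_coord i" "c' = Re_coord j"
      then have "M $ i $ j \<noteq> 0" using nz by (auto simp: matrix_def ent)
      then show ?thesis using tri c by auto
    next
      fix i j assume c: "c = Im_coord i" "c' = Im_coord j"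
      then have "M $ i $ j \<noteq> 0" using nz by (auto simp: matrix_def ent)
      then show ?thesis using tri c by auto
    next
      fix i j assume c: "c = Re_coord i" "c' = Im_coord j"
      then have "M $ i $ j \<noteq> 0" "i \<noteq> j" using nz unit by (auto simp: matrix_def ent)
      then show ?thesis using tri c by auto
    next
      fix i j assume c: "c = Im_coord i" "c' = Re_coord j"
      then have "M $ i $ j \<noteq> 0" "i \<noteq> j" using nz unit by (auto simp: matrix_def ent)
      then show ?thesis using tri c by auto
    qed
  qed
  also have "\<dots> = 1"
    by (simp add: prod_coord matrix_def ent unit)
  finally show ?thesis by (simp add: rdet_def)
qed

lemma rdet_id: "rdet (\<lambda>z::complex^'n. z) = 1"
proof -
  have "realify \<circ> (\<lambda>z::complex^'n. z) \<circ> complexify = id" by (auto simp: fun_eq_iff)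
  then show ?thesis unfolding rdet_def by (simp only: matrix_id_mat_1 det_I abs_one)
qed

lemma rdet_real_diagonal: "rdet (\<lambda>z. \<chi> i. complex_of_real (a i) * z $ i) = (\<Prod>i\<in>UNIV. (a i)\<^sup>2)"
proof -
  let ?A = "matrix (realify \<circ> (\<lambda>z. \<chi> i. complex_of_real (a i) * z $ i) \<circ> complexify)"
  have ent: "?A $ c $ c' = (if c = c' then case_coord a a c else 0)" for c c'
    by (cases c) (auto simp: matrix_def axis_def)
  have "det ?A = (\<Prod>c\<in>UNIV. ?A $ c $ c)"
    by (rule det_diagonal) (simp add: ent)
  also have "\<dots> = (\<Prod>i\<in>UNIV. (a i)\<^sup>2)"
    by (simp add: ent prod_coord power2_eq_square)
  finally show ?thesis by (simp add: rdet_def abs_prod)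
qed

text \<open>
Conjugation of all coordinates intertwines a diagonal map with its conjugate, so both have the same
real determinant, and their composition is a real diagonal map.
\<close>

lemma rdet_diagonal:
  fixes a :: "'n::finite \<Rightarrow> complex"
  shows "rdet (\<lambda>z. \<chi> i. a i * z $ i) = (\<Prod>i\<in>UNIV. (norm (a i))\<^sup>2)"
proof -
  let ?C = "\<lambda>z::complex^'n. \<chi> i. cnj (z $ i)"
  let ?L = "\<lambda>a z::complex^'n. \<chi> i. a i * z $ i"
  have linC: "linear ?C" by (rule linearI) (simp_all add: vec_eq_iff)
  have CC: "rdet ?C * rdet ?C = 1"
    using rdet_compose[OF linC linC] rdet_id[where 'n = 'n] by (simp add: o_def)
  have "?L (\<lambda>i. cnj (a i)) = ?C \<circ> (?L a \<circ> ?C)"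
    by (simp add: fun_eq_iff vec_eq_iff)
  then have conj: "rdet (?L (\<lambda>i. cnj (a i))) = rdet (?L a)"
    by (simp only: rdet_compose linC linear_compose linear_coordinatewise) (use CC in auto)
  have "rdet (?L a) * rdet (?L a) = rdet (?L a \<circ> ?L (\<lambda>i. cnj (a i)))"
    using conj by (simp add: rdet_compose linear_coordinatewise)
  also have "?L a \<circ> ?L (\<lambda>i. cnj (a i)) = ?L (\<lambda>i. complex_of_real ((norm (a i))\<^sup>2))"
    by (simp add: fun_eq_iff vec_eq_iff complex_norm_square mult.assoc[symmetric] del: of_real_power)
  also have "rdet \<dots> = (\<Prod>i\<in>UNIV. ((norm (a i))\<^sup>2)\<^sup>2)"
    by (rule rdet_real_diagonal)
  also have "\<dots> = (\<Prod>i\<in>UNIV. (norm (a i))\<^sup>2)\<^sup>2"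
    by (simp add: prod_power_distrib)
  finally have "(rdet (?L a))\<^sup>2 = (\<Prod>i\<in>UNIV. (norm (a i))\<^sup>2)\<^sup>2"
    by (simp add: power2_eq_square)
  then show ?thesis
    by (rule power2_eq_imp_eq) (auto simp: rdet_def prod_nonneg)
qed

text \<open>
The real determinant of a complex-linear map is the squared modulus of its complex determinant.
For a triangular matrix this follows by splitting off the diagonal.
\<close>

lemma rdet_triangular:
  fixes M :: "complex ^ 'n ^ 'n" and r :: "'n \<Rightarrow> nat"
  assumes tri: "\<And>i j. M $ i $ j \<noteq> 0 \<Longrightarrow> j = i \<or> r j < r i" and nz: "\<And>i. M $ i $ i \<noteq> 0"
  shows "rdet ((*v) M) = (\<Prod>i\<in>UNIV. (norm (M $ i $ i))\<^sup>2)"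
proof -
  define U where "U = (\<chi> i j. M $ i $ j / M $ i $ i)"
  have "(*v) M = (\<lambda>z. \<chi> i. M $ i $ i * z $ i) \<circ> (*v) U"
    by (simp add: fun_eq_iff vec_eq_iff matrix_vector_mult_def U_def sum_distrib_left nz)
  moreover have "rdet ((*v) U) = 1"
    by (rule rdet_unitriangular[where r = r]) (use tri nz in \<open>auto simp: U_def\<close>)
  ultimately show ?thesis
    by (simp add: rdet_compose linear_coordinatewise linear_matrix_vector_mult rdet_diagonal)
qed

text \<open>
As an identity of measures, the change-of-variables formula applies to nonnegative and to complex
integrands alike. On a Borel set \<open>B\<close> it is the formula for the volume of an image, applied to the
part of \<open>S\<close> that \<open>g\<close> sends into \<open>B\<close>.
\<close>

lemma change_of_variables_complex_vec:
  fixes g :: "complex ^ 'n \<Rightarrow> complex ^ 'n"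
  assumes S: "S \<in> sets borel" and T: "g ` S \<in> sets borel" "bounded (g ` S)"
    and g: "g \<in> borel_measurable borel" and J: "J \<in> borel_measurable borel"
    and der: "\<And>z. z \<in> S \<Longrightarrow> (g has_derivative g' z) (at z)"
    and inj: "inj_on g S" and rdet: "\<And>z. z \<in> S \<Longrightarrow> rdet (g' z) = J z"
  shows "density lborel (indicator (g ` S)) =
         distr (density lborel (\<lambda>z. indicator S z * ennreal (J z))) borel g" (is "?L = ?R")
proof (rule measure_eqI)
  note [measurable] = S T g J
  show "sets ?L = sets ?R" by simp
  fix B assume "B \<in> sets ?L"
  then have B [measurable]: "B \<in> sets borel" by simp
  define S' where "S' = S \<inter> g -` B"
  have S' [measurable]: "S' \<in> sets borel"
    unfolding S'_def using measurable_sets[OF g B] by simp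
  have img: "g ` S' = g ` S \<inter> B" by (auto simp: S'_def)
  define G where "G = realify \<circ> g \<circ> complexify"
  define R where "R = complexify -` S'"
  have R [measurable]: "R \<in> sets borel"
    unfolding R_def using measurable_sets[OF measurable_complexify S'] by simp
  have GR: "G ` R = complexify -` (g ` S \<inter> B)"
    unfolding img[symmetric]
  proof (intro set_eqI iffI)
    fix x assume "x \<in> complexify -` g ` S'"
    then obtain z where z: "z \<in> S'" "complexify x = g z" by auto
    then have "x = G (realify z)" "realify z \<in> R"
      by (auto simp: G_def R_def) (metis realify_complexify)
    then show "x \<in> G ` R" by blast
  qed (auto simp: G_def R_def)
  have "bounded (realify ` (g ` S \<inter> B))"
    by (intro bounded_linear_image bounded_subset[OF T(2)])
       (auto simp: linear_realify linear_conv_bounded_linear[symmetric])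
  moreover have "realify ` (g ` S \<inter> B) = G ` R"
  proof (intro set_eqI iffI)
    fix x assume "x \<in> G ` R"
    then have "complexify x \<in> g ` S \<inter> B" unfolding GR by simp
    then have "realify (complexify x) \<in> realify ` (g ` S \<inter> B)" by (rule imageI)
    then show "x \<in> realify ` (g ` S \<inter> B)" by (simp only: realify_complexify)
  qed (auto simp: GR simp del: realify_complexify)
  ultimately have bd: "bounded (G ` R)" by (simp only:)
  have GRm [measurable]: "G ` R \<in> sets borel"
  proof -
    have "g ` S \<inter> B \<in> sets borel" by (intro sets.Int T B)
    then show ?thesis
      unfolding GR using measurable_sets[OF measurable_complexify] by (simp only: space_borel Int_UNIV_right) simp
  qed
  have lm: "G ` R \<in> lmeasurable"
    using bd GRm by (simp add: bounded_set_imp_lmeasurable)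
  have "((\<lambda>x. \<bar>det (matrix (realify \<circ> g' (complexify x) \<circ> complexify))\<bar>) has_integral measure lebesgue (G ` R)) R"
  proof (rule iffD1[OF has_measure_differentiable_image], safe)
    fix x assume "x \<in> R"
    then have "(g has_derivative g' (complexify x)) (at (complexify x))"
      using der by (auto simp: R_def S'_def)
    from diff_chain_at[OF linear_imp_has_derivative[OF linear_complexify] this]
      diff_chain_at[OF _ linear_imp_has_derivative[OF linear_realify]]
    have "(realify \<circ> (g \<circ> complexify) has_derivative realify \<circ> (g' (complexify x) \<circ> complexify)) (at x)"
      by blast
    then show "(G has_derivative realify \<circ> g' (complexify x) \<circ> complexify) (at x within R)"
      unfolding G_def by (simp only: comp_assoc has_derivative_at_withinI)
  next
    show "inj_on G R"
    proof (rule inj_onI)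
      fix x y assume xy: "x \<in> R" "y \<in> R" "G x = G y"
      then have "g (complexify x) = g (complexify y)"
        by (metis G_def comp_apply complexify_realify)
      with xy inj have "complexify x = complexify y"
        by (auto simp: R_def S'_def inj_on_def)
      then show "x = y" by (metis realify_complexify)
    qed
  qed (use lm in auto)
  then have "((\<lambda>x. J (complexify x)) has_integral measure lebesgue (G ` R)) R"
    by (rule has_integral_eq[rotated]) (auto simp: R_def S'_def rdet[symmetric] rdet_def)
  then have "(\<integral>\<^sup>+x. ennreal (indicator R x * J (complexify x)) \<partial>lborel) = measure lebesgue (G ` R)"
    by (intro nn_integral_has_integral_lebesgue) (auto simp: R_def S'_def rdet[symmetric] rdet_def)
  also have "\<dots> = emeasure lebesgue (G ` R)"
    using lm by (simp add: emeasure_eq_measure2)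
  also have "\<dots> = emeasure lborel (G ` R)"
    by simp
  also have "\<dots> = emeasure (distr lborel borel realify) (G ` R)"
    by (simp add: distr_realify)
  also have "\<dots> = emeasure lborel (g ` S \<inter> B)"
    by (subst emeasure_distr) (auto simp: GR vimage_def Int_def)
  also have "\<dots> = emeasure ?L B"
  proof -
    have "emeasure ?L B = (\<integral>\<^sup>+z. indicator (g ` S \<inter> B) z \<partial>lborel)"
      by (subst emeasure_density) (auto intro!: nn_integral_cong simp: indicator_inter_arith simp del: nn_integral_indicator)
    then show ?thesis
      by (simp only: nn_integral_indicator sets_lborel sets.Int T B)
  qed
  finally have "emeasure ?L B = (\<integral>\<^sup>+x. ennreal (indicator R x * J (complexify x)) \<partial>distr lborel borel realify)"
    by (simp add: distr_realify)
  also have "\<dots> = (\<integral>\<^sup>+z. ennreal (indicator R (realify z) * J z) \<partial>lborel)"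
    by (subst nn_integral_distr) auto
  also have "\<dots> = (\<integral>\<^sup>+z. indicator S z * ennreal (J z) * indicator (g -` B) z \<partial>lborel)"
    by (intro nn_integral_cong) (auto simp: R_def S'_def indicator_def)
  also have "\<dots> = emeasure ?R B"
    using measurable_sets[OF g B]
    by (subst emeasure_distr) (auto simp: emeasure_density)
  finally show "emeasure ?L B = emeasure ?R B" .
qed

section \<open>The symmetrization map and its fibres\<close>

lemma card_atMost_less_iff: "card {..k} < card {..l} \<longleftrightarrow> k < l"
  for k l :: "'n::{finite,linorder}"
proof -
  have "card {..k} < card {..l}" if "k < l" for k l :: 'n
    by (rule psubset_card_mono) (use that in auto)
  then show ?thesis
    by (metis less_asym linorder_neqE)
qed

lemma card_atMost_bounds: "0 < card {..k}" "card {..k} \<le> CARD('n)"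
  for k :: "'n::{finite,linorder}"
  by (auto simp: card_gt_0_iff intro: card_mono)

lemma inj_card_atMost: "inj (\<lambda>k::'n::{finite,linorder}. card {..k})"
  by (rule injI) (metis card_atMost_less_iff less_irrefl linorder_neqE)

lemma bij_betw_card_atMost: "bij_betw (\<lambda>k::'n::{finite,linorder}. card {..k}) UNIV {1..CARD('n)}"
proof -
  have "(\<lambda>k::'n. card {..k}) ` UNIV \<subseteq> {1..CARD('n)}"
    using card_atMost_bounds by (auto simp: Suc_le_eq)
  moreover have "card ((\<lambda>k::'n. card {..k}) ` UNIV) = card {1..CARD('n)}"
    using card_image[OF inj_card_atMost] by simp
  ultimately have "(\<lambda>k::'n. card {..k}) ` UNIV = {1..CARD('n)}"
    by (intro card_subset_eq) auto
  then show ?thesis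
    using inj_card_atMost by (simp add: bij_betw_def)
qed

text \<open>
The elementary symmetric polynomial of degree \<open>k\<close> is the coefficient of \<open>x ^ (d - k)\<close>: the
coordinates of the symmetrization correspond to the exponents below \<open>d\<close>.
\<close>

lemma bij_betw_codegree: "bij_betw (\<lambda>k::'n::{finite,linorder}. CARD('n) - card {..k}) UNIV {..<CARD('n)}"
proof -
  have inj: "inj (\<lambda>k::'n. CARD('n) - card {..k})"
    by (rule injI) (metis card_atMost_bounds(2) diff_diff_cancel inj_card_atMost injD)
  have "CARD('n) - card {..k} < CARD('n)" for k :: 'n
    using card_atMost_bounds[of k] by simp
  then have "(\<lambda>k::'n. CARD('n) - card {..k}) ` UNIV \<subseteq> {..<CARD('n)}"
    by auto
  moreover have "card ((\<lambda>k::'n. CARD('n) - card {..k}) ` UNIV) = card {..<CARD('n)}"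
    using card_image[OF inj] by simp
  ultimately have "(\<lambda>k::'n. CARD('n) - card {..k}) ` UNIV = {..<CARD('n)}"
    by (intro card_subset_eq) auto
  then show ?thesis
    using inj by (simp add: bij_betw_def)
qed

lemma prod_diff_eq_sum_elem_sym:
  fixes z :: "complex ^ 'n"
  shows "(\<Prod>i\<in>UNIV. x - z $ i) = (\<Sum>k\<le>CARD('n). (-1) ^ k * elem_sym k z * x ^ (CARD('n) - k))"
proof -
  have "(\<Prod>i\<in>UNIV. x - z $ i) = (\<Prod>i\<in>UNIV. - z $ i + x)"
    by simp
  also have "\<dots> = (\<Sum>X\<in>UNIV. (\<Prod>i\<in>X. - z $ i) * (\<Prod>i\<in>UNIV - X. x))"
    by (subst prod_add) auto
  also have "\<dots> = (\<Sum>X\<in>UNIV. (-1) ^ card X * (\<Prod>i\<in>X. z $ i) * x ^ (CARD('n) - card X))"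
    by (simp add: prod_uminus card_Diff_subset)
  also have "\<dots> = (\<Sum>k\<le>CARD('n). \<Sum>X | X \<in> UNIV \<and> card X = k.
      (-1) ^ card X * (\<Prod>i\<in>X. z $ i) * x ^ (CARD('n) - card X))"
    by (rule sum.group[symmetric]) (auto intro: card_mono)
  also have "\<dots> = (\<Sum>k\<le>CARD('n). (-1) ^ k * elem_sym k z * x ^ (CARD('n) - k))"
    by (intro sum.cong refl) (simp add: elem_sym_def sum_distrib_left sum_distrib_right)
  finally show ?thesis .
qed

text \<open>
The monic polynomial whose roots, with multiplicities, are the coordinates of any point with
symmetrization \<open>S\<close>.
\<close>

definition vieta_poly :: "complex ^ 'n::{finite,linorder} \<Rightarrow> complex poly" where
  "vieta_poly S = monom 1 CARD('n) +
     (\<Sum>k\<in>UNIV. monom ((-1) ^ card {..k} * S $ k) (CARD('n) - card {..k}))"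

lemma poly_vieta_poly:
  fixes S :: "complex ^ 'n::{finite,linorder}"
  shows "poly (vieta_poly S) x =
    x ^ CARD('n) + (\<Sum>k\<in>UNIV. (-1) ^ card {..k} * S $ k * x ^ (CARD('n) - card {..k}))"
  by (simp add: vieta_poly_def poly_sum poly_monom)

lemma poly_vieta_poly_symmetrization:
  fixes z :: "complex ^ 'n::{finite,linorder}"
  shows "poly (vieta_poly (symmetrization z)) x = (\<Prod>i\<in>UNIV. x - z $ i)"
proof -
  let ?t = "\<lambda>k. (-1) ^ k * elem_sym k z * x ^ (CARD('n) - k)"
  have "{A :: 'n set. A = {}} = {{}}" by auto
  then have e0: "elem_sym 0 z = 1"
    by (simp add: elem_sym_def card_eq_0_iff)
  have "(\<Sum>k\<in>UNIV. (-1) ^ card {..k} * symmetrization z $ k * x ^ (CARD('n) - card {..k})) = (\<Sum>k=1..CARD('n). ?t k)"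
    using sum.reindex_bij_betw[OF bij_betw_card_atMost[where 'n='n], of ?t]
    by (simp add: symmetrization_def)
  also have "x ^ CARD('n) + \<dots> = (\<Sum>k\<le>CARD('n). ?t k)"
    by (simp add: e0 sum.atMost_shift sum.atLeast1_atMost_eq)
  finally show ?thesis
    unfolding poly_vieta_poly prod_diff_eq_sum_elem_sym .
qed

lemma vieta_poly_symmetrization:
  "vieta_poly (symmetrization z) = (\<Prod>i\<in>UNIV. [:- (z $ i), 1:])"
  by (simp add: poly_eq_poly_eq_iff[symmetric] fun_eq_iff poly_vieta_poly_symmetrization poly_prod)

lemma coeff_vieta_poly:
  fixes S :: "complex ^ 'n::{finite,linorder}"
  shows "coeff (vieta_poly S) CARD('n) = 1"
    and "coeff (vieta_poly S) (CARD('n) - card {..k}) = (-1) ^ card {..k} * S $ k"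
    and "degree (vieta_poly S) = CARD('n)"
proof -
  have lt: "CARD('n) - card {..k} < CARD('n)" for k :: 'n
    using card_atMost_bounds[of k] by simp
  have inj: "CARD('n) - card {..l} = CARD('n) - card {..k} \<longleftrightarrow> l = k" for k l :: 'n
    using bij_betw_codegree[where 'n='n] by (auto simp: bij_betw_def inj_def)
  show c1: "coeff (vieta_poly S) CARD('n) = 1"
    using lt by (simp add: vieta_poly_def coeff_sum less_imp_neq)
  show "coeff (vieta_poly S) (CARD('n) - card {..k}) = (-1) ^ card {..k} * S $ k"
    using lt[of k] by (simp add: vieta_poly_def coeff_sum coeff_monom inj if_distrib less_imp_neq[OF lt, symmetric] cong: if_cong)
  have "degree (vieta_poly S) \<le> CARD('n)"
    unfolding vieta_poly_def
    by (intro degree_add_le degree_sum_le order.trans[OF degree_monom_le]) auto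
  with c1 show "degree (vieta_poly S) = CARD('n)"
    by (simp add: le_antisym le_degree)
qed

lemma vieta_poly_inject: "vieta_poly S = vieta_poly S' \<longleftrightarrow> S = S'"
proof
  assume eq: "vieta_poly S = vieta_poly S'"
  show "S = S'"
  proof (rule vec_eq_iff[THEN iffD2, rule_format])
    fix k
    show "S $ k = S' $ k"
      using coeff_vieta_poly(2)[of S k] coeff_vieta_poly(2)[of S' k] eq by simp
  qed
qed simp

lemma symmetrization_permute:
  assumes "p permutes UNIV"
  shows "symmetrization (\<chi> i. z $ p i) = symmetrization z"
proof -
  have "vieta_poly (symmetrization (\<chi> i. z $ p i)) = vieta_poly (symmetrization z)"
    unfolding vieta_poly_symmetrization
    using prod.permute[OF assms, of "\<lambda>i. [:- (z $ i), 1:]"] by (simp add: o_def)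
  then show ?thesis by (simp add: vieta_poly_inject)
qed

text \<open>
All points of a fibre list the roots of one polynomial.
\<close>

lemma symmetrization_eqD:
  fixes z z' :: "complex ^ 'n::{finite,linorder}"
  assumes "symmetrization z = symmetrization z'"
  obtains p where "p permutes UNIV" "z' = (\<chi> i. z $ p i)"
proof -
  have proots: "proots (vieta_poly (symmetrization z)) = image_mset (($) z) (mset_set UNIV)" for z :: "complex ^ 'n::{finite,linorder}"
    unfolding vieta_poly_symmetrization
    by (subst proots_prod) (auto simp: sum_unfold_sum_mset)
  have "image_mset (($) z') (mset_set UNIV) = image_mset (($) z) (mset_set UNIV)"
    using assms by (metis proots)
  then obtain p where "p permutes UNIV" "\<forall>i\<in>UNIV. z' $ i = z $ p i"
    using image_mset_eq_implies_permutes[OF finite] by metis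
  then show ?thesis using that by (simp add: vec_eq_iff)
qed

text \<open>
This is the fundamental theorem of algebra: the roots of \<open>vieta_poly S\<close> form a preimage of \<open>S\<close>.
\<close>

lemma surj_symmetrization: "surj (symmetrization :: complex ^ 'n::{finite,linorder} \<Rightarrow> _)"
proof (unfold surj_def, intro allI)
  fix S :: "complex ^ 'n::{finite,linorder}"
  have "vieta_poly S \<noteq> 0"
    using coeff_vieta_poly(1)[of S] by auto
  then obtain A where A: "size A = CARD('n)" "vieta_poly S = (\<Prod>x\<in>#A. [:- x, 1:])"
    using alg_closed_imp_factorization[of "vieta_poly S"] coeff_vieta_poly[of S] by auto
  obtain xs where xs: "mset xs = A" by (rule ex_mset[THEN exE])
  define z :: "complex ^ 'n::{finite,linorder}" where "z = (\<chi> i. xs ! (CARD('n) - card {..i}))"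
  have "vieta_poly (symmetrization z) = (\<Prod>i\<in>UNIV. [:- (xs ! (CARD('n) - card {..i::'n})), 1:])"
    by (simp add: vieta_poly_symmetrization z_def)
  also have "\<dots> = (\<Prod>m<CARD('n). [:- (xs ! m), 1:])"
    by (rule prod.reindex_bij_betw[OF bij_betw_codegree])
  also have "\<dots> = vieta_poly S"
  proof -
    have len: "length xs = CARD('n)" using A xs by auto
    have "vieta_poly S = prod_list (map (\<lambda>x. [:- x, 1:]) xs)"
      using A(2) xs by (simp flip: prod_mset_prod_list)
    also have "\<dots> = (\<Prod>m<CARD('n). [:- (xs ! m), 1:])"
      by (simp add: prod.list_conv_set_nth len lessThan_atLeast0)
    finally show ?thesis ..
  qed
  finally have "symmetrization z = S"
    by (simp add: vieta_poly_inject)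
  then show "\<exists>z. S = symmetrization z" by blast
qed

text \<open>
Cauchy's bound on the roots of a polynomial shows that the symmetrization is a proper map.
\<close>

lemma norm_root_le:
  fixes S :: "complex ^ 'n::{finite,linorder}"
  assumes "poly (vieta_poly S) x = 0"
  shows "norm x \<le> 1 + (\<Sum>k\<in>UNIV. norm (S $ k))"
proof (cases "norm x \<le> 1")
  case False
  have "x ^ CARD('n) = - (\<Sum>k\<in>UNIV. (-1) ^ card {..k} * S $ k * x ^ (CARD('n) - card {..k}))"
    using assms by (simp add: poly_vieta_poly eq_neg_iff_add_eq_0)
  then have "norm x ^ CARD('n) = norm (\<Sum>k\<in>UNIV. (-1) ^ card {..k} * S $ k * x ^ (CARD('n) - card {..k}))"
    by (metis norm_minus_cancel norm_power)
  also have "\<dots> \<le> (\<Sum>k\<in>UNIV. norm (S $ k) * norm x ^ (CARD('n) - 1))"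
  proof (rule sum_norm_le)
    fix k :: 'n
    have "norm x ^ (CARD('n) - card {..k}) \<le> norm x ^ (CARD('n) - 1)"
      by (rule power_increasing) (use False card_atMost_bounds[of k] in auto)
    then show "norm ((-1) ^ card {..k} * S $ k * x ^ (CARD('n) - card {..k})) \<le> norm (S $ k) * norm x ^ (CARD('n) - 1)"
      by (simp add: norm_mult norm_power mult_left_mono)
  qed
  also have "\<dots> = (\<Sum>k\<in>UNIV. norm (S $ k)) * norm x ^ (CARD('n) - 1)"
    by (simp add: sum_distrib_right)
  also have "norm x ^ CARD('n) = norm x * norm x ^ (CARD('n) - 1)"
    by (simp add: power_eq_if)
  finally have "norm x \<le> (\<Sum>k\<in>UNIV. norm (S $ k))"
    using False
    by (metis linorder_not_le mult_le_cancel_right_pos zero_less_one order_less_trans zero_less_power)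
  then show ?thesis by simp
next
  case True
  then show ?thesis
    using sum_nonneg[of UNIV "\<lambda>k. norm (S $ k)"] by simp
qed

lemma has_derivative_vec:
  fixes f :: "'a::real_normed_vector \<Rightarrow> 'n::finite \<Rightarrow> 'b::euclidean_space"
  assumes "\<And>i. ((\<lambda>x. f x i) has_derivative (\<lambda>v. f' v i)) (at a within S)"
  shows "((\<lambda>x. \<chi> i. f x i) has_derivative (\<lambda>v. \<chi> i. f' v i)) (at a within S)"
  unfolding has_derivative_componentwise_within[of "\<lambda>x. \<chi> i. f x i"]
  by (auto simp: Basis_vec_def inner_axis intro!: has_derivative_inner_left assms)

lemma vec_nth_has_derivative: "((\<lambda>z. z $ i) has_derivative (\<lambda>v. v $ i)) F"
  by (rule bounded_linear_imp_has_derivative) (rule bounded_linear_vec_nth)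

lemma elem_sym_has_derivative:
  "(elem_sym m has_derivative
     (\<lambda>v. \<Sum>A | card A = m. \<Sum>i\<in>A. v $ i * (\<Prod>j\<in>A - {i}. z $ j))) (at z)"
  unfolding elem_sym_def[abs_def]
  by (intro has_derivative_sum has_derivative_prod vec_nth_has_derivative)

definition symmetrization_deriv ::
    "complex ^ 'n::{finite,linorder} \<Rightarrow> complex ^ 'n::{finite,linorder} \<Rightarrow> complex ^ 'n::{finite,linorder}"
  where
  "symmetrization_deriv z v =
     (\<chi> k. \<Sum>A | card A = card {..k}. \<Sum>i\<in>A. v $ i * (\<Prod>j\<in>A - {i}. z $ j))"

lemma symmetrization_has_derivative:
  "(symmetrization has_derivative symmetrization_deriv z) (at z)"
  unfolding symmetrization_def[abs_def] symmetrization_deriv_def[abs_def]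
  by (intro has_derivative_vec elem_sym_has_derivative)

lemma continuous_symmetrization: "continuous_on A symmetrization"
  by (meson continuous_at_imp_continuous_on has_derivative_continuous symmetrization_has_derivative)

text \<open>
A convergent sequence of images is bounded, so by the bound on roots it is the image of a sequence
in a compact part of \<open>C\<close>.
\<close>

lemma closed_symmetrization_image:
  fixes C :: "(complex ^ 'n::{finite,linorder}) set"
  assumes "closed C"
  shows "closed (symmetrization ` C)"
  unfolding closed_sequential_limits
proof (intro allI impI, elim conjE)
  fix X L assume X: "\<forall>n. X n \<in> symmetrization ` C" and lim: "X \<longlonglongrightarrow> L"
  have "\<forall>n. \<exists>z. z \<in> C \<and> X n = symmetrization z"
    using X by blast
  from choice[OF this] obtain Z where Z: "\<And>n. Z n \<in> C" "\<And>n. X n = symmetrization (Z n)"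
    by blast
  have "Bseq X"
    using lim by (intro convergent_imp_Bseq) (auto simp: convergent_def)
  then obtain B where B: "\<And>n. norm (X n) \<le> B"
    unfolding Bseq_def by blast
  define R where "R = CARD('n) * (1 + CARD('n) * B)"
  have "norm (Z n) \<le> R" for n
  proof -
    have comp: "norm (Z n $ i) \<le> 1 + CARD('n) * B" for i
    proof -
      have "poly (vieta_poly (X n)) (Z n $ i) = 0"
        by (simp add: Z(2) poly_vieta_poly_symmetrization) (metis (mono_tags) UNIV_I diff_self finite prod_zero_iff)
      then have "norm (Z n $ i) \<le> 1 + (\<Sum>k\<in>UNIV. norm (X n $ k))"
        by (rule norm_root_le)
      also have "(\<Sum>k\<in>UNIV. norm (X n $ k)) \<le> (\<Sum>k\<in>(UNIV::'n set). B)"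
        by (intro sum_mono) (rule order_trans[OF Finite_Cartesian_Product.norm_nth_le B])
      finally show ?thesis by simp
    qed
    have "norm (Z n) \<le> (\<Sum>i\<in>UNIV. norm (Z n $ i))"
      unfolding norm_vec_def by (rule L2_set_le_sum) auto
    also have "\<dots> \<le> (\<Sum>i\<in>(UNIV::'n set). 1 + CARD('n) * B)"
      by (intro sum_mono comp)
    finally show ?thesis by (simp add: R_def)
  qed
  then have mem: "X n \<in> symmetrization ` (C \<inter> cball 0 R)" for n
    unfolding Z(2) by (intro imageI) (simp add: Z(1))
  have "compact (C \<inter> cball 0 R)"
    using assms by (rule closed_Int_compact) (rule compact_cball)
  then have "closed (symmetrization ` (C \<inter> cball 0 R))"
    by (intro compact_imp_closed compact_continuous_image continuous_symmetrization)
  then have "L \<in> symmetrization ` (C \<inter> cball 0 R)"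
    by (rule closed_sequentially) (use mem lim in auto)
  then show "L \<in> symmetrization ` C" by blast
qed

text \<open>
The fibres are the orbits of the permutations, so an invariant set and its complement have
complementary images, and the image of the closed complement is closed.
\<close>

lemma open_symmetrization_image:
  fixes U :: "(complex ^ 'n::{finite,linorder}) set"
  assumes "open U" and perm: "\<And>z p. z \<in> U \<Longrightarrow> p permutes UNIV \<Longrightarrow> (\<chi> i. z $ p i) \<in> U"
  shows "open (symmetrization ` U)"
proof -
  have "symmetrization ` U = - symmetrization ` (- U)"
  proof (intro equalityI subsetI)
    fix S assume "S \<in> symmetrization ` U"
    then show "S \<in> - symmetrization ` (- U)"
      by (auto elim!: symmetrization_eqD dest: perm)
  next
    fix S assume "S \<in> - symmetrization ` (- U)"
    moreover obtain z where "S = symmetrization z" using surj_symmetrization by (metis surjD)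
    ultimately show "S \<in> symmetrization ` U" by auto
  qed
  then show ?thesis
    using closed_symmetrization_image[of "- U"] assms by (simp add: open_closed closed_Compl)
qed

section \<open>The Jacobian determinant of the symmetrization\<close>

text \<open>
Let \<open>E\<close> map the (signed) coefficients of a polynomial of degree below \<open>d\<close> to its values at the points
\<open>z\<^sub>i\<close>. Differentiating \<open>\<Prod>j. x - z\<^sub>j\<close> with respect to \<open>z\<close>, once as a product and once through its
coefficients, and putting \<open>x = z\<^sub>i\<close> shows that \<open>E\<close> composed with the derivative of the
symmetrization is diagonal with entries \<open>- (\<Prod>j\<noteq>i. z\<^sub>i - z\<^sub>j)\<close>; its volume factor is the square of
the claimed value \<open>\<Delta>\<close>. The polynomials \<open>\<Prod>j>k. x - z\<^sub>j\<close> of Newton's interpolation formula are monic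
of each degree below \<open>d\<close>, so the matrix \<open>T\<close> of their coefficients is triangular with diagonal entries
\<open>\<plusminus>1\<close>. Their values at the points \<open>z\<^sub>i\<close> form a triangular matrix as well, with volume factor \<open>\<Delta>\<close>. Hence
\<open>E\<close> has volume factor \<open>\<Delta>\<close> too, and \<open>\<Delta>\<close> remains for the derivative.
\<close>

lemma rdet_symmetrization_deriv:
  fixes z :: "complex ^ 'n::{finite,linorder}"
  assumes dist: "\<And>i j. i \<noteq> j \<Longrightarrow> z $ i \<noteq> z $ j"
  shows "rdet (symmetrization_deriv z) = (\<Prod>(i, j) \<in> {(i, j). i < j}. (norm (z $ i - z $ j))\<^sup>2)"
proof -
  let ?d = "CARD('n)" and ?c = "\<lambda>k::'n. card {..k}" and ?L = "symmetrization_deriv z"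
  define E where "E = (\<chi> (i::'n) (k::'n). (-1) ^ ?c k * z $ i ^ (?d - ?c k))"
  define newton where "newton k = (\<Prod>j\<in>{k<..}. [:- (z $ j), 1:])" for k
  define T where "T = (\<chi> (l::'n) (k::'n). (-1) ^ ?c l * coeff (newton k) (?d - ?c l))"
  define \<Delta> where "\<Delta> = (\<Prod>i\<in>UNIV. \<Prod>j\<in>{i<..}. (norm (z $ i - z $ j))\<^sup>2)"
  have linL: "linear ?L"
    using symmetrization_has_derivative has_derivative_linear by blast
  have EL: "E *v ?L v = (\<chi> i. - (\<Prod>j\<in>UNIV - {i}. z $ i - z $ j) * v $ i)" for v
  proof (rule vec_eq_iff[THEN iffD2, rule_format])
    fix i
    let ?x = "z $ i"
    have "((\<lambda>y. poly (vieta_poly (symmetrization y)) ?x) has_derivative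
        (\<lambda>v. \<Sum>k\<in>UNIV. (-1) ^ ?c k * ?L v $ k * ?x ^ (?d - ?c k))) (at z)"
      unfolding poly_vieta_poly
      by (auto intro!: derivative_eq_intros has_derivative_compose[OF symmetrization_has_derivative vec_nth_has_derivative])
    moreover have "((\<lambda>y. poly (vieta_poly (symmetrization y)) ?x) has_derivative
        (\<lambda>v. \<Sum>l\<in>UNIV. - (v $ l) * (\<Prod>j\<in>UNIV - {l}. ?x - z $ j))) (at z)"
      unfolding poly_vieta_poly_symmetrization
      by (auto intro!: derivative_eq_intros vec_nth_has_derivative)
    ultimately have "(\<lambda>v. \<Sum>k\<in>UNIV. (-1) ^ ?c k * ?L v $ k * ?x ^ (?d - ?c k)) =
       (\<lambda>v. \<Sum>l\<in>UNIV. - (v $ l) * (\<Prod>j\<in>UNIV - {l}. ?x - z $ j))"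
      by (rule has_derivative_unique)
    then have "(\<Sum>k\<in>UNIV. (-1) ^ ?c k * ?L v $ k * ?x ^ (?d - ?c k)) =
       (\<Sum>l\<in>UNIV. - (v $ l) * (\<Prod>j\<in>UNIV - {l}. ?x - z $ j))"
      by metis
    also have "\<dots> = (\<Sum>l\<in>UNIV. if l = i then - (v $ i) * (\<Prod>j\<in>UNIV - {i}. ?x - z $ j) else 0)"
      by (intro sum.cong refl) (auto simp: prod_zero_iff)
    finally show "(E *v ?L v) $ i = (\<chi> i. - (\<Prod>j\<in>UNIV - {i}. z $ i - z $ j) * v $ i) $ i"
      by (simp add: E_def matrix_vector_mult_def mult_ac)
  qed
  have deg: "degree (newton k) = ?d - ?c k" for k
  proof -
    have "card {k<..} = ?d - ?c k"
      by (subst card_Diff_subset[symmetric]) (auto intro!: arg_cong[of _ _ card])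
    then show ?thesis by (simp add: newton_def degree_prod_sum_eq)
  qed
  have lead: "coeff (newton k) (?d - ?c k) = 1" for k
  proof -
    have "lead_coeff (newton k) = 1" by (simp add: newton_def lead_coeff_prod)
    then show ?thesis by (simp add: deg)
  qed
  have ET: "(E ** T) $ i $ k = (\<Prod>j\<in>{k<..}. z $ i - z $ j)" for i k
  proof -
    have "(E ** T) $ i $ k = (\<Sum>l\<in>UNIV. z $ i ^ (?d - ?c l) * coeff (newton k) (?d - ?c l))"
      by (simp add: E_def T_def matrix_matrix_mult_def mult_ac flip: power_add power_mult_distrib)
    also have "\<dots> = (\<Sum>m<?d. z $ i ^ m * coeff (newton k) m)"
      by (rule sum.reindex_bij_betw[OF bij_betw_codegree])
    also have "\<dots> = (\<Sum>m\<le>degree (newton k). z $ i ^ m * coeff (newton k) m)"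
      by (rule sum.mono_neutral_right) (use card_atMost_bounds[of k] in \<open>auto simp: deg coeff_eq_0\<close>)
    also have "\<dots> = poly (newton k) (z $ i)"
      by (simp add: poly_altdef mult.commute)
    finally show ?thesis by (simp add: newton_def poly_prod)
  qed
  have "rdet ((*v) T) = (\<Prod>i\<in>UNIV. (norm (T $ i $ i))\<^sup>2)"
  proof (rule rdet_triangular[where r = ?c])
    fix l k assume "T $ l $ k \<noteq> 0"
    then have "?d - ?c l \<le> ?d - ?c k"
      using le_degree[of "newton k"] by (auto simp: T_def deg)
    then have "?c k \<le> ?c l"
      using card_atMost_bounds(2)[of l] card_atMost_bounds(2)[of k] by linarith
    then show "k = l \<or> ?c k < ?c l"
      using inj_card_atMost by (metis injD le_neq_implies_less)
  qed (simp add: T_def lead)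
  then have rT: "rdet ((*v) T) = 1"
    by (simp add: T_def lead norm_power)
  have "rdet ((*v) (E ** T)) = (\<Prod>i\<in>UNIV. (norm ((E ** T) $ i $ i))\<^sup>2)"
  proof (rule rdet_triangular[where r = "\<lambda>k. ?d - ?c k"])
    fix i k assume "(E ** T) $ i $ k \<noteq> 0"
    then have "\<not> k < i" by (auto simp: ET prod_zero_iff)
    then show "k = i \<or> ?d - ?c k < ?d - ?c i"
      using card_atMost_less_iff[of i k] card_atMost_bounds[of k] card_atMost_bounds[of i]
      by (auto simp: not_less le_less diff_less_mono2)
  qed (use dist in \<open>auto simp: ET prod_zero_iff\<close>)
  then have rET: "rdet ((*v) (E ** T)) = \<Delta>"
    by (simp add: ET \<Delta>_def prod_norm[symmetric] prod_power_distrib)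
  have "(*v) (E ** T) = (*v) E \<circ> (*v) T"
    by (simp add: fun_eq_iff matrix_vector_mul_assoc)
  then have rE: "rdet ((*v) E) = \<Delta>"
    using rET rT by (simp add: rdet_compose linear_matrix_vector_mult)
  have "(*v) E \<circ> ?L = (\<lambda>v. \<chi> i. - (\<Prod>j\<in>UNIV - {i}. z $ i - z $ j) * v $ i)"
    using EL by (simp add: fun_eq_iff)
  then have "rdet ((*v) E) * rdet ?L = rdet (\<lambda>v. \<chi> i. - (\<Prod>j\<in>UNIV - {i}. z $ i - z $ j) * v $ i)"
    by (metis rdet_compose linear_matrix_vector_mult linL)
  also have "\<dots> = (\<Prod>i\<in>UNIV. \<Prod>j\<in>UNIV - {i}. (norm (z $ i - z $ j))\<^sup>2)"
    unfolding rdet_diagonal by (simp add: prod_norm[symmetric] prod_power_distrib)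
  also have "\<dots> = (\<Prod>i\<in>UNIV. (\<Prod>j\<in>{i<..}. (norm (z $ i - z $ j))\<^sup>2) * (\<Prod>j\<in>{..<i}. (norm (z $ i - z $ j))\<^sup>2))"
  proof (intro prod.cong refl)
    fix i :: 'n
    have split: "UNIV - {i} = {i<..} \<union> {..<i}" by auto
    show "(\<Prod>j\<in>UNIV - {i}. (norm (z $ i - z $ j))\<^sup>2) =
        (\<Prod>j\<in>{i<..}. (norm (z $ i - z $ j))\<^sup>2) * (\<Prod>j\<in>{..<i}. (norm (z $ i - z $ j))\<^sup>2)"
      unfolding split by (rule prod.union_disjoint) auto
  qed
  also have "\<dots> = \<Delta> * (\<Prod>i\<in>UNIV. \<Prod>j\<in>{..<i}. (norm (z $ i - z $ j))\<^sup>2)"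
    by (simp add: prod.distrib \<Delta>_def)
  also have "(\<Prod>i\<in>UNIV. \<Prod>j\<in>{..<i}. (norm (z $ i - z $ j))\<^sup>2) = \<Delta>"
    unfolding \<Delta>_def
    by (subst prod.swap_restrict[where R = "\<lambda>i j. j < i" and A = UNIV and B = UNIV, simplified, unfolded lessThan_def[symmetric] greaterThan_def[symmetric]])
       (auto simp: lessThan_def greaterThan_def norm_minus_commute)
  finally have "\<Delta> * rdet ?L = \<Delta> * \<Delta>"
    by (simp add: rE)
  moreover have "\<Delta> \<noteq> 0"
    using dist by (auto simp: \<Delta>_def prod_zero_iff)
  ultimately have "rdet ?L = \<Delta>" by simp
  also have "\<Delta> = (\<Prod>(i, j) \<in> (SIGMA i:UNIV. {i<..}). (norm (z $ i - z $ j))\<^sup>2)"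
    unfolding \<Delta>_def by (rule prod.Sigma) auto
  also have "(SIGMA i:UNIV. {i<..}) = {(i, j). i < (j::'n)}" by auto
  finally show ?thesis .
qed

section \<open>Symmetric functions as holomorphic functions on the symmetrized polydisc\<close>

lemma bounded_linear_coeff_sum:
  "bounded_linear (\<lambda>v::complex^'n. \<Sum>k\<in>UNIV. c k * v $ k)"
  by (intro bounded_linear_sum bounded_linear_compose[OF bounded_linear_mult_right bounded_linear_vec_nth])

lemma poly_pderiv_vieta_poly:
  fixes S :: "complex ^ 'n::{finite,linorder}"
  shows "poly (pderiv (vieta_poly S)) x = of_nat CARD('n) * x ^ (CARD('n) - 1) +
     (\<Sum>k\<in>UNIV. (-1) ^ card {..k} * of_nat (CARD('n) - card {..k}) * x ^ (CARD('n) - card {..k} - 1) * S $ k)"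
  by (simp add: vieta_poly_def pderiv_add sum_comp_morphism[OF pderiv_0 pderiv_add, symmetric, unfolded o_def] pderiv_monom poly_sum poly_monom mult_ac)

lemma logarithmic_derivative_vieta_poly:
  fixes z :: "complex ^ 'n::{finite,linorder}"
  assumes "\<And>i. x \<noteq> z $ i"
  shows "poly (pderiv (vieta_poly (symmetrization z))) x / poly (vieta_poly (symmetrization z)) x =
    (\<Sum>i\<in>UNIV. 1 / (x - z $ i))"
proof -
  have "poly (pderiv (vieta_poly (symmetrization z))) x = (\<Sum>i\<in>UNIV. \<Prod>j\<in>UNIV - {i}. x - z $ j)"
    by (simp add: vieta_poly_symmetrization pderiv_prod poly_sum poly_prod pderiv_pCons)
  also have "\<dots> / (\<Prod>j\<in>UNIV. x - z $ j) = (\<Sum>i\<in>UNIV. 1 / (x - z $ i))"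
    unfolding sum_divide_distrib
  proof (intro sum.cong refl)
    fix i :: 'n
    have "(\<Prod>j\<in>UNIV. x - z $ j) = (x - z $ i) * (\<Prod>j\<in>UNIV - {i}. x - z $ j)"
      by (rule prod.remove) auto
    moreover have "(\<Prod>j\<in>UNIV - {i}. x - z $ j) \<noteq> 0"
      using assms by (simp add: prod_zero_iff)
    ultimately show "(\<Prod>j\<in>UNIV - {i}. x - z $ j) / (\<Prod>j\<in>UNIV. x - z $ j) = 1 / (x - z $ i)"
      by simp
  qed
  finally show ?thesis by (simp add: poly_vieta_poly_symmetrization)
qed

text \<open>
Cauchy's formula gives the value of \<open>h\<close> at each \<open>z\<^sub>i\<close>, and the Cauchy kernels of these points add up
to the logarithmic derivative of the polynomial with roots \<open>z\<^sub>i\<close>. The point of this formula is that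
its right-hand side mentions \<open>z\<close> only through the symmetrization.
\<close>

lemma sum_eq_contour_integral:
  fixes z :: "complex ^ 'n::{finite,linorder}"
  assumes h: "h holomorphic_on ball 0 1" and r: "r < 1" and z: "\<And>i. norm (z $ i) < r"
  shows "(\<Sum>i\<in>UNIV. h (z $ i)) = 1 / (2 * of_real pi * \<i>) * contour_integral (circlepath 0 r)
    (\<lambda>x. h x * (poly (pderiv (vieta_poly (symmetrization z))) x / poly (vieta_poly (symmetrization z)) x))"
proof -
  have "0 < r" using z[of undefined] norm_ge_zero order_le_less_trans by blast
  have "h holomorphic_on cball 0 r"
    by (rule holomorphic_on_subset[OF h]) (use r in auto)
  then have "((\<lambda>x. \<Sum>i\<in>UNIV. h x / (x - z $ i)) has_contour_integral
     (\<Sum>i\<in>UNIV. 2 * of_real pi * \<i> * h (z $ i))) (circlepath 0 r)"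
    by (intro has_contour_integral_sum Cauchy_integral_circlepath_simple) (auto simp: z)
  then have "((\<lambda>x. h x * (poly (pderiv (vieta_poly (symmetrization z))) x / poly (vieta_poly (symmetrization z)) x))
     has_contour_integral (\<Sum>i\<in>UNIV. 2 * of_real pi * \<i> * h (z $ i))) (circlepath 0 r)"
  proof (rule has_contour_integral_eq)
    fix x assume "x \<in> path_image (circlepath 0 r)"
    then have "x \<noteq> z $ i" for i
      using z[of i] \<open>0 < r\<close> by auto
    then show "(\<Sum>i\<in>UNIV. h x / (x - z $ i)) =
       h x * (poly (pderiv (vieta_poly (symmetrization z))) x / poly (vieta_poly (symmetrization z)) x)"
      by (simp add: logarithmic_derivative_vieta_poly sum_distrib_left)
  qed
  then show ?thesis
    by (simp add: contour_integral_unique sum_distrib_left[symmetric] sum_divide_distrib[symmetric])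
qed

lemma vec_holomorphic_onD:
  assumes "f vec_holomorphic_on S" "z \<in> S"
  obtains D where "(f has_derivative D) (at z)" "\<And>c v. D (c *s v) = c * D v"
  using assms unfolding vec_holomorphic_on_def by blast

lemma vec_holomorphic_on_const: "(\<lambda>z. c) vec_holomorphic_on S"
  unfolding vec_holomorphic_on_def by (auto intro!: exI[of _ "\<lambda>v. 0"])

lemma vec_holomorphic_on_diff:
  assumes "f vec_holomorphic_on S" "g vec_holomorphic_on S"
  shows "(\<lambda>z. f z - g z) vec_holomorphic_on S"
  unfolding vec_holomorphic_on_def
proof
  fix z assume z: "z \<in> S"
  obtain D where D: "(f has_derivative D) (at z)" "\<And>c v. D (c *s v) = c * D v"
    using vec_holomorphic_onD[OF assms(1) z] by blast
  obtain E where E: "(g has_derivative E) (at z)" "\<And>c v. E (c *s v) = c * E v"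
    using vec_holomorphic_onD[OF assms(2) z] by blast
  show "\<exists>D. ((\<lambda>z. f z - g z) has_derivative D) (at z) \<and> (\<forall>c v. D (c *s v) = c * D v)"
    using has_derivative_diff[OF D(1) E(1)] D(2) E(2)
    by (intro exI[of _ "\<lambda>v. D v - E v"]) (simp add: right_diff_distrib)
qed

lemma vec_holomorphic_on_mult:
  assumes "f vec_holomorphic_on S" "g vec_holomorphic_on S"
  shows "(\<lambda>z. f z * g z) vec_holomorphic_on S"
  unfolding vec_holomorphic_on_def
proof
  fix z assume z: "z \<in> S"
  obtain D where D: "(f has_derivative D) (at z)" "\<And>c v. D (c *s v) = c * D v"
    using vec_holomorphic_onD[OF assms(1) z] by blast
  obtain E where E: "(g has_derivative E) (at z)" "\<And>c v. E (c *s v) = c * E v"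
    using vec_holomorphic_onD[OF assms(2) z] by blast
  show "\<exists>D. ((\<lambda>z. f z * g z) has_derivative D) (at z) \<and> (\<forall>c v. D (c *s v) = c * D v)"
    using has_derivative_mult[OF D(1) E(1)] D(2) E(2)
    by (intro exI[of _ "\<lambda>v. f z * E v + D v * g z"]) (simp add: algebra_simps)
qed

lemma vec_holomorphic_on_prod:
  assumes "\<And>i. i \<in> I \<Longrightarrow> f i vec_holomorphic_on S"
  shows "(\<lambda>z. \<Prod>i\<in>I. f i z) vec_holomorphic_on S"
  using assms
  by (induction I rule: infinite_finite_induct)
     (auto intro: vec_holomorphic_on_const vec_holomorphic_on_mult)

definition descends :: "(complex ^ 'n::{finite,linorder} \<Rightarrow> complex) \<Rightarrow> bool" where
  "descends F \<longleftrightarrow> (\<exists>f. f vec_holomorphic_on symmetrized_polydisc \<and>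
     (\<forall>z\<in>polydisc. f (symmetrization z) = F z))"

lemma open_polydisc_radius: "open {z :: complex ^ 'n. \<forall>i. norm (z $ i) < r}"
proof -
  have "open (\<Inter>i. {z :: complex ^ 'n. norm (z $ i) < r})"
    by (intro open_INT ballI open_Collect_less continuous_intros) simp
  moreover have "(\<Inter>i. {z :: complex ^ 'n. norm (z $ i) < r}) = {z. \<forall>i. norm (z $ i) < r}"
    by auto
  ultimately show ?thesis by (simp only:)
qed

text \<open>
The sum is invariant under permutations, so it is a function of the symmetrization. Near the
image of \<open>z0\<close>, every point is the image of a point with all coordinates in a fixed disc of radius
\<open>r < 1\<close>, because the set of those images is open. There the contour integral over the circle of radius
\<open>r\<close> represents the function; its integrand is a quotient of functions that are affine in \<open>S\<close>, with a
denominator that does not vanish on the circle, and may be differentiated under the integral.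
\<close>

lemma descends_power_sum:
  assumes h: "h holomorphic_on ball 0 1"
  shows "descends (\<lambda>z :: complex ^ 'n::{finite,linorder}. \<Sum>i\<in>UNIV. h (z $ i))"
proof -
  define f where "f S = (\<Sum>i\<in>UNIV. h ((SOME z. z \<in> polydisc \<and> symmetrization z = S) $ i))"
    for S :: "complex ^ 'n::{finite,linorder}"
  have f: "f (symmetrization z) = (\<Sum>i\<in>UNIV. h (z $ i))" if "z \<in> polydisc" for z :: "complex ^ 'n::{finite,linorder}"
  proof -
    define z' where "z' = (SOME z'. z' \<in> polydisc \<and> symmetrization z' = symmetrization z)"
    have "z' \<in> polydisc \<and> symmetrization z' = symmetrization z"
      unfolding z'_def by (rule someI[of _ z]) (use that in auto)
    then obtain p where p: "p permutes UNIV" "z' = (\<chi> i. z $ p i)"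
      using symmetrization_eqD[of z z'] by metis
    have "f (symmetrization z) = (\<Sum>i\<in>UNIV. h (z' $ i))"
      by (simp add: f_def z'_def)
    also have "\<dots> = (\<Sum>i\<in>UNIV. h (z $ i))"
      using sum.permute[OF p(1), of "\<lambda>i. h (z $ i)"] by (simp add: p(2) o_def)
    finally show ?thesis .
  qed
  have "f vec_holomorphic_on symmetrized_polydisc"
    unfolding vec_holomorphic_on_def
  proof
    fix S0 :: "complex ^ 'n::{finite,linorder}" assume "S0 \<in> symmetrized_polydisc"
    then obtain z0 where z0: "z0 \<in> polydisc" "S0 = symmetrization z0"
      by (auto simp: symmetrized_polydisc_def)
    obtain r where r: "r < 1" "\<And>i. norm (z0 $ i) < r"
    proof -
      have "Max (range (\<lambda>i. norm (z0 $ i))) < 1"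
        using z0(1) by (simp add: polydisc_def)
      then obtain r where "Max (range (\<lambda>i. norm (z0 $ i))) < r" "r < 1"
        using dense by blast
      then show ?thesis by (intro that) auto
    qed
    have "0 < r" using r(2)[of undefined] norm_ge_zero order_le_less_trans by blast
    define D where "D = {z :: complex ^ 'n::{finite,linorder}. \<forall>i. norm (z $ i) < r}"
    have "open (symmetrization ` D)"
      unfolding D_def by (rule open_symmetrization_image[OF open_polydisc_radius]) simp
    moreover have "S0 \<in> symmetrization ` D"
      using r z0 by (auto simp: D_def)
    ultimately obtain e where e: "e > 0" "ball S0 e \<subseteq> symmetrization ` D"
      by (meson open_contains_ball)
    define U where "U = ball S0 e"
    define c where "c t = circlepath 0 r t" for t
    define w where "w t = h (c t) * (2 * of_real pi * \<i> * of_real r * exp (2 * of_real pi * \<i> * of_real t))" for t :: real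
    define P where "P S t = poly (vieta_poly S) (c t)" for S :: "complex ^ 'n::{finite,linorder}" and t
    define P' where "P' S t = poly (pderiv (vieta_poly S)) (c t)" for S :: "complex ^ 'n::{finite,linorder}" and t
    define A where "A t v = (\<Sum>k\<in>UNIV. (-1) ^ card {..k} * c t ^ (CARD('n) - card {..k}) * v $ k)"
      for t and v :: "complex ^ 'n::{finite,linorder}"
    define A' where "A' t v = (\<Sum>k\<in>UNIV. (-1) ^ card {..k} * of_nat (CARD('n) - card {..k}) * c t ^ (CARD('n) - card {..k} - 1) * v $ k)"
      for t and v :: "complex ^ 'n::{finite,linorder}"
    have P: "P S t = c t ^ CARD('n) + A t S" "P' S t = of_nat CARD('n) * c t ^ (CARD('n) - 1) + A' t S" for S t
      by (simp_all add: P_def P'_def A_def A'_def poly_vieta_poly poly_pderiv_vieta_poly mult_ac)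
    have norm_c: "norm (c t) = r" for t
      using \<open>0 < r\<close> by (simp add: c_def circlepath norm_mult)
    have P_nz: "P S t \<noteq> 0" if "S \<in> U" for S t
    proof -
      from that e obtain z where z: "S = symmetrization z" "\<And>i. norm (z $ i) < r"
        by (auto simp: U_def D_def)
      then have "c t \<noteq> z $ i" for i
        using norm_c[of t] by (metis less_irrefl)
      then show ?thesis by (simp add: P_def z(1) poly_vieta_poly_symmetrization prod_zero_iff)
    qed
    have cont_c: "continuous_on X (\<lambda>x. c (g x))" if "continuous_on X g" for X and g :: "'x::topological_space \<Rightarrow> real"
      unfolding c_def circlepath using that by (intro continuous_intros)
    have cont_w: "continuous_on X (\<lambda>x. w (g x))" if "continuous_on X g" for X and g :: "'x::topological_space \<Rightarrow> real"
    proof -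
      have "continuous_on X (\<lambda>x. h (c (g x)))"
        by (rule continuous_on_compose2[OF holomorphic_on_imp_continuous_on[OF h] cont_c[OF that]])
           (use norm_c r(1) in auto)
      then show ?thesis unfolding w_def using that by (intro continuous_intros)
    qed
    have rep: "f S = 1 / (2 * of_real pi * \<i>) * integral (cbox 0 1) (\<lambda>t. w t * (P' S t / P S t))" if "S \<in> U" for S
    proof -
      from that e obtain z where z: "S = symmetrization z" "\<And>i. norm (z $ i) < r"
        by (auto simp: U_def D_def)
      then have "z \<in> polydisc" using r(1) by (auto simp: polydisc_def intro: less_trans)
      then have "f S = (\<Sum>i\<in>UNIV. h (z $ i))" by (simp add: z(1) f)
      also have "\<dots> = 1 / (2 * of_real pi * \<i>) * contour_integral (circlepath 0 r)
         (\<lambda>x. h x * (poly (pderiv (vieta_poly S)) x / poly (vieta_poly S) x))"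
        unfolding z(1) by (rule sum_eq_contour_integral[OF h r(1) z(2)])
      also have "contour_integral (circlepath 0 r)
         (\<lambda>x. h x * (poly (pderiv (vieta_poly S)) x / poly (vieta_poly S) x)) =
         integral (cbox 0 1) (\<lambda>t. w t * (P' S t / P S t))"
        unfolding contour_integral_integral box_real
        by (rule integral_cong) (simp add: vector_derivative_circlepath vector_derivative_circlepath01 w_def P_def P'_def c_def mult_ac)
      finally show ?thesis .
    qed
    \<comment> \<open>By the quotient rule, the derivative of the integrand in \<open>S\<close>; \<open>A t\<close> and \<open>A' t\<close> are the linear parts of \<open>P\<close> and \<open>P'\<close>.\<close>
    define fx where "fx S t = Blinfun (\<lambda>v. w t * ((A' t v * P S t - P' S t * A t v) / (P S t * P S t)))" for S t
    have lin_A: "bounded_linear (A t)" "bounded_linear (A' t)" for t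
      unfolding A_def[abs_def] A'_def[abs_def] by (rule bounded_linear_coeff_sum)+
    have fx: "blinfun_apply (fx S t) = (\<lambda>v. w t * ((A' t v * P S t - P' S t * A t v) / (P S t * P S t)))" for S t
      unfolding fx_def divide_inverse
      by (intro bounded_linear_Blinfun_apply bounded_linear_const_mult bounded_linear_mult_const
           bounded_linear_sub lin_A)
    have cont_A: "continuous_on X (\<lambda>x. A (g x) (k x))" "continuous_on X (\<lambda>x. A' (g x) (k x))"
      if "continuous_on X g" "continuous_on X k" for X and g :: "'x::topological_space \<Rightarrow> real" and k
      unfolding A_def A'_def using that by (intro continuous_intros cont_c; simp)+
    have cont_P: "continuous_on X (\<lambda>x. P (k x) (g x))" "continuous_on X (\<lambda>x. P' (k x) (g x))"
      if "continuous_on X g" "continuous_on X k" for X and g :: "'x::topological_space \<Rightarrow> real" and k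
      unfolding P using that by (intro continuous_intros cont_c cont_A; simp)+
    have "((\<lambda>S. integral (cbox 0 1) (\<lambda>t. w t * (P' S t / P S t))) has_derivative
        integral (cbox 0 1) (fx S0)) (at S0 within U)"
    proof (rule leibniz_rule)
      fix S t assume "S \<in> U"
      have dA: "(A t has_derivative A t) (at S within U)" "(A' t has_derivative A' t) (at S within U)"
        by (intro bounded_linear_imp_has_derivative lin_A)+
      show "((\<lambda>S. w t * (P' S t / P S t)) has_derivative blinfun_apply (fx S t)) (at S within U)"
        unfolding fx using P_nz[OF \<open>S \<in> U\<close>, of t]
        by (intro has_derivative_mult_right has_derivative_divide')
           (auto simp: P intro!: derivative_eq_intros dA)
    next
      fix S assume "S \<in> U"
      show "(\<lambda>t. w t * (P' S t / P S t)) integrable_on cbox 0 1"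
        by (intro integrable_continuous continuous_intros cont_w cont_P) (use P_nz \<open>S \<in> U\<close> in auto)
    next
      show "continuous_on (U \<times> cbox 0 1) (\<lambda>(S, t). fx S t)"
        unfolding split_beta
      proof (rule continuous_on_blinfun_componentwise)
        fix b :: "complex ^ 'n::{finite,linorder}"
        show "continuous_on (U \<times> cbox 0 1) (\<lambda>x. blinfun_apply (fx (fst x) (snd x)) b)"
          unfolding fx
          by (intro continuous_intros cont_w cont_P cont_A) (use P_nz in auto)
      qed
    qed (use e in \<open>auto simp: U_def\<close>)
    then have "((\<lambda>S. 1 / (2 * of_real pi * \<i>) * integral (cbox 0 1) (\<lambda>t. w t * (P' S t / P S t))) has_derivative
        (\<lambda>v. 1 / (2 * of_real pi * \<i>) * integral (cbox 0 1) (fx S0) v)) (at S0 within U)"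
      by (rule has_derivative_mult_right)
    then have "(f has_derivative (\<lambda>v. 1 / (2 * of_real pi * \<i>) * integral (cbox 0 1) (fx S0) v)) (at S0 within U)"
      by (rule has_derivative_transform[rotated 2]) (use rep e in \<open>auto simp: U_def\<close>)
    then have der: "(f has_derivative (\<lambda>v. 1 / (2 * of_real pi * \<i>) * integral (cbox 0 1) (fx S0) v)) (at S0)"
      using e by (subst (asm) at_within_open) (auto simp: U_def)
    have "S0 \<in> U" using e by (simp add: U_def)
    have int_fx: "fx S0 integrable_on cbox 0 1"
    proof (intro integrable_continuous continuous_on_blinfun_componentwise)
      fix b :: "complex ^ 'n::{finite,linorder}"
      show "continuous_on (cbox 0 1) (\<lambda>t. blinfun_apply (fx S0 t) b)"
        unfolding fx
        by (intro continuous_intros cont_w cont_P cont_A) (use P_nz \<open>S0 \<in> U\<close> in auto)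
    qed
    have scale: "A t (a *s v) = a * A t v" "A' t (a *s v) = a * A' t v" for t a v
      by (simp_all add: A_def A'_def sum_distrib_left mult_ac)
    have "integral (cbox 0 1) (fx S0) (a *s v) = a * integral (cbox 0 1) (fx S0) v" for a v
    proof -
      have "integral (cbox 0 1) (fx S0) (a *s v) = integral (cbox 0 1) (\<lambda>t. a * fx S0 t v)"
        unfolding blinfun_apply_integral[OF int_fx] fx scale
        by (intro integral_cong) (simp add: field_simps)
      also have "\<dots> = a * integral (cbox 0 1) (\<lambda>t. fx S0 t v)"
        by (rule integral_mult_right)
      finally show ?thesis by (simp only: blinfun_apply_integral[OF int_fx])
    qed
    then show "\<exists>D. (f has_derivative D) (at S0) \<and> (\<forall>a v. D (a *s v) = a * D v)"
      using der by (intro exI conjI allI) (auto simp: mult_ac)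
  qed
  then show ?thesis unfolding descends_def using f by blast
qed

lemma descends_const: "descends (\<lambda>z. c)"
  unfolding descends_def using vec_holomorphic_on_const by blast

lemma descends_diff: "descends F \<Longrightarrow> descends G \<Longrightarrow> descends (\<lambda>z. F z - G z)"
  unfolding descends_def using vec_holomorphic_on_diff by (metis (no_types, lifting))

lemma descends_mult: "descends F \<Longrightarrow> descends G \<Longrightarrow> descends (\<lambda>z. F z * G z)"
  unfolding descends_def using vec_holomorphic_on_mult by (metis (no_types, lifting))

lemma descends_sum:
  assumes "\<And>i. i \<in> I \<Longrightarrow> descends (F i)"
  shows "descends (\<lambda>z. \<Sum>i\<in>I. F i z)"
  using assms
proof (induction I rule: infinite_finite_induct)
  case (insert i I)
  have "descends (\<lambda>z. F i z - (0 - (\<Sum>i\<in>I. F i z)))"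
    using insert by (intro descends_diff descends_const) auto
  with insert show ?case by simp
qed (simp_all add: descends_const)

text \<open>
Extensional functions only, so that distinct members differ on \<open>A\<close> and a finite \<open>A\<close> has finitely many.
\<close>

definition injections :: "'b set \<Rightarrow> ('b \<Rightarrow> 'n) set" where
  "injections A = {\<phi> \<in> A \<rightarrow>\<^sub>E UNIV. inj_on \<phi> A}"

lemma finite_injections: "finite A \<Longrightarrow> finite (injections A :: ('b \<Rightarrow> 'n::finite) set)"
  unfolding injections_def by (rule finite_subset[OF _ finite_PiE[of A "\<lambda>_. UNIV"]]) auto

text \<open>
To extend an injection of \<open>A\<close> to \<open>a\<close> is to choose a value outside its range. Allow all values first;
what has to be subtracted are the extensions that repeat a value \<open>\<phi> k\<close>, and in these the factor of
\<open>a\<close> can be merged into the factor of \<open>k\<close>.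
\<close>

lemma sum_injections_insert:
  fixes g :: "'b \<Rightarrow> 'n::finite \<Rightarrow> 'c::comm_ring_1"
  assumes A: "finite A" "a \<notin> A"
  shows "(\<Sum>\<phi>\<in>injections (insert a A). \<Prod>j\<in>insert a A. g j (\<phi> j)) =
    (\<Sum>i\<in>UNIV. g a i) * (\<Sum>\<phi>\<in>injections A. \<Prod>j\<in>A. g j (\<phi> j)) -
    (\<Sum>k\<in>A. \<Sum>\<phi>\<in>injections A. \<Prod>j\<in>A. (g(k := \<lambda>i. g k i * g a i)) j (\<phi> j))"
proof -
  let ?p = "\<lambda>\<phi>. \<Prod>j\<in>A. g j (\<phi> j)"
  have "(\<Sum>\<phi>\<in>injections (insert a A). \<Prod>j\<in>insert a A. g j (\<phi> j)) =
      (\<Sum>(\<phi>, i)\<in>(SIGMA \<phi>:injections A. UNIV - \<phi> ` A). g a i * ?p \<phi>)"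
  proof (rule sum.reindex_bij_witness[of _ "\<lambda>(\<phi>, i). \<phi>(a := i)" "\<lambda>\<phi>. (\<phi>(a := undefined), \<phi> a)"])
    fix \<phi> :: "'b \<Rightarrow> 'n" assume \<phi>: "\<phi> \<in> injections (insert a A)"
    have "(\<Prod>j\<in>A. g j ((\<phi>(a := undefined)) j)) = ?p \<phi>"
      by (rule prod.cong) (use A in auto)
    then show "(case (\<phi>(a := undefined), \<phi> a) of (\<phi>, i) \<Rightarrow> g a i * ?p \<phi>) = (\<Prod>j\<in>insert a A. g j (\<phi> j))"
      using A by simp
    have "inj_on (\<phi>(a := undefined)) A"
      using \<phi> A by (auto simp: injections_def inj_on_def fun_upd_apply)
    moreover have "\<phi> a \<notin> (\<phi>(a := undefined)) ` A"
      using \<phi> A by (auto simp: injections_def inj_on_def)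
    ultimately show "(\<phi>(a := undefined), \<phi> a) \<in> (SIGMA \<phi>:injections A. UNIV - \<phi> ` A)"
      using \<phi> by (auto simp: injections_def PiE_def extensional_def)
  next
    fix x assume "x \<in> (SIGMA \<phi>:injections A. UNIV - (\<phi> :: 'b \<Rightarrow> 'n) ` A)"
    then obtain \<phi> i where x: "x = (\<phi>, i)" "\<phi> \<in> injections A" "i \<notin> \<phi> ` A" by auto
    have "\<phi> a = undefined"
      using x(2) A by (auto simp: injections_def PiE_def extensional_def)
    then show "(\<lambda>\<phi>. (\<phi>(a := undefined), \<phi> a)) (case x of (\<phi>, i) \<Rightarrow> \<phi>(a := i)) = x"
      by (auto simp: x(1) fun_eq_iff)
    show "(case x of (\<phi>, i) \<Rightarrow> \<phi>(a := i)) \<in> injections (insert a A)"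
      using x A by (auto simp: injections_def PiE_def extensional_def inj_on_def)
  qed auto
  also have "\<dots> = (\<Sum>\<phi>\<in>injections A. (\<Sum>i\<in>UNIV - \<phi> ` A. g a i) * ?p \<phi>)"
    by (subst sum.Sigma[symmetric]) (auto simp: finite_injections A sum_distrib_right)
  also have "\<dots> = (\<Sum>\<phi>\<in>injections A. (\<Sum>i\<in>UNIV. g a i) * ?p \<phi> -
      (\<Sum>k\<in>A. \<Prod>j\<in>A. (g(k := \<lambda>i. g k i * g a i)) j (\<phi> j)))"
  proof (intro sum.cong refl)
    fix \<phi> :: "'b \<Rightarrow> 'n" assume \<phi>: "\<phi> \<in> injections A"
    have "(\<Sum>i\<in>UNIV - \<phi> ` A. g a i) = (\<Sum>i\<in>UNIV. g a i) - (\<Sum>i\<in>\<phi> ` A. g a i)"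
      by (rule sum_diff) auto
    moreover have "(\<Sum>i\<in>\<phi> ` A. g a i) = (\<Sum>k\<in>A. g a (\<phi> k))"
      using \<phi> by (subst sum.reindex) (auto simp: injections_def)
    moreover have "g a (\<phi> k) * ?p \<phi> = (\<Prod>j\<in>A. (g(k := \<lambda>i. g k i * g a i)) j (\<phi> j))" if "k \<in> A" for k
    proof -
      have "(\<Prod>j\<in>A - {k}. (g(k := \<lambda>i. g k i * g a i)) j (\<phi> j)) = (\<Prod>j\<in>A - {k}. g j (\<phi> j))"
        by (rule prod.cong) auto
      then show ?thesis
        using that A by (simp add: prod.remove[of A k] mult_ac)
    qed
    ultimately show "(\<Sum>i\<in>UNIV - \<phi> ` A. g a i) * ?p \<phi> = (\<Sum>i\<in>UNIV. g a i) * ?p \<phi> -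
      (\<Sum>k\<in>A. \<Prod>j\<in>A. (g(k := \<lambda>i. g k i * g a i)) j (\<phi> j))"
      by (simp add: left_diff_distrib sum_distrib_right)
  qed
  also have "\<dots> = (\<Sum>i\<in>UNIV. g a i) * (\<Sum>\<phi>\<in>injections A. ?p \<phi>) -
    (\<Sum>k\<in>A. \<Sum>\<phi>\<in>injections A. \<Prod>j\<in>A. (g(k := \<lambda>i. g k i * g a i)) j (\<phi> j))"
    by (simp add: sum_subtractf sum_distrib_left sum.swap[of _ "injections A"])
  finally show ?thesis .
qed

text \<open>
By induction on the number of factors, the sum is a polynomial in power sums of products of the
functions \<open>g j\<close>.
\<close>

lemma descends_sum_injections:
  fixes g :: "'b \<Rightarrow> complex \<Rightarrow> complex"
  assumes "finite A" "\<And>j. j \<in> A \<Longrightarrow> g j holomorphic_on ball 0 1"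
  shows "descends (\<lambda>z :: complex ^ 'n::{finite,linorder}. \<Sum>\<phi>\<in>injections A. \<Prod>j\<in>A. g j (z $ \<phi> j))"
  using assms
proof (induction A arbitrary: g rule: finite_induct)
  case empty
  then show ?case by (simp add: descends_const)
next
  case (insert a A)
  have eq: "(\<Sum>\<phi>\<in>injections (insert a A). \<Prod>j\<in>insert a A. g j (z $ \<phi> j)) =
    (\<Sum>i\<in>UNIV. g a (z $ i)) * (\<Sum>\<phi>\<in>injections A. \<Prod>j\<in>A. g j (z $ \<phi> j)) -
    (\<Sum>k\<in>A. \<Sum>\<phi>\<in>injections A. \<Prod>j\<in>A. (g(k := \<lambda>x. g k x * g a x)) j (z $ \<phi> j))"
    for z :: "complex ^ 'n::{finite,linorder}"
  proof -
    have "((\<lambda>j i. g j (z $ i))(k := \<lambda>i. g k (z $ i) * g a (z $ i))) j i =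
        (g(k := \<lambda>x. g k x * g a x)) j (z $ i)" for k j i
      by simp
    then show ?thesis
      using sum_injections_insert[OF insert(1,2), of "\<lambda>j i. g j (z $ i)"] by simp
  qed
  show ?case
    unfolding eq
  proof (intro descends_diff descends_mult)
    show "descends (\<lambda>z :: complex ^ 'n::{finite,linorder}. \<Sum>i\<in>UNIV. g a (z $ i))"
      using insert.prems by (intro descends_power_sum) auto
    show "descends (\<lambda>z :: complex ^ 'n::{finite,linorder}. \<Sum>\<phi>\<in>injections A. \<Prod>j\<in>A. g j (z $ \<phi> j))"
      using insert.prems by (intro insert.IH) auto
    show "descends (\<lambda>z :: complex ^ 'n::{finite,linorder}.
        \<Sum>k\<in>A. \<Sum>\<phi>\<in>injections A. \<Prod>j\<in>A. (g(k := \<lambda>x. g k x * g a x)) j (z $ \<phi> j))"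
      using insert.prems by (intro descends_sum insert.IH) (auto intro: holomorphic_on_mult)
  qed
qed

lemma permanent_eq_sum_columns:
  "permanent A = (\<Sum>p | p permutes UNIV. \<Prod>j\<in>UNIV. A $ p j $ j)"
proof -
  have "permanent A = (\<Sum>p | p permutes UNIV. \<Prod>i\<in>UNIV. A $ i $ inv p i)"
    unfolding permanent_def by (rule sum_permutations_inverse)
  also have "\<dots> = (\<Sum>p | p permutes UNIV. \<Prod>j\<in>UNIV. A $ p j $ j)"
  proof (intro sum.cong refl)
    fix p :: "'b \<Rightarrow> 'b" assume "p \<in> {p. p permutes UNIV}"
    then have p: "p permutes UNIV" by simp
    show "(\<Prod>i\<in>UNIV. A $ i $ inv p i) = (\<Prod>j\<in>UNIV. A $ p j $ j)"
      using prod.permute[OF p, of "\<lambda>i. A $ i $ inv p i"] by (simp add: o_def permutes_inverses[OF p])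
  qed
  finally show ?thesis .
qed

lemma descends_permanent:
  fixes g :: "'n::{finite,linorder} \<Rightarrow> complex \<Rightarrow> complex"
  assumes "\<And>j. g j holomorphic_on ball 0 1"
  shows "descends (\<lambda>z :: complex ^ 'n::{finite,linorder}. permanent (\<chi> i j. g j (z $ i)))"
proof -
  have "(injections UNIV :: ('n \<Rightarrow> 'n) set) = {p. p permutes UNIV}"
    by (auto simp: injections_def permutes_inj bij_def finite_UNIV_inj_surj intro: bij_imp_permutes)
  moreover have "descends (\<lambda>z :: complex ^ 'n::{finite,linorder}. \<Sum>\<phi>\<in>injections UNIV. \<Prod>j\<in>UNIV. g j (z $ \<phi> j))"
    using assms by (intro descends_sum_injections) auto
  ultimately show ?thesis
    by (simp add: permanent_eq_sum_columns)
qed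

section \<open>The weighted measure on the polydisc\<close>

lemma borel_measurable_vec_complex:
  fixes f :: "'a \<Rightarrow> complex ^ 'n"
  assumes [measurable]: "\<And>i. (\<lambda>x. f x $ i) \<in> borel_measurable M"
  shows "f \<in> borel_measurable M"
proof (subst borel_measurable_euclidean_space, intro ballI)
  fix b :: "complex ^ 'n" assume "b \<in> Basis"
  then obtain i u where "b = axis i u" by (auto simp: Basis_vec_def)
  then show "(\<lambda>x. f x \<bullet> b) \<in> borel_measurable M"
    by (simp add: inner_axis)
qed

lemma measurable_vec_lambda_complex [measurable]:
  "(vec_lambda :: ('n::finite \<Rightarrow> complex) \<Rightarrow> _) \<in> borel_measurable (\<Pi>\<^sub>M i\<in>UNIV. lborel)"
  by (rule borel_measurable_vec_complex) simp

lemma distr_vec_lambda_lborel: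
  "distr (\<Pi>\<^sub>M i\<in>UNIV. lborel) borel vec_lambda = (lborel :: (complex ^ 'n) measure)"
proof (rule lborel_eqI[symmetric])
  interpret product_sigma_finite "\<lambda>i::'n. lborel :: complex measure"
    by standard
  fix l u :: "complex ^ 'n"
  assume le: "\<And>b. b \<in> Basis \<Longrightarrow> l \<bullet> b \<le> u \<bullet> b"
  have lu: "Re (l $ i) \<le> Re (u $ i)" "Im (l $ i) \<le> Im (u $ i)" for i
    using le[of "axis i 1"] le[of "axis i \<i>"] by (simp_all add: axis_in_Basis_iff inner_axis inner_complex_def Basis_complex_def)
  have pre: "vec_lambda -` box l u \<inter> space (\<Pi>\<^sub>M i\<in>UNIV. lborel) = (\<Pi>\<^sub>E i\<in>UNIV. box (l $ i) (u $ i))"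
    by (auto simp: mem_box Basis_vec_complex ball_Un inner_axis PiE_def Pi_iff Basis_complex_def space_PiM inner_complex_def)
  have "emeasure (distr (\<Pi>\<^sub>M i\<in>UNIV. lborel) borel vec_lambda) (box l u) = (\<Prod>i\<in>UNIV. emeasure lborel (box (l $ i) (u $ i)))"
    by (subst emeasure_distr) (auto simp: pre intro!: emeasure_PiM)
  also have "\<dots> = (\<Prod>i\<in>UNIV. ennreal ((Re (u $ i) - Re (l $ i)) * (Im (u $ i) - Im (l $ i))))"
    by (intro prod.cong refl, subst emeasure_lborel_box)
       (auto simp: Basis_complex_def inner_complex_def lu complex_eq_iff)
  also have "\<dots> = ennreal (\<Prod>i\<in>UNIV. (Re (u $ i) - Re (l $ i)) * (Im (u $ i) - Im (l $ i)))"
    by (intro prod_ennreal) (simp add: lu)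
  also have "(\<Prod>i\<in>UNIV. (Re (u $ i) - Re (l $ i)) * (Im (u $ i) - Im (l $ i))) = (\<Prod>b\<in>Basis. (u - l) \<bullet> b)"
    by (simp add: prod_Basis_complex_vec inner_axis inner_complex_def)
  finally show "emeasure (distr (\<Pi>\<^sub>M i\<in>UNIV. lborel) borel vec_lambda) (box l u) = ennreal (\<Prod>b\<in>Basis. (u - l) \<bullet> b)"
    .
qed simp

lemma measurable_vec_nth_complex [measurable]: "(\<lambda>z::complex^'n. z $ i) \<in> borel_measurable borel"
  by (intro borel_measurable_continuous_onI continuous_intros)

lemma ball_borel [measurable]: "ball (c::complex) r \<in> sets borel"
  by simp

lemma nn_integral_prod_coordinates:
  fixes f :: "'n::finite \<Rightarrow> complex \<Rightarrow> ennreal"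
  assumes [measurable]: "\<And>i. f i \<in> borel_measurable borel"
  shows "(\<integral>\<^sup>+ z. (\<Prod>i\<in>UNIV. f i (z $ i)) \<partial>lborel) = (\<Prod>i\<in>UNIV. \<integral>\<^sup>+ x. f i x \<partial>lborel)"
proof -
  interpret product_sigma_finite "\<lambda>i::'n. lborel :: complex measure"
    by standard
  have "(\<integral>\<^sup>+ z. (\<Prod>i\<in>UNIV. f i (z $ i)) \<partial>lborel) =
        (\<integral>\<^sup>+ x. (\<Prod>i\<in>UNIV. f i (x i)) \<partial>(\<Pi>\<^sub>M i\<in>UNIV. lborel))"
    unfolding distr_vec_lambda_lborel[symmetric] by (subst nn_integral_distr) auto
  also have "\<dots> = (\<Prod>i\<in>UNIV. \<integral>\<^sup>+ x. f i x \<partial>lborel)"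
    by (rule product_nn_integral_prod) auto
  finally show ?thesis .
qed

text \<open>
For \<open>0 \<le> t < 1\<close>, the function exceeds \<open>t\<close> on the disc of radius \<open>sqrt (1 - t)\<close>, which has area \<open>pi * (1 - t)\<close>.
\<close>

lemma distr_disc_radial:
  "distr (density lborel (indicator (ball 0 1))) borel (\<lambda>x::complex. 1 - (norm x)\<^sup>2) =
   density lborel (\<lambda>t. indicator {0..1} t * ennreal pi)" (is "?L = ?R")
proof (rule measure_eqI_lessThan)
  have L: "emeasure ?L {t<..} = emeasure lborel {x::complex. t < 1 - (norm x)\<^sup>2 \<and> norm x < 1}" for t
  proof -
    have "emeasure ?L {t<..} = (\<integral>\<^sup>+ x. indicator (ball 0 1) x * indicator {x::complex. t < 1 - (norm x)\<^sup>2} x \<partial>lborel)"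
      by (subst emeasure_distr) (auto simp: emeasure_density vimage_def)
    also have "\<dots> = (\<integral>\<^sup>+ x. indicator {x::complex. t < 1 - (norm x)\<^sup>2 \<and> norm x < 1} x \<partial>lborel)"
      by (intro nn_integral_cong) (auto simp: indicator_def)
    finally show ?thesis by simp
  qed
  have R: "emeasure ?R {t<..} = ennreal pi * emeasure lborel ({0..1} \<inter> {t<..})" for t
  proof -
    have "emeasure ?R {t<..} = (\<integral>\<^sup>+ x. ennreal pi * indicator ({0..1} \<inter> {t<..}) x \<partial>lborel)"
      by (subst emeasure_density) (auto intro!: nn_integral_cong simp: indicator_def)
    then show ?thesis by (simp add: nn_integral_cmult)
  qed
  show "emeasure ?L {t<..} = emeasure ?R {t<..}" for t :: real
  proof -
    consider "t < 0" | "0 \<le> t" "t < 1" | "1 \<le> t" by linarith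
    then show ?thesis
    proof cases
      case 1
      then have "{x::complex. t < 1 - (norm x)\<^sup>2 \<and> norm x < 1} = ball 0 1"
        using power_le_one[of "norm (x::complex)" 2 for x] by (auto simp: less_imp_le) (smt (verit) norm_ge_zero power_le_one)
      moreover have "{0..1} \<inter> {t<..} = {0..1}" using 1 by auto
      ultimately show ?thesis by (simp add: L R emeasure_ball eval_unit_ball_vol)
    next
      case 2
      have "norm x < sqrt (1 - t) \<longleftrightarrow> t < 1 - (norm x)\<^sup>2" for x :: complex
        using 2 real_less_rsqrt[of "norm x" "1 - t"] real_sqrt_less_iff[of "(norm x)\<^sup>2" "1 - t"] by auto
      moreover have "norm x < 1" if "t < 1 - (norm x)\<^sup>2" for x :: complex
        using that 2 power_less_one_iff[of "norm x" 2] by auto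
      ultimately have "{x::complex. t < 1 - (norm x)\<^sup>2 \<and> norm x < 1} = ball 0 (sqrt (1 - t))"
        by auto
      moreover have "emeasure lborel ({0..1} \<inter> {t<..}) = ennreal (1 - t)"
      proof -
        have "{0..1} \<inter> {t<..} = {t<..1}" using 2 by auto
        then show ?thesis using 2 by simp
      qed
      ultimately show ?thesis
        using 2 by (simp add: L R emeasure_ball eval_unit_ball_vol ennreal_mult)
    next
      case 3
      then have "{x::complex. t < 1 - (norm x)\<^sup>2 \<and> norm x < 1} = {}" "{0..1} \<inter> {t<..} = {}"
        by auto (smt (verit) zero_le_power2)
      then show ?thesis by (simp only: L R) simp
    qed
  qed
  show "emeasure ?L {t<..} < \<infinity>" for t :: real
  proof -
    have "emeasure ?L {t<..} \<le> emeasure lborel (ball (0::complex) 1)"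
      unfolding L by (rule emeasure_mono) auto
    also have "\<dots> < \<infinity>" by (simp add: emeasure_ball)
    finally show ?thesis .
  qed
qed auto

lemma nn_integral_disc_weight:
  assumes "lam > 1"
  shows "(\<integral>\<^sup>+ x. indicator (ball (0::complex) 1) x *
     ennreal ((lam - 1) / pi * (1 - (norm x)\<^sup>2) powr (lam - 2)) \<partial>lborel) = 1"
proof -
  have "(\<integral>\<^sup>+ x. indicator (ball (0::complex) 1) x *
      ennreal ((lam - 1) / pi * (1 - (norm x)\<^sup>2) powr (lam - 2)) \<partial>lborel) =
    (\<integral>\<^sup>+ t. ennreal ((lam - 1) / pi * t powr (lam - 2))
       \<partial>distr (density lborel (indicator (ball 0 1))) borel (\<lambda>x::complex. 1 - (norm x)\<^sup>2))"
    by (subst nn_integral_distr) (auto simp: nn_integral_density)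
  also have "\<dots> = (\<integral>\<^sup>+ t. ennreal (indicator {0..1} t * ((lam - 1) * t powr (lam - 2))) \<partial>lborel)"
    unfolding distr_disc_radial
    by (subst nn_integral_density)
       (use assms in \<open>auto intro!: nn_integral_cong simp: indicator_def ennreal_mult[symmetric]\<close>)
  also have "\<dots> = ennreal 1"
  proof (rule nn_integral_has_integral_lebesgue)
    have "((\<lambda>t. t powr (lam - 2)) has_integral (1 powr (lam - 2 + 1) / (lam - 2 + 1))) {0..1}"
      by (rule has_integral_powr_from_0) (use assms in auto)
    from has_integral_mult_right[OF this, of "lam - 1"]
    show "((\<lambda>t. (lam - 1) * t powr (lam - 2)) has_integral 1) {0..1}"
      using assms by simp
  qed (use assms in auto)
  finally show ?thesis by simp
qed

definition disc_weight :: "real \<Rightarrow> complex ^ 'n \<Rightarrow> real" where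
  "disc_weight lam z = (\<Prod>i\<in>UNIV. (lam - 1) / pi * (1 - (norm (z $ i))\<^sup>2) powr (lam - 2))"

text \<open>
The measure \<open>\<omega> dV\<close> of the weighted Bergman space on the polydisc: the powers of \<open>pi\<close> in
\<open>disc_weight\<close> account for the normalization of the volume.
\<close>

definition polydisc_measure :: "real \<Rightarrow> (complex ^ 'n) measure" where
  "polydisc_measure lam = density lborel (\<lambda>z. indicator polydisc z * ennreal (disc_weight lam z))"

lemma open_polydisc: "open (polydisc :: (complex ^ 'n) set)"
  using open_polydisc_radius[of 1] by (simp add: polydisc_def)

lemma bounded_polydisc: "bounded (polydisc :: (complex ^ 'n) set)"
proof (rule boundedI)
  fix z :: "complex ^ 'n"
  assume "z \<in> polydisc"
  then have "(\<Sum>i\<in>UNIV. norm (z $ i)) \<le> (\<Sum>i\<in>(UNIV :: 'n set). 1)"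
    by (intro sum_mono) (auto simp: polydisc_def less_imp_le)
  then show "norm z \<le> real CARD('n)"
    using L2_set_le_sum[of UNIV "\<lambda>i. norm (z $ i)"] by (simp add: norm_vec_def)
qed

lemma polydisc_borel [measurable]: "(polydisc :: (complex ^ 'n) set) \<in> sets borel"
  using open_polydisc by (rule borel_open)

lemma disc_weight_measurable [measurable]: "disc_weight lam \<in> borel_measurable borel"
  unfolding disc_weight_def[abs_def] by measurable

lemma disc_weight_nonneg: "lam > 1 \<Longrightarrow> 0 \<le> disc_weight lam z"
  unfolding disc_weight_def by (intro prod_nonneg) auto

lemma indicator_polydisc: "(indicator polydisc z :: 'a::{comm_semiring_1}) = (\<Prod>i\<in>UNIV. indicator (ball 0 1) (z $ i))"
proof (cases "z \<in> polydisc")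
  case False
  then obtain i where "z $ i \<notin> ball 0 1" by (auto simp: polydisc_def)
  then have "(\<Prod>i\<in>UNIV. indicator (ball 0 1) (z $ i)) = (0::'a)"
    by (intro prod_zero bexI[of _ i]) auto
  with False show ?thesis by simp
qed (auto simp: polydisc_def)

lemma emeasure_polydisc_measure_space:
  assumes "lam > 1"
  shows "emeasure (polydisc_measure lam :: (complex ^ 'n) measure) UNIV = 1"
proof -
  have "emeasure (polydisc_measure lam :: (complex ^ 'n) measure) UNIV =
      (\<integral>\<^sup>+ z. (\<Prod>i\<in>UNIV. indicator (ball 0 1) (z $ i) *
         ennreal ((lam - 1) / pi * (1 - (norm (z $ i))\<^sup>2) powr (lam - 2))) \<partial>(lborel :: (complex ^ 'n) measure))"
    unfolding polydisc_measure_def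
    by (subst emeasure_density)
       (use assms in \<open>auto intro!: nn_integral_cong simp: indicator_polydisc disc_weight_def prod.distrib prod_ennreal\<close>)
  also have "\<dots> = 1"
    by (subst nn_integral_prod_coordinates) (simp_all only: nn_integral_disc_weight[OF assms] prod.neutral_const, measurable)
  finally show ?thesis .
qed

lemma sets_polydisc_measure [simp, measurable_cong]: "sets (polydisc_measure lam) = sets borel"
  by (simp add: polydisc_measure_def)

lemma space_polydisc_measure [simp]: "space (polydisc_measure lam) = UNIV"
  by (simp add: polydisc_measure_def)

lemma finite_measure_polydisc_measure: "lam > 1 \<Longrightarrow> finite_measure (polydisc_measure lam)"
  by (intro finite_measureI) (simp add: emeasure_polydisc_measure_space)

lemma AE_polydisc_measure: "AE z in polydisc_measure lam. z \<in> polydisc"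
  unfolding polydisc_measure_def by (subst AE_density) (auto simp: indicator_def)

lemma emeasure_lborel_polydisc: "emeasure lborel (polydisc :: (complex ^ 'n) set) = ennreal (pi ^ CARD('n))"
proof -
  have "emeasure lborel (polydisc :: (complex ^ 'n) set) = (\<integral>\<^sup>+ z. indicator polydisc z \<partial>(lborel :: (complex ^ 'n) measure))"
    by simp
  also have "\<dots> = (\<Prod>i\<in>(UNIV::'n set). \<integral>\<^sup>+ x. indicator (ball (0::complex) 1) x \<partial>lborel)"
    unfolding indicator_polydisc by (rule nn_integral_prod_coordinates) auto
  also have "\<dots> = ennreal (pi ^ CARD('n))"
    by (simp add: emeasure_ball eval_unit_ball_vol ennreal_power)
  finally show ?thesis .
qed

lemma normalized_volume_eq:
  "(normalized_volume :: (complex ^ 'n) measure) = density lborel (\<lambda>z. ennreal (1 / pi ^ CARD('n)))"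
  unfolding normalized_volume_def emeasure_lborel_polydisc
  by (rule measure_eqI)
     (auto simp: emeasure_density nn_integral_cmult divide_ennreal[symmetric])

lemma polydisc_weight_eq:
  "polydisc_weight lam z = pi ^ CARD('n) * disc_weight lam (z :: complex ^ 'n)"
  by (simp add: polydisc_weight_def disc_weight_def prod.distrib prod_dividef power_divide)

lemma closed_coinciding_coordinates: "closed {z :: complex ^ 'n. \<exists>i j. i \<noteq> j \<and> z $ i = z $ j}"
proof -
  have "closed (\<Union>i. \<Union>j\<in>-{i}. {z :: complex ^ 'n. z $ i = z $ j})"
    by (intro closed_UN ballI closed_Collect_eq continuous_intros finite)
  also have "(\<Union>i. \<Union>j\<in>-{i}. {z :: complex ^ 'n. z $ i = z $ j}) = {z. \<exists>i j. i \<noteq> j \<and> z $ i = z $ j}"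
    by (rule set_eqI, simp add: Bex_def) metis
  finally show ?thesis .
qed

lemma diagonals_eq: "diagonals = polydisc \<inter> {z. \<exists>i j. i \<noteq> j \<and> z $ i = z $ j}"
  by (auto simp: diagonals_def)

lemma diagonals_borel [measurable]: "(diagonals :: (complex ^ 'n) set) \<in> sets borel"
  unfolding diagonals_eq by (intro sets.Int polydisc_borel borel_closed closed_coinciding_coordinates)

text \<open>
The diagonals lie in the union of the real hyperplanes \<open>Re z\<^sub>i = Re z\<^sub>j\<close>.
\<close>

lemma diagonals_null_sets: "(diagonals :: (complex ^ 'n) set) \<in> null_sets lborel"
proof -
  have neg: "negligible {z :: complex ^ 'n. (axis i 1 - axis j 1) \<bullet> z = 0}" if "i \<noteq> j" for i j
    by (rule negligible_hyperplane) (use that in \<open>auto simp: vec_eq_iff axis_def\<close>)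
  have "negligible (\<Union>i. \<Union>j\<in>-{i}. {z :: complex ^ 'n. (axis i 1 - axis j 1) \<bullet> z = 0})"
    by (auto intro!: negligible_Union neg)
  moreover have "(diagonals :: (complex ^ 'n) set) \<subseteq> (\<Union>i. \<Union>j\<in>-{i}. {z. (axis i 1 - axis j 1) \<bullet> z = 0})"
  proof
    fix z :: "complex ^ 'n" assume "z \<in> diagonals"
    then obtain i j where "i \<noteq> j" "z $ i = z $ j" by (auto simp: diagonals_def)
    then show "z \<in> (\<Union>i. \<Union>j\<in>-{i}. {z. (axis i 1 - axis j 1) \<bullet> z = 0})"
      by (intro UN_I[of i] UN_I[of j]) (auto simp: inner_diff_left inner_commute[of "axis _ _"] inner_axis)
  qed
  ultimately have "negligible (diagonals :: (complex ^ 'n) set)"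
    by (rule negligible_subset)
  then show ?thesis
    by (simp add: negligible_iff_null_sets null_sets_completion_iff diagonals_borel)
qed

section \<open>The mean value property on the polydisc\<close>

lemma borel_measurable_on_polydisc:
  fixes F :: "complex ^ 'n \<Rightarrow> complex"
  assumes "continuous_on polydisc F"
  shows "(\<lambda>z. indicator polydisc z *\<^sub>R F z) \<in> borel_measurable borel"
  using assms polydisc_borel by (intro borel_measurable_continuous_on_indicator) auto

lemma vec_holomorphic_on_imp_continuous_on:
  assumes "f vec_holomorphic_on S"
  shows "continuous_on S f"
proof (rule continuous_at_imp_continuous_on, rule ballI)
  fix z assume "z \<in> S"
  then obtain D where "(f has_derivative D) (at z)"
    using vec_holomorphic_onD[OF assms] by metis
  then show "isCont f z" by (rule has_derivative_continuous)
qed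

lemma vec_holomorphic_on_compose:
  assumes f: "f vec_holomorphic_on T"
    and g: "\<And>i. (\<lambda>z. g z $ i) vec_holomorphic_on S" and maps: "g ` S \<subseteq> T"
  shows "(\<lambda>z. f (g z)) vec_holomorphic_on S"
  unfolding vec_holomorphic_on_def
proof
  fix z assume z: "z \<in> S"
  then obtain D where D: "(f has_derivative D) (at (g z))" "\<And>c v. D (c *s v) = c * D v"
    using vec_holomorphic_onD[OF f] maps by blast
  have "\<exists>E. \<forall>i. ((\<lambda>z. g z $ i) has_derivative E i) (at z) \<and> (\<forall>c v. E i (c *s v) = c * E i v)"
    using g z unfolding vec_holomorphic_on_def by (intro choice) blast
  then obtain E where E: "\<And>i. ((\<lambda>z. g z $ i) has_derivative E i) (at z)" "\<And>i c v. E i (c *s v) = c * E i v"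
    by blast
  have "((\<lambda>z. \<chi> i. g z $ i) has_derivative (\<lambda>v. \<chi> i. E i v)) (at z)"
    by (intro has_derivative_vec E)
  then have "(g has_derivative (\<lambda>v. \<chi> i. E i v)) (at z)"
    by simp
  from has_derivative_compose[OF this D(1)]
  have "((\<lambda>z. f (g z)) has_derivative (\<lambda>v. D (\<chi> i. E i v))) (at z)" .
  moreover have "D (\<chi> i. E i (c *s v)) = c * D (\<chi> i. E i v)" for c v
  proof -
    have "(\<chi> i. E i (c *s v)) = c *s (\<chi> i. E i v)" by (simp add: vec_eq_iff E(2))
    then show ?thesis by (simp add: D(2))
  qed
  ultimately show "\<exists>D. ((\<lambda>z. f (g z)) has_derivative D) (at z) \<and> (\<forall>c v. D (c *s v) = c * D v)"
    by blast
qed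

lemma vec_holomorphic_on_coordinate:
  assumes h: "h holomorphic_on ball 0 1"
  shows "(\<lambda>z::complex ^ 'n. h (z $ i)) vec_holomorphic_on polydisc"
  unfolding vec_holomorphic_on_def
proof
  fix z :: "complex ^ 'n" assume "z \<in> polydisc"
  then have "(h has_field_derivative deriv h (z $ i)) (at (z $ i))"
    by (intro holomorphic_derivI[OF h]) (auto simp: polydisc_def)
  then have "(h has_derivative (\<lambda>u. deriv h (z $ i) * u)) (at (z $ i))"
    by (simp add: has_field_derivative_def)
  from has_derivative_compose[OF vec_nth_has_derivative this]
  show "\<exists>D. ((\<lambda>z. h (z $ i)) has_derivative D) (at z) \<and> (\<forall>c v. D (c *s v) = c * D v)"
    by (intro exI conjI) (assumption, auto)
qed

lemma rotation_polydisc_measure: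
  fixes u :: complex
  assumes u: "norm u = 1"
  shows "distr (polydisc_measure lam) borel ((*s) u) = (polydisc_measure lam :: (complex ^ 'n) measure)"
proof -
  let ?g = "(*s) u :: complex ^ 'n \<Rightarrow> _"
  have lin: "bounded_linear ?g"
    by (rule linear_conv_bounded_linear[THEN iffD1], rule linearI) (simp_all add: vec_eq_iff algebra_simps)
  have meas [measurable]: "?g \<in> borel_measurable borel"
    by (intro borel_measurable_continuous_onI linear_continuous_on lin)
  have "u \<noteq> 0" using u by auto
  have img: "?g ` polydisc = polydisc"
  proof (intro equalityI subsetI)
    fix z :: "complex ^ 'n" assume "z \<in> polydisc"
    then have "(inverse u) *s z \<in> polydisc" "z = ?g ((inverse u) *s z)"
      using u \<open>u \<noteq> 0\<close> by (auto simp: polydisc_def norm_mult norm_inverse vec_eq_iff)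
    then show "z \<in> ?g ` polydisc" by blast
  qed (use u in \<open>auto simp: polydisc_def norm_mult\<close>)
  have cv: "density lborel (indicator (?g ` polydisc)) =
        distr (density lborel (\<lambda>z. indicator polydisc z * ennreal 1)) borel ?g"
  proof (rule change_of_variables_complex_vec)
    show "bounded (?g ` polydisc)" unfolding img by (rule bounded_polydisc)
    show "inj_on ?g polydisc"
    proof (rule inj_onI)
      fix z z' :: "complex ^ 'n" assume "u *s z = u *s z'"
      then have "u * z $ i = u * z' $ i" for i by (metis vector_smult_component)
      then show "z = z'" using \<open>u \<noteq> 0\<close> by (simp add: vec_eq_iff)
    qed
    have "?g = (\<lambda>z. \<chi> i. u * z $ i)" by (rule ext) (simp add: vec_eq_iff)
    then have "rdet ?g = rdet (\<lambda>z :: complex ^ 'n. \<chi> i. u * z $ i)" by (rule arg_cong)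
    also have "\<dots> = 1" unfolding rdet_diagonal by (simp add: u)
    finally show "rdet ?g = 1" .
    show "(?g has_derivative ?g) (at z)" for z
      by (rule bounded_linear_imp_has_derivative[OF lin])
    show "?g ` polydisc \<in> sets borel" unfolding img by (rule polydisc_borel)
  qed (rule polydisc_borel meas borel_measurable_const)+
  have one: "(\<lambda>z::complex ^ 'n. indicator polydisc z * ennreal 1) = indicator polydisc"
    by (simp add: fun_eq_iff)
  have eq: "density lborel (indicator polydisc) = distr (density lborel (indicator polydisc)) borel ?g"
    by (rule cv[unfolded img one])
  have w: "disc_weight lam (?g z) = disc_weight lam z" for z
    by (simp add: disc_weight_def norm_mult u)
  have dens: "(polydisc_measure lam :: (complex ^ 'n) measure) = density (density lborel (indicator polydisc)) (\<lambda>z. ennreal (disc_weight lam z))"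
    unfolding polydisc_measure_def by (rule density_density_eq[symmetric]) auto
  also have "\<dots> = density (distr (density lborel (indicator polydisc)) borel ?g) (\<lambda>z. ennreal (disc_weight lam z))"
    by (simp only: eq[symmetric])
  also have "\<dots> = distr (density (density lborel (indicator polydisc)) (\<lambda>z. ennreal (disc_weight lam (?g z)))) borel ?g"
    by (rule density_distr) auto
  also have "\<dots> = distr (polydisc_measure lam) borel ?g"
    by (simp only: w dens)
  finally show ?thesis by simp
qed

text \<open>
The mean value property of the function \<open>\<lambda>\<zeta>. F (\<zeta> *s z)\<close> of one variable, which is holomorphic on a
neighbourhood of the closed unit disc.
\<close>

lemma circle_mean_value:
  assumes F: "F vec_holomorphic_on polydisc" and z: "z \<in> polydisc"
  shows "(LINT t:{0..1}|lborel. F (exp (2 * of_real pi * \<i> * of_real t) *s z)) = F 0"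
proof -
  define k where "k \<zeta> = F (\<zeta> *s z)" for \<zeta>
  have in_D: "\<zeta> *s z \<in> polydisc" if "norm \<zeta> \<le> 1" for \<zeta>
    using that z mult_left_le_one_le[of "norm (z $ i)" "norm \<zeta>" for i]
    by (auto simp: polydisc_def norm_mult intro: le_less_trans)
  have "k holomorphic_on cball 0 1"
    unfolding holomorphic_on_def
  proof
    fix \<zeta> :: complex assume "\<zeta> \<in> cball 0 1"
    then obtain D where D: "(F has_derivative D) (at (\<zeta> *s z))" "\<And>c v. D (c *s v) = c * D v"
      using vec_holomorphic_onD[OF F in_D] by auto
    have "((\<lambda>\<zeta>. \<zeta> *s z) has_derivative (\<lambda>h. h *s z)) (at \<zeta>)"
      by (rule bounded_linear_imp_has_derivative, rule linear_conv_bounded_linear[THEN iffD1], rule linearI)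
         (simp_all add: vec_eq_iff algebra_simps)
    from has_derivative_compose[OF this D(1)] have "(k has_derivative (\<lambda>h. h * D z)) (at \<zeta>)"
      by (simp add: D(2) k_def[abs_def])
    then have "(k has_field_derivative D z) (at \<zeta>)"
      by (simp add: has_field_derivative_def mult.commute[of _ "D z"])
    then show "k field_differentiable at \<zeta> within cball 0 1"
      using field_differentiable_at_within field_differentiable_def by blast
  qed
  then have cauchy: "((\<lambda>u. k u / (u - 0)) has_contour_integral (2 * of_real pi * \<i> * k 0)) (circlepath 0 1)"
    by (rule Cauchy_integral_circlepath_simple) simp
  have circle: "circlepath 0 1 t = exp (2 * of_real pi * \<i> * of_real t)" for t
    by (simp add: circlepath)
  have "((\<lambda>t. 2 * of_real pi * \<i> * k (exp (2 * of_real pi * \<i> * of_real t))) has_integral (2 * of_real pi * \<i> * k 0)) {0..1}"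
    by (rule has_integral_eq[OF _ cauchy[unfolded has_contour_integral_def]])
       (simp add: vector_derivative_circlepath01 circle)
  then have "((\<lambda>t. k (exp (2 * of_real pi * \<i> * of_real t))) has_integral k 0) {0..1}"
    by (subst (asm) has_integral_mult_right_iff) auto
  moreover have int: "set_integrable lborel {0..1} (\<lambda>t. k (exp (2 * of_real pi * \<i> * of_real t)))"
    unfolding set_integrable_def
  proof (rule borel_integrable_compact)
    show "continuous_on {0..1} (\<lambda>t. k (exp (2 * of_real pi * \<i> * of_real t)))"
      by (rule continuous_on_compose2[OF holomorphic_on_imp_continuous_on[OF \<open>k holomorphic_on cball 0 1\<close>]])
         (auto intro!: continuous_intros simp: norm_exp_eq_Re)
  qed auto
  ultimately show ?thesis
    using set_borel_integral_eq_integral(2)[OF int] by (simp add: integral_unique k_def)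
qed

text \<open>
Rotating all coordinates by the same angle preserves the measure. Averaging over the angle and
exchanging the integrals replaces \<open>F\<close> by its means over circles, which are all equal to \<open>F 0\<close>.
\<close>

lemma polydisc_mean_value:
  fixes F :: "complex ^ 'n \<Rightarrow> complex"
  assumes lam: "lam > 1" and F: "F vec_holomorphic_on polydisc"
    and int: "integrable (polydisc_measure lam) (\<lambda>z. indicator polydisc z *\<^sub>R F z)"
  shows "integral\<^sup>L (polydisc_measure lam) (\<lambda>z. indicator polydisc z *\<^sub>R F z) = F 0"
proof -
  define M :: "(complex ^ 'n) measure" where "M = polydisc_measure lam"
  define N where "N = density lborel (indicator {0..1::real})"
  define F0 where "F0 z = indicator polydisc z *\<^sub>R F z" for z
  define e where "e t = exp (2 * of_real pi * \<i> * of_real t)" for t :: real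
  interpret M: finite_measure M unfolding M_def using lam by (rule finite_measure_polydisc_measure)
  interpret N: finite_measure N
    by (rule finite_measureI) (simp add: N_def emeasure_density)
  interpret pair_sigma_finite N M ..
  have [measurable]: "F0 \<in> borel_measurable borel"
    unfolding F0_def[abs_def] by (intro borel_measurable_on_polydisc vec_holomorphic_on_imp_continuous_on F)
  have sets_M [measurable_cong, simp]: "sets M = sets borel" and sets_N [measurable_cong, simp]: "sets N = sets borel"
    by (simp_all add: M_def N_def)
  have meas_e [measurable]: "(\<lambda>p :: real \<times> (complex ^ 'n). e (fst p) *s snd p) \<in> borel_measurable borel"
    unfolding e_def vector_scalar_mult_def
    by (intro borel_measurable_continuous_onI continuous_on_vec_lambda continuous_intros)
  have sets_NM: "sets (N \<Otimes>\<^sub>M M) = sets (borel :: (real \<times> (complex ^ 'n)) measure)"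
    by (simp add: borel_prod[symmetric] cong: sets_pair_measure_cong)
  have norm_e: "norm (e t) = 1" for t by (simp add: e_def norm_exp_eq_Re)
  have rot: "integral\<^sup>L M (\<lambda>z. f (e t *s z)) = integral\<^sup>L M f"
    if [measurable]: "f \<in> borel_measurable borel" for t and f :: "complex ^ 'n \<Rightarrow> 'b::{banach, second_countable_topology}"
  proof -
    have [measurable]: "(\<lambda>z::complex ^ 'n. e t *s z) \<in> borel_measurable borel"
      unfolding vector_scalar_mult_def
      by (intro borel_measurable_continuous_onI continuous_on_vec_lambda continuous_intros)
    have "integral\<^sup>L M f = integral\<^sup>L (distr M borel ((*s) (e t))) f"
      by (simp add: M_def rotation_polydisc_measure norm_e)
    also have "\<dots> = integral\<^sup>L M (\<lambda>z. f (e t *s z))"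
      by (rule integral_distr) auto
    finally show ?thesis ..
  qed
  have rot_int: "integrable M (\<lambda>z. F0 (e t *s z))" for t
  proof -
    have [measurable]: "(\<lambda>z::complex ^ 'n. e t *s z) \<in> borel_measurable borel"
      unfolding vector_scalar_mult_def
      by (intro borel_measurable_continuous_onI continuous_on_vec_lambda continuous_intros)
    have "integrable (distr M borel ((*s) (e t))) F0"
      using int by (simp add: M_def F0_def[abs_def] rotation_polydisc_measure norm_e)
    then show ?thesis
      by (subst (asm) integrable_distr_eq) auto
  qed
  have int_NM: "integrable (N \<Otimes>\<^sub>M M) (\<lambda>(t, z). F0 (e t *s z))"
  proof (rule Fubini_integrable)
    show "(\<lambda>(t, z). F0 (e t *s z)) \<in> borel_measurable (N \<Otimes>\<^sub>M M)"
      unfolding split_beta measurable_cong_sets[OF sets_NM refl]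
      by measurable
    show "integrable N (\<lambda>t. LINT z|M. norm (case (t, z) of (t, z) \<Rightarrow> F0 (e t *s z)))"
      using rot[of "\<lambda>z. norm (F0 z)"] by simp
  qed (simp add: rot_int)
  from Fubini_integral[OF int_NM]
  have "(LINT z|M. LINT t|N. F0 (e t *s z)) = (LINT t|N. LINT z|M. F0 (e t *s z))" .
  also have "\<dots> = (LINT t|N. integral\<^sup>L M F0)"
    by (simp add: rot)
  also have "\<dots> = integral\<^sup>L M F0"
    by (simp add: measure_def N_def emeasure_density)
  also have "(LINT z|M. LINT t|N. F0 (e t *s z)) = (LINT z|M. F 0)"
  proof (rule integral_cong_AE)
    show "AE z in M. (LINT t|N. F0 (e t *s z)) = F 0"
      using AE_polydisc_measure[of lam] unfolding M_def
    proof eventually_elim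
      case (elim z)
      then have "e t *s z \<in> polydisc" for t
        by (auto simp: polydisc_def norm_mult norm_e)
      then have "(LINT t|N. F0 (e t *s z)) = (LINT t|N. F (e t *s z))"
        by (simp add: F0_def)
      also have "\<dots> = (LINT t:{0..1}|lborel. F (e t *s z))"
      proof -
        have "continuous_on UNIV (\<lambda>t. F (e t *s z))"
          by (rule continuous_on_compose2[OF vec_holomorphic_on_imp_continuous_on[OF F]])
             (use \<open>\<And>t. e t *s z \<in> polydisc\<close> in \<open>auto simp: vector_scalar_mult_def e_def intro!: continuous_on_vec_lambda continuous_intros\<close>)
        then have [measurable]: "(\<lambda>t. F (e t *s z)) \<in> borel_measurable borel"
          by (rule borel_measurable_continuous_onI)
        show ?thesis
          unfolding N_def set_lebesgue_integral_def
          using integral_density[of "\<lambda>t. F (e t *s z)" lborel "indicator {0..1}"] by (simp add: ennreal_indicator)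
      qed
      also have "\<dots> = F 0"
        unfolding e_def by (rule circle_mean_value[OF F elim])
      finally show ?case .
    qed
    show "(\<lambda>z. LINT t|N. F0 (e t *s z)) \<in> borel_measurable M"
      by (intro borel_measurable_integrable integrable_snd[OF int_NM])
  qed auto
  also have "(LINT z|M. F 0) = F 0"
    using emeasure_polydisc_measure_space[OF lam, where 'n='n] by (simp add: measure_def M_def)
  finally show ?thesis by (simp add: F0_def[abs_def] M_def)
qed

section \<open>Automorphisms of the polydisc and its reproducing kernel\<close>

text \<open>
The involutive automorphism of the unit disc that exchanges \<open>0\<close> and \<open>a\<close>.
\<close>

definition disc_moebius :: "complex \<Rightarrow> complex \<Rightarrow> complex" where
  "disc_moebius a x = (a - x) / (1 - cnj a * x)"

text \<open>
The modulus of the derivative of \<open>disc_moebius a\<close> at \<open>x\<close>.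
\<close>

definition moebius_jacobian :: "complex \<Rightarrow> complex \<Rightarrow> real" where
  "moebius_jacobian a x = (1 - (norm a)\<^sup>2) / (norm (1 - cnj a * x))\<^sup>2"

lemma Re_one_minus_pos:
  assumes "norm a < 1" "norm x \<le> 1"
  shows "0 < Re (1 - cnj a * x)"
proof -
  have "norm (cnj a * x) < 1"
    using assms mult_right_le_one_le[of "norm a" "norm x"] by (simp add: norm_mult)
  then show ?thesis
    using complex_Re_le_cmod[of "cnj a * x"] by simp
qed

lemma one_minus_cnj_mult_nonzero:
  assumes "norm a < 1" "norm x \<le> 1"
  shows "1 - cnj a * x \<noteq> 0"
  using Re_one_minus_pos[OF assms] by force

lemma norm_less_one_iff: "norm (x::complex) < 1 \<longleftrightarrow> 0 < 1 - (norm x)\<^sup>2"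
  using abs_square_less_1[of "norm x"] by simp

lemma moebius_jacobian_pos: "norm a < 1 \<Longrightarrow> norm x < 1 \<Longrightarrow> 0 < moebius_jacobian a x"
  using one_minus_cnj_mult_nonzero[of a x] norm_less_one_iff[of a]
  unfolding moebius_jacobian_def
  by (intro divide_pos_pos zero_less_power) simp_all

lemma one_minus_norm_moebius:
  assumes "norm a < 1" "norm x < 1"
  shows "1 - (norm (disc_moebius a x))\<^sup>2 = moebius_jacobian a x * (1 - (norm x)\<^sup>2)"
proof -
  have nz: "(norm (1 - cnj a * x))\<^sup>2 \<noteq> 0"
    using one_minus_cnj_mult_nonzero[of a x] assms by simp
  have "(norm (1 - cnj a * x))\<^sup>2 - (norm (a - x))\<^sup>2 = (1 - (norm a)\<^sup>2) * (1 - (norm x)\<^sup>2)"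
    unfolding cmod_power2 by (simp add: power2_eq_square algebra_simps)
  then show ?thesis
    using nz by (simp add: disc_moebius_def moebius_jacobian_def norm_divide power_divide field_simps)
qed

lemma norm_moebius_less_one:
  assumes "norm a < 1" "norm x < 1"
  shows "norm (disc_moebius a x) < 1"
  unfolding norm_less_one_iff one_minus_norm_moebius[OF assms]
  using moebius_jacobian_pos[OF assms] assms(2) by (simp add: norm_less_one_iff)

lemma one_minus_moebius:
  assumes "norm a < 1" "norm x < 1"
  shows "1 - cnj a * disc_moebius a x = of_real (1 - (norm a)\<^sup>2) / (1 - cnj a * x)"
  using one_minus_cnj_mult_nonzero[of a x] assms
  by (simp add: disc_moebius_def field_simps complex_norm_square[of a, unfolded of_real_power])

lemma moebius_involution:
  assumes "norm a < 1" "norm x < 1"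
  shows "disc_moebius a (disc_moebius a x) = x"
proof -
  let ?b = "1 - cnj a * x"
  have nz: "?b \<noteq> 0"
    using one_minus_cnj_mult_nonzero[of a x] assms by simp
  have s: "complex_of_real (1 - (norm a)\<^sup>2) \<noteq> 0"
    using assms by (simp only: of_real_eq_0_iff) (simp add: norm_less_one_iff)
  have "a - disc_moebius a x = x * complex_of_real (1 - (norm a)\<^sup>2) / ?b"
    using nz by (simp add: disc_moebius_def field_simps complex_norm_square[of a, unfolded of_real_power])
  then have "disc_moebius a (disc_moebius a x) =
      (x * complex_of_real (1 - (norm a)\<^sup>2) / ?b) / (complex_of_real (1 - (norm a)\<^sup>2) / ?b)"
    unfolding disc_moebius_def[of a "disc_moebius a x"] one_minus_moebius[OF assms] by simp
  also have "\<dots> = x" using s nz by (simp del: of_real_diff of_real_power)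
  finally show ?thesis .
qed

lemma moebius_has_field_derivative:
  assumes "norm a < 1" "norm x < 1"
  shows "(disc_moebius a has_field_derivative - of_real (1 - (norm a)\<^sup>2) / (1 - cnj a * x)\<^sup>2) (at x)"
proof -
  have nz: "1 - cnj a * x \<noteq> 0"
    using one_minus_cnj_mult_nonzero[of a x] assms by simp
  have "(disc_moebius a has_field_derivative
      ((0 - 1) * (1 - cnj a * x) - (a - x) * (0 - cnj a * 1)) / ((1 - cnj a * x) * (1 - cnj a * x))) (at x)"
    unfolding disc_moebius_def[abs_def] using nz by (intro derivative_intros DERIV_divide) auto
  moreover have "(0 - 1) * (1 - cnj a * x) - (a - x) * (0 - cnj a * 1) = - of_real (1 - (norm a)\<^sup>2)"
    by (simp add: complex_norm_square[of a, unfolded of_real_power] algebra_simps)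
  ultimately show ?thesis
    by (simp only: power2_eq_square)
qed

lemma holomorphic_moebius: "norm a < 1 \<Longrightarrow> disc_moebius a holomorphic_on ball 0 1"
  by (auto simp: holomorphic_on_open intro!: exI moebius_has_field_derivative)

definition polydisc_moebius :: "complex ^ 'n \<Rightarrow> complex ^ 'n \<Rightarrow> complex ^ 'n" where
  "polydisc_moebius w z = (\<chi> i. disc_moebius (w $ i) (z $ i))"

text \<open>
In each coordinate, let \<open>q\<close> be the modulus of the derivative of the automorphism. Volume is scaled by
\<open>q\<^sup>2\<close>, and \<open>1 - |x|\<^sup>2\<close> is multiplied by \<open>q\<close> under the automorphism, so the weight contributes
\<open>q powr (lam - 2)\<close>.
\<close>

lemma polydisc_measure_moebius:
  fixes w :: "complex ^ 'n"
  assumes lam: "lam > 1" and w: "w \<in> polydisc"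
  shows "polydisc_measure lam = distr (density (polydisc_measure lam)
      (\<lambda>z. ennreal (\<Prod>i\<in>UNIV. moebius_jacobian (w $ i) (z $ i) powr lam))) borel (polydisc_moebius w)"
proof -
  let ?g = "polydisc_moebius w"
  let ?J = "\<lambda>z::complex ^ 'n. \<Prod>i\<in>UNIV. (moebius_jacobian (w $ i) (z $ i))\<^sup>2"
  let ?W = "\<lambda>z::complex ^ 'n. disc_weight lam z"
  have w1: "norm (w $ i) < 1" for i using w by (simp add: polydisc_def)
  have g [measurable]: "?g \<in> borel_measurable borel"
    by (rule borel_measurable_vec_complex) (simp add: polydisc_moebius_def disc_moebius_def)
  have J [measurable]: "?J \<in> borel_measurable borel" "(\<lambda>z. \<Prod>i\<in>UNIV. moebius_jacobian (w $ i) (z $ i) powr lam) \<in> borel_measurable borel"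
    unfolding moebius_jacobian_def by measurable
  have maps: "?g z \<in> polydisc" if "z \<in> polydisc" for z
    using that w1 by (auto simp: polydisc_def polydisc_moebius_def intro: norm_moebius_less_one)
  have inv: "?g (?g z) = z" if "z \<in> polydisc" for z
    using that w1 by (auto simp: polydisc_def polydisc_moebius_def vec_eq_iff intro: moebius_involution)
  have img: "?g ` polydisc = polydisc"
    using maps inv by (metis image_subset_iff equalityI subsetI image_eqI)
  have cv: "density lborel (indicator (?g ` polydisc)) = distr (density lborel (\<lambda>z. indicator polydisc z * ennreal (?J z))) borel ?g"
  proof (rule change_of_variables_complex_vec)
    show "bounded (?g ` polydisc)" unfolding img by (rule bounded_polydisc)
    show "inj_on ?g polydisc" by (metis inj_on_inverseI inv)
    fix z :: "complex ^ 'n" assume z: "z \<in> polydisc"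
    then have z1: "norm (z $ i) < 1" for i by (simp add: polydisc_def)
    let ?a = "\<lambda>i. - of_real (1 - (norm (w $ i))\<^sup>2) / (1 - cnj (w $ i) * z $ i)\<^sup>2"
    have "((\<lambda>z. disc_moebius (w $ i) (z $ i)) has_derivative (\<lambda>v. ?a i * v $ i)) (at z)" for i
      using has_derivative_compose[OF vec_nth_has_derivative
          moebius_has_field_derivative[OF w1 z1, unfolded has_field_derivative_def]] .
    then show "(?g has_derivative (\<lambda>v. \<chi> i. ?a i * v $ i)) (at z)"
      unfolding polydisc_moebius_def[abs_def] by (intro has_derivative_vec)
    have "norm (?a i) = moebius_jacobian (w $ i) (z $ i)" for i
    proof -
      have "0 < 1 - (norm (w $ i))\<^sup>2" using w1[of i] by (simp only: norm_less_one_iff)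
      then show ?thesis
        by (simp only: norm_divide norm_minus_cancel norm_of_real norm_power moebius_jacobian_def abs_of_pos)
    qed
    then show "rdet (\<lambda>v. \<chi> i. ?a i * v $ i) = ?J z"
      unfolding rdet_diagonal by simp
  qed (auto simp: img)
  note eq = cv[unfolded img]
  have weight: "?J z * ?W (?g z) = ?W z * (\<Prod>i\<in>UNIV. moebius_jacobian (w $ i) (z $ i) powr lam)"
    if "z \<in> polydisc" for z
  proof -
    have factor: "(moebius_jacobian (w $ i) (z $ i))\<^sup>2 *
        ((lam - 1) / pi * (1 - (norm (disc_moebius (w $ i) (z $ i)))\<^sup>2) powr (lam - 2)) =
      (lam - 1) / pi * (1 - (norm (z $ i))\<^sup>2) powr (lam - 2) * moebius_jacobian (w $ i) (z $ i) powr lam" for i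
    proof -
      let ?q = "moebius_jacobian (w $ i) (z $ i)"
      have z1: "norm (z $ i) < 1" using that by (simp add: polydisc_def)
      have q: "?q > 0" by (rule moebius_jacobian_pos[OF w1 z1])
      have "?q\<^sup>2 * ?q powr (lam - 2) = ?q powr lam"
        using q by (simp add: powr_add[symmetric] flip: powr_numeral)
      then show ?thesis
        using q z1 by (simp add: one_minus_norm_moebius[OF w1 z1] powr_mult norm_less_one_iff mult_ac)
    qed
    show ?thesis
      by (simp only: disc_weight_def polydisc_moebius_def vec_lambda_beta prod.distrib[symmetric] factor)
  qed
  have "polydisc_measure lam = density (density lborel (indicator polydisc)) (\<lambda>z. ennreal (?W z))"
    unfolding polydisc_measure_def by (rule density_density_eq[symmetric]) auto
  also have "\<dots> = density (distr (density lborel (\<lambda>z. indicator polydisc z * ennreal (?J z))) borel ?g) (\<lambda>z. ennreal (?W z))"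
    by (simp only: eq[symmetric])
  also have "\<dots> = distr (density (density lborel (\<lambda>z. indicator polydisc z * ennreal (?J z))) (\<lambda>z. ennreal (?W (?g z)))) borel ?g"
    by (rule density_distr) auto
  also have "density (density lborel (\<lambda>z. indicator polydisc z * ennreal (?J z))) (\<lambda>z. ennreal (?W (?g z))) =
      density lborel (\<lambda>z. indicator polydisc z * ennreal (?J z) * ennreal (?W (?g z)))"
    by (rule density_density_eq) auto
  also have "\<dots> = density lborel (\<lambda>z. indicator polydisc z * ennreal (?W z) *
      ennreal (\<Prod>i\<in>UNIV. moebius_jacobian (w $ i) (z $ i) powr lam))"
    by (rule arg_cong[of _ _ "density lborel"])
       (auto simp: fun_eq_iff indicator_def ennreal_mult[symmetric] prod_nonneg disc_weight_nonneg lam weight)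
  also have "\<dots> = density (polydisc_measure lam) (\<lambda>z. ennreal (\<Prod>i\<in>UNIV. moebius_jacobian (w $ i) (z $ i) powr lam))"
    unfolding polydisc_measure_def by (rule density_density_eq[symmetric]) auto
  finally show ?thesis .
qed

definition polydisc_kernel :: "real \<Rightarrow> complex ^ 'n \<Rightarrow> complex ^ 'n \<Rightarrow> complex" where
  "polydisc_kernel lam z w = (\<Prod>i\<in>UNIV. (1 - z $ i * cnj (w $ i)) powr (- of_real lam))"

lemma holomorphic_kernel_factor:
  assumes "norm a < 1"
  shows "(\<lambda>x. (1 - x * cnj a) powr (- of_real lam)) holomorphic_on ball 0 1"
proof (intro holomorphic_intros)
  fix x :: complex assume "x \<in> ball 0 1"
  then show "1 - x * cnj a \<notin> \<real>\<^sub>\<le>\<^sub>0"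
    using Re_one_minus_pos[OF assms, of x] by (auto simp: complex_nonpos_Reals_iff mult.commute)
qed

text \<open>
With \<open>b = 1 - cnj a * x\<close> and \<open>s = 1 - |a|\<^sup>2\<close>, the Jacobian is \<open>s / (b * cnj b)\<close> and the kernel
is evaluated at \<open>s / b\<close>, so the conjugated kernel cancels \<open>s\<close> and \<open>cnj b\<close>. Since \<open>Re b > 0\<close>, the
principal logarithms of \<open>s\<close> and \<open>b\<close> subtract to that of \<open>s / b\<close>.
\<close>

lemma moebius_kernel_factor:
  assumes "norm a < 1" "norm x < 1"
  shows "of_real (moebius_jacobian a x powr lam) * cnj ((1 - disc_moebius a x * cnj a) powr (- of_real lam)) =
    (1 - x * cnj a) powr (- of_real lam)"
proof -
  define b where "b = 1 - cnj a * x"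
  define s where "s = 1 - (norm a)\<^sup>2"
  have s: "s > 0" using assms(1) by (simp only: s_def norm_less_one_iff)
  have Reb: "Re b > 0" unfolding b_def using Re_one_minus_pos assms by simp
  then have b: "b \<noteq> 0" "b \<notin> \<real>\<^sub>\<le>\<^sub>0" by (auto simp: complex_nonpos_Reals_iff)
  have "1 - disc_moebius a x * cnj a = of_real s * inverse b"
    using one_minus_moebius[OF assms] by (simp add: s_def b_def divide_inverse mult.commute)
  moreover have "Ln (of_real s * inverse b) = of_real (ln s) - Ln b"
    using s b by (simp add: Ln_times_of_real Ln_inverse Ln_of_real)
  ultimately have 1: "(1 - disc_moebius a x * cnj a) powr (- of_real lam) = exp (- of_real lam * (of_real (ln s) - Ln b))"
    using s b by (simp add: powr_def)
  have LnLn: "complex_of_real (2 * ln (norm b)) = Ln b + cnj (Ln b)"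
    using b by (simp add: complex_add_cnj)
  have "moebius_jacobian a x powr lam = exp (lam * (ln s - 2 * ln (norm b)))"
  proof -
    have "moebius_jacobian a x = s / (norm b)\<^sup>2"
      by (simp add: moebius_jacobian_def s_def b_def)
    then show ?thesis
      using s b by (simp add: powr_def ln_div ln_realpow)
  qed
  then have 2: "of_real (moebius_jacobian a x powr lam) = exp (of_real lam * (of_real (ln s) - (Ln b + cnj (Ln b))))"
    by (simp only: exp_of_real[symmetric] LnLn[symmetric] of_real_mult of_real_diff)
  have "of_real (moebius_jacobian a x powr lam) * cnj ((1 - disc_moebius a x * cnj a) powr (- of_real lam)) =
      exp (of_real lam * (of_real (ln s) - (Ln b + cnj (Ln b)))) * exp (- of_real lam * (of_real (ln s) - cnj (Ln b)))"
    unfolding 1 2 by (simp add: exp_cnj)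
  also have "\<dots> = exp (- of_real lam * Ln b)"
    by (simp add: exp_add[symmetric] algebra_simps)
  also have "\<dots> = b powr (- of_real lam)"
    using b by (simp add: powr_def)
  finally show ?thesis by (simp add: b_def mult.commute)
qed

lemma vec_holomorphic_polydisc_kernel:
  assumes "w \<in> polydisc"
  shows "(\<lambda>z. polydisc_kernel lam z w) vec_holomorphic_on polydisc"
  unfolding polydisc_kernel_def
  using assms by (intro vec_holomorphic_on_prod vec_holomorphic_on_coordinate[OF holomorphic_kernel_factor])
    (auto simp: polydisc_def)

text \<open>
The automorphism that exchanges \<open>0\<close> and \<open>w\<close> turns the integrand into a holomorphic function \<open>H\<close>,
whose mean value is \<open>H 0 = F w\<close>.
\<close>

lemma polydisc_kernel_reproducing:
  fixes F :: "complex ^ 'n \<Rightarrow> complex"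
  assumes lam: "lam > 1" and F: "F vec_holomorphic_on polydisc" and w: "w \<in> polydisc"
    and int: "integrable (polydisc_measure lam) (\<lambda>z. indicator polydisc z *\<^sub>R (F z * cnj (polydisc_kernel lam z w)))"
  shows "integral\<^sup>L (polydisc_measure lam) (\<lambda>z. indicator polydisc z *\<^sub>R (F z * cnj (polydisc_kernel lam z w))) = F w"
proof -
  let ?M = "polydisc_measure lam :: (complex ^ 'n) measure"
  let ?g = "polydisc_moebius w"
  define G where "G z = indicator polydisc z *\<^sub>R (F z * cnj (polydisc_kernel lam z w))" for z
  define \<rho> where "\<rho> z = (\<Prod>i\<in>UNIV. moebius_jacobian (w $ i) (z $ i) powr lam)" for z :: "complex ^ 'n"
  define H where "H z = F (?g z) * polydisc_kernel lam z w" for z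
  have w1: "norm (w $ i) < 1" for i using w by (simp add: polydisc_def)
  have [measurable]: "?g \<in> borel_measurable borel"
    by (rule borel_measurable_vec_complex) (simp add: polydisc_moebius_def disc_moebius_def)
  have [measurable]: "\<rho> \<in> borel_measurable borel"
    unfolding \<rho>_def moebius_jacobian_def by measurable
  have [measurable]: "G \<in> borel_measurable borel"
    unfolding G_def
    by (intro borel_measurable_on_polydisc continuous_intros
        vec_holomorphic_on_imp_continuous_on F vec_holomorphic_polydisc_kernel w)
  have maps: "?g z \<in> polydisc" if "z \<in> polydisc" for z
    using that w1 by (auto simp: polydisc_def polydisc_moebius_def intro: norm_moebius_less_one)
  have \<rho>0: "0 \<le> \<rho> z" for z by (simp add: \<rho>_def prod_nonneg)
  have M_eq: "?M = distr (density ?M (\<lambda>z. ennreal (\<rho> z))) borel ?g"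
    unfolding \<rho>_def by (rule polydisc_measure_moebius[OF lam w])
  have pull: "\<rho> z *\<^sub>R G (?g z) = indicator polydisc z *\<^sub>R H z" if z: "z \<in> polydisc" for z
  proof -
    have "of_real (\<rho> z) * cnj (polydisc_kernel lam (?g z) w) = polydisc_kernel lam z w"
    proof -
      have "of_real (\<rho> z) * cnj (polydisc_kernel lam (?g z) w) =
         (\<Prod>i\<in>UNIV. of_real (moebius_jacobian (w $ i) (z $ i) powr lam) *
            cnj ((1 - disc_moebius (w $ i) (z $ i) * cnj (w $ i)) powr (- of_real lam)))"
        by (simp add: \<rho>_def polydisc_kernel_def polydisc_moebius_def prod.distrib)
      also have "\<dots> = polydisc_kernel lam z w"
        unfolding polydisc_kernel_def
        by (intro prod.cong refl moebius_kernel_factor w1) (use z in \<open>simp add: polydisc_def\<close>)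
      finally show ?thesis .
    qed
    then show ?thesis
      using z maps[OF z] by (simp add: G_def H_def scaleR_conv_of_real mult_ac)
  qed
  have pull_AE: "AE z in ?M. \<rho> z *\<^sub>R G (?g z) = indicator polydisc z *\<^sub>R H z"
    using AE_polydisc_measure by eventually_elim (rule pull)
  have H_holo: "H vec_holomorphic_on polydisc"
    unfolding H_def
  proof (intro vec_holomorphic_on_mult vec_holomorphic_polydisc_kernel w vec_holomorphic_on_compose[OF F])
    fix i
    show "(\<lambda>z. ?g z $ i) vec_holomorphic_on polydisc"
      unfolding polydisc_moebius_def vec_lambda_beta
      by (rule vec_holomorphic_on_coordinate[OF holomorphic_moebius[OF w1]])
  qed (use maps in auto)
  have H_meas: "(\<lambda>z. indicator polydisc z *\<^sub>R H z) \<in> borel_measurable borel"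
    by (intro borel_measurable_on_polydisc vec_holomorphic_on_imp_continuous_on H_holo)
  have "integrable (distr (density ?M (\<lambda>z. ennreal (\<rho> z))) borel ?g) G"
    using int by (simp add: M_eq[symmetric] G_def[abs_def])
  then have "integrable (density ?M (\<lambda>z. ennreal (\<rho> z))) (\<lambda>z. G (?g z))"
    by (subst (asm) integrable_distr_eq) auto
  then have "integrable ?M (\<lambda>z. \<rho> z *\<^sub>R G (?g z))"
    by (subst (asm) integrable_density) (auto simp: \<rho>0)
  then have H_int: "integrable ?M (\<lambda>z. indicator polydisc z *\<^sub>R H z)"
    by (rule integrable_cong_AE_imp) (use H_meas pull_AE in \<open>auto elim!: eventually_mono\<close>)
  have "integral\<^sup>L ?M G = integral\<^sup>L (distr (density ?M (\<lambda>z. ennreal (\<rho> z))) borel ?g) G"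
    by (simp add: M_eq[symmetric])
  also have "\<dots> = integral\<^sup>L (density ?M (\<lambda>z. ennreal (\<rho> z))) (\<lambda>z. G (?g z))"
    by (rule integral_distr) auto
  also have "\<dots> = integral\<^sup>L ?M (\<lambda>z. \<rho> z *\<^sub>R G (?g z))"
    by (rule integral_density) (auto simp: \<rho>0)
  also have "\<dots> = integral\<^sup>L ?M (\<lambda>z. indicator polydisc z *\<^sub>R H z)"
    by (rule integral_cong_AE) (use H_meas pull_AE in auto)
  also have "\<dots> = H 0"
    by (rule polydisc_mean_value[OF lam H_holo H_int])
  also have "\<dots> = F w"
  proof -
    have "?g 0 = w" by (simp add: polydisc_moebius_def disc_moebius_def vec_eq_iff)
    then show ?thesis by (simp add: H_def polydisc_kernel_def)
  qed
  finally show ?thesis by (simp only: G_def[abs_def])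
qed

lemma norm_polydisc_kernel_le:
  assumes "lam > 0" "z \<in> polydisc" "w \<in> polydisc"
  shows "norm (polydisc_kernel lam z w) \<le> (\<Prod>i\<in>UNIV. (1 - norm (w $ i)) powr (- lam))"
  unfolding polydisc_kernel_def prod_norm[symmetric]
proof (intro prod_mono conjI norm_ge_zero)
  fix i
  let ?b = "1 - z $ i * cnj (w $ i)"
  have zw: "norm (z $ i) < 1" "norm (w $ i) < 1" using assms by (auto simp: polydisc_def)
  have "norm (z $ i * cnj (w $ i)) \<le> norm (w $ i)"
    using zw mult_left_le_one_le[of "norm (w $ i)" "norm (z $ i)"] by (simp add: norm_mult)
  then have le: "1 - norm (w $ i) \<le> norm ?b"
    using norm_triangle_ineq2[of 1 "z $ i * cnj (w $ i)"] by simp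
  then have "?b \<noteq> 0" using zw by auto
  then have "norm (?b powr (- of_real lam)) = norm ?b powr (- lam)"
    by (simp add: powr_def)
  also have "\<dots> \<le> (1 - norm (w $ i)) powr (- lam)"
    by (rule powr_mono2') (use assms zw le in auto)
  finally show "norm (?b powr (- of_real lam)) \<le> (1 - norm (w $ i)) powr (- lam)" .
qed

section \<open>The symmetrization as a d!-sheeted covering\<close>

text \<open>
A Borel linear order on the complex numbers; it serves to select one point from each orbit of the
permutations of coordinates.
\<close>

definition lex_less :: "complex \<Rightarrow> complex \<Rightarrow> bool" where
  "lex_less a b \<longleftrightarrow> Re a < Re b \<or> Re a = Re b \<and> Im a < Im b"

lemma lex_less_trans: "lex_less a b \<Longrightarrow> lex_less b c \<Longrightarrow> lex_less a c"
  by (auto simp: lex_less_def)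

lemma lex_less_irrefl: "\<not> lex_less a a"
  by (auto simp: lex_less_def)

lemma lex_less_linear: "a \<noteq> b \<Longrightarrow> lex_less a b \<or> lex_less b a"
  by (auto simp: lex_less_def complex_eq_iff)

definition coordinate_rank :: "complex ^ 'n \<Rightarrow> 'n \<Rightarrow> nat" where
  "coordinate_rank z i = card {j. lex_less (z $ j) (z $ i)}"

text \<open>
In a point of \<open>sector p\<close>, coordinate \<open>i\<close> has position \<open>p i\<close> when the coordinates are sorted in
decreasing order. The sectors are fundamental domains of the permutations, off the diagonals.
\<close>

definition sector :: "('n \<Rightarrow> 'n) \<Rightarrow> (complex ^ 'n::{finite,linorder}) set" where
  "sector p = {z \<in> polydisc - diagonals. \<forall>i. coordinate_rank z i = CARD('n) - card {..p i}}"

lemma bij_betw_coordinate_rank: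
  fixes z :: "complex ^ 'n"
  assumes dist: "\<And>i j. i \<noteq> j \<Longrightarrow> z $ i \<noteq> z $ j"
  shows "bij_betw (coordinate_rank z) UNIV {..<CARD('n)}"
proof -
  have less: "coordinate_rank z i < coordinate_rank z j" if "lex_less (z $ i) (z $ j)" for i j
    unfolding coordinate_rank_def
  proof (rule psubset_card_mono)
    show "{k. lex_less (z $ k) (z $ i)} \<subset> {k. lex_less (z $ k) (z $ j)}"
      using that lex_less_trans lex_less_irrefl by blast
  qed simp
  have inj: "inj (coordinate_rank z)"
    by (rule injI) (metis dist less lex_less_linear less_irrefl)
  have "coordinate_rank z i < CARD('n)" for i
    unfolding coordinate_rank_def by (rule psubset_card_mono) (use lex_less_irrefl in auto)
  then have "range (coordinate_rank z) = {..<CARD('n)}"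
    using card_image[OF inj] by (intro card_subset_eq) auto
  then show ?thesis using inj by (simp add: bij_betw_def)
qed

text \<open>
Sorting the coordinates: both the ranks of the coordinates and the positions exhaust the numbers
below \<open>d\<close>, so matching them defines the permutation.
\<close>

lemma ex1_sector:
  fixes z :: "complex ^ 'n::{finite,linorder}"
  assumes "z \<in> polydisc - diagonals"
  shows "\<exists>!p. p permutes UNIV \<and> z \<in> sector p"
proof -
  let ?c = "\<lambda>k::'n. CARD('n) - card {..k}"
  have c: "bij_betw ?c UNIV {..<CARD('n)}" by (rule bij_betw_codegree)
  have r: "bij_betw (coordinate_rank z) UNIV {..<CARD('n)}"
    by (rule bij_betw_coordinate_rank) (use assms in \<open>auto simp: diagonals_def\<close>)
  define p where "p i = inv_into UNIV ?c (coordinate_rank z i)" for i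
  have "bij_betw (inv_into UNIV ?c \<circ> coordinate_rank z) UNIV UNIV"
    by (rule bij_betw_trans[OF r bij_betw_inv_into[OF c]])
  then have p: "p permutes UNIV"
    by (intro bij_imp_permutes) (auto simp: p_def[abs_def] o_def)
  have cp: "?c (p i) = coordinate_rank z i" for i
  proof -
    have "coordinate_rank z i \<in> {..<CARD('n)}" using r bij_betw_apply by fastforce
    then show ?thesis unfolding p_def using c
      by (metis (no_types, lifting) bij_betw_inv_into_right)
  qed
  show ?thesis
  proof (rule ex1I[of _ p])
    show "p permutes UNIV \<and> z \<in> sector p"
      using p cp assms by (simp add: sector_def)
    fix q assume "q permutes UNIV \<and> z \<in> sector q"
    then have "?c (q i) = ?c (p i)" for i
      by (simp add: sector_def cp)
    then show "q = p"
      using c by (auto simp: bij_betw_def inj_def fun_eq_iff)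
  qed
qed

lemma permute_in_polydisc:
  assumes p: "p permutes UNIV"
  shows "(\<chi> i. z $ p i) \<in> polydisc \<longleftrightarrow> z \<in> polydisc"
proof -
  have "(\<forall>i. norm (z $ p i) < 1) \<longleftrightarrow> (\<forall>i. norm (z $ i) < 1)"
    using permutes_surj[OF p] by (metis surjD)
  then show ?thesis by (simp add: polydisc_def)
qed

lemma permute_in_diagonals:
  assumes p: "p permutes UNIV"
  shows "(\<chi> i. z $ p i) \<in> diagonals \<longleftrightarrow> z \<in> diagonals"
proof -
  have "(\<exists>i j. i \<noteq> j \<and> z $ p i = z $ p j) \<longleftrightarrow> (\<exists>i j. i \<noteq> j \<and> z $ i = z $ j)"
  proof
    assume "\<exists>i j. i \<noteq> j \<and> z $ p i = z $ p j"
    then obtain i j where "i \<noteq> j" "z $ p i = z $ p j" by blast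
    then show "\<exists>i j. i \<noteq> j \<and> z $ i = z $ j"
      using permutes_inj[OF p] by (intro exI[of _ "p i"] exI[of _ "p j"]) (simp add: inj_eq)
  next
    assume "\<exists>i j. i \<noteq> j \<and> z $ i = z $ j"
    then obtain i j where "i \<noteq> j" "z $ i = z $ j" by blast
    then show "\<exists>i j. i \<noteq> j \<and> z $ p i = z $ p j"
      using permutes_inj[OF permutes_inv[OF p]]
      by (intro exI[of _ "inv p i"] exI[of _ "inv p j"]) (simp add: permutes_inverses[OF p] inj_eq)
  qed
  then show ?thesis
    using permute_in_polydisc[OF p, of z] by (simp add: diagonals_def)
qed

lemma permute_in_sector:
  fixes z :: "complex ^ 'n::{finite,linorder}"
  assumes p: "p permutes UNIV" and q: "q permutes UNIV"
  shows "(\<chi> i. z $ p i) \<in> sector (q \<circ> p) \<longleftrightarrow> z \<in> sector q"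
proof -
  have "coordinate_rank (\<chi> i. z $ p i) i = coordinate_rank z (p i)" for i
  proof -
    have "{j. lex_less (z $ j) (z $ p i)} = p ` {j. lex_less (z $ p j) (z $ p i)}"
      using permutes_surj[OF p] by (auto simp: surj_def)
    then show ?thesis
      using permutes_inj_on[OF p] by (simp add: coordinate_rank_def card_image)
  qed
  moreover have "(\<forall>i. coordinate_rank z (p i) = CARD('n) - card {..q (p i)}) \<longleftrightarrow>
      (\<forall>i. coordinate_rank z i = CARD('n) - card {..q i})"
    using permutes_surj[OF p] by (metis surjD)
  ultimately show ?thesis
    using permute_in_polydisc[OF p, of z] permute_in_diagonals[OF p, of z]
    by (simp add: sector_def)
qed

lemma inj_on_symmetrization_sector: "inj_on symmetrization (sector id)"
proof (rule inj_onI)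
  fix z z' :: "complex ^ 'a::{finite,linorder}"
  assume z: "z \<in> sector id" "z' \<in> sector id" "symmetrization z = symmetrization z'"
  from z(3) obtain p where p: "p permutes UNIV" "z' = (\<chi> i. z $ p i)"
    by (rule symmetrization_eqD)
  have "z' \<in> sector p"
    using permute_in_sector[OF p(1) permutes_id, of z] z(1) p(2) by simp
  moreover have "\<exists>!p. p permutes UNIV \<and> z' \<in> sector p"
    by (rule ex1_sector) (use z(2) in \<open>simp add: sector_def\<close>)
  ultimately have "p = id"
    using z(2) p(1) permutes_id by blast
  then show "z = z'" using p(2) by (simp add: vec_eq_iff)
qed

lemma symmetrization_in_polydisc_image: "symmetrization z \<in> symmetrized_polydisc \<longleftrightarrow> z \<in> polydisc"
  unfolding symmetrized_polydisc_def
proof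
  assume "symmetrization z \<in> symmetrization ` polydisc"
  then obtain z' where z': "z' \<in> polydisc" "symmetrization z' = symmetrization z" by force
  from z'(2) obtain p where "p permutes UNIV" "z = (\<chi> i. z' $ p i)"
    by (rule symmetrization_eqD)
  with z'(1) show "z \<in> polydisc" by (simp add: permute_in_polydisc)
qed blast

lemma symmetrization_in_diagonals_image: "symmetrization z \<in> symmetrization ` diagonals \<longleftrightarrow> z \<in> diagonals"
proof
  assume "symmetrization z \<in> symmetrization ` diagonals"
  then obtain z' where z': "z' \<in> diagonals" "symmetrization z' = symmetrization z" by force
  from z'(2) obtain p where "p permutes UNIV" "z = (\<chi> i. z' $ p i)"
    by (rule symmetrization_eqD)
  with z'(1) show "z \<in> diagonals" by (simp add: permute_in_diagonals)
qed blast

lemma symmetrization_image_sector: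
  "symmetrization ` sector id = symmetrized_polydisc - symmetrization ` diagonals"
proof (intro equalityI subsetI)
  fix S assume "S \<in> symmetrized_polydisc - symmetrization ` (diagonals :: (complex ^ 'a::{finite,linorder}) set)"
  then obtain z where z: "z \<in> polydisc - diagonals" "S = symmetrization z"
    by (auto simp: symmetrized_polydisc_def)
  obtain p where p: "p permutes UNIV" "z \<in> sector p"
    using ex1_sector[OF z(1)] by blast
  have "(\<chi> i. z $ inv p i) \<in> sector id"
    using permute_in_sector[OF permutes_inv[OF p(1)] p(1), of z] p by (simp add: permutes_inv_o)
  moreover have "symmetrization (\<chi> i. z $ inv p i) = S"
    using symmetrization_permute[OF permutes_inv[OF p(1)]] z by metis
  ultimately show "S \<in> symmetrization ` sector id" by blast
next
  fix S :: "complex ^ 'a::{finite,linorder}" assume "S \<in> symmetrization ` sector id"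
  then obtain z where "z \<in> sector id" "S = symmetrization z" by blast
  then show "S \<in> symmetrized_polydisc - symmetrization ` diagonals"
    using symmetrization_in_polydisc_image[of z] symmetrization_in_diagonals_image[of z]
    by (simp add: sector_def)
qed

lemma open_symmetrized_polydisc: "open symmetrized_polydisc"
  unfolding symmetrized_polydisc_def
  by (rule open_symmetrization_image[OF open_polydisc]) (simp add: permute_in_polydisc)

lemma open_symmetrized_polydisc_minus_diagonals:
  "open (symmetrized_polydisc - symmetrization ` (diagonals :: (complex ^ 'n::{finite,linorder}) set))"
proof -
  let ?C = "{z :: complex ^ 'n::{finite,linorder}. \<exists>i j. i \<noteq> j \<and> z $ i = z $ j}"
  have eq: "symmetrized_polydisc - symmetrization ` diagonals = symmetrized_polydisc - symmetrization ` ?C"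
  proof (intro equalityI subsetI DiffI notI; elim DiffE)
    fix S assume S: "S \<in> symmetrized_polydisc" "S \<notin> symmetrization ` diagonals" "S \<in> symmetrization ` ?C"
    from S(3) obtain c where c: "c \<in> ?C" "S = symmetrization c" by blast
    then have "c \<in> diagonals"
      using S(1) symmetrization_in_polydisc_image[of c] by (simp add: diagonals_eq)
    then show False using S(2) c(2) by blast
  next
    fix S assume S: "S \<notin> symmetrization ` ?C" "S \<in> symmetrization ` diagonals"
    then show False unfolding diagonals_eq by blast
  qed assumption+
  show ?thesis
    unfolding eq
    by (intro open_Diff open_symmetrized_polydisc closed_symmetrization_image closed_coinciding_coordinates)
qed

lemma sector_borel [measurable]: "sector p \<in> sets borel"
proof -
  have rank: "coordinate_rank z i = (\<Sum>j\<in>UNIV. if lex_less (z $ j) (z $ i) then 1 else 0)"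
    for z :: "complex ^ 'a::{finite,linorder}" and i
    by (simp add: coordinate_rank_def sum.If_cases)
  have "(\<lambda>z. \<Sum>j\<in>UNIV. if lex_less (z $ j) (z $ i) then 1 else 0 :: real) \<in> borel_measurable borel"
    for i :: 'a
    unfolding lex_less_def by measurable
  then have [measurable]: "(\<lambda>z. real (coordinate_rank z i)) \<in> borel_measurable borel" for i :: 'a
    by (simp add: rank of_nat_sum if_distrib cong: if_cong)
  have "sector p = (polydisc - diagonals) \<inter> {z \<in> space borel. \<forall>i. real (coordinate_rank z i) = real (CARD('a) - card {..p i})}"
    by (auto simp: sector_def)
  also have "\<dots> \<in> sets borel"
    by measurable
  finally show ?thesis .
qed

lemma distr_permute_lborel:
  assumes p: "p permutes UNIV"
  shows "distr lborel borel (\<lambda>z. \<chi> i. z $ p i) = (lborel :: (complex ^ 'n) measure)"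
proof (rule lborel_eqI[symmetric])
  let ?\<pi> = "\<lambda>z::complex ^ 'n. \<chi> i. z $ p i"
  have meas [measurable]: "?\<pi> \<in> borel_measurable borel"
    by (rule borel_measurable_vec_complex) simp
  fix l u :: "complex ^ 'n"
  assume le: "\<And>b. b \<in> Basis \<Longrightarrow> l \<bullet> b \<le> u \<bullet> b"
  have lu: "Re (l $ i) \<le> Re (u $ i)" "Im (l $ i) \<le> Im (u $ i)" for i
    using le[of "axis i 1"] le[of "axis i \<i>"] by (simp_all add: axis_in_Basis_iff inner_axis inner_complex_def Basis_complex_def)
  let ?l = "\<chi> i. l $ inv p i" and ?u = "\<chi> i. u $ inv p i"
  have all: "(\<forall>i. P (p i)) \<longleftrightarrow> (\<forall>i. P i)" for P
    using permutes_surj[OF p] by (metis surjD)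
  have mem: "z \<in> box a b \<longleftrightarrow> (\<forall>i. Re (a $ i) < Re (z $ i) \<and> Re (z $ i) < Re (b $ i) \<and>
      Im (a $ i) < Im (z $ i) \<and> Im (z $ i) < Im (b $ i))" for a b z :: "complex ^ 'n"
    by (auto simp: mem_box Basis_vec_complex ball_Un inner_axis inner_complex_def)
  have pre: "?\<pi> -` box l u = box ?l ?u"
  proof (rule set_eqI)
    fix z
    show "z \<in> ?\<pi> -` box l u \<longleftrightarrow> z \<in> box ?l ?u"
      unfolding vimage_eq mem vec_lambda_beta
      by (subst (2) all[symmetric]) (simp add: permutes_inverses[OF p])
  qed
  let ?t = "\<lambda>i. (Re (u $ i) - Re (l $ i)) * (Im (u $ i) - Im (l $ i))"
  have "emeasure (distr lborel borel ?\<pi>) (box l u) = emeasure lborel (box ?l ?u)"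
    by (subst emeasure_distr) (auto simp: pre)
  also have "\<dots> = ennreal (\<Prod>b\<in>Basis. (?u - ?l) \<bullet> b)"
    by (subst emeasure_lborel_box)
       (auto simp: Basis_vec_complex inner_axis inner_complex_def lu)
  also have "(\<Prod>b\<in>Basis. (?u - ?l) \<bullet> b) = (\<Prod>i\<in>UNIV. ?t (inv p i))"
    by (simp add: prod_Basis_complex_vec inner_axis inner_complex_def)
  also have "\<dots> = (\<Prod>i\<in>UNIV. ?t i)"
    using prod.permute[OF permutes_inv[OF p], of ?t] by (simp add: o_def)
  also have "\<dots> = (\<Prod>b\<in>Basis. (u - l) \<bullet> b)"
    by (simp add: prod_Basis_complex_vec inner_axis inner_complex_def)
  finally show "emeasure (distr lborel borel ?\<pi>) (box l u) = ennreal (\<Prod>b\<in>Basis. (u - l) \<bullet> b)" .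
qed simp

lemma disc_weight_permute:
  assumes "p permutes UNIV"
  shows "disc_weight lam (\<chi> i. z $ p i) = disc_weight lam z"
  unfolding disc_weight_def
  using prod.permute[OF assms, of "\<lambda>i. (lam - 1) / pi * (1 - (norm (z $ i))\<^sup>2) powr (lam - 2)"]
  by (simp add: o_def)

lemma bounded_symmetrized_polydisc: "bounded (symmetrized_polydisc :: (complex ^ 'n::{finite,linorder}) set)"
proof -
  have "compact (symmetrization ` closure (polydisc :: (complex ^ 'n::{finite,linorder}) set))"
    using bounded_polydisc
    by (intro compact_continuous_image continuous_symmetrization) (simp add: compact_closure)
  then show ?thesis
    unfolding symmetrized_polydisc_def
    by (rule bounded_subset[OF compact_imp_bounded]) (use closure_subset in blast)
qed

lemma measurable_symmetrization [measurable]: "symmetrization \<in> borel_measurable borel"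
  by (intro borel_measurable_continuous_onI continuous_symmetrization)

text \<open>
Volume and weight are invariant under permutations, so all sectors contribute equally to the mass
over \<open>B\<close>, and together they fill the polydisc up to the diagonals, which have measure zero.
\<close>

lemma distr_sector:
  fixes B :: "(complex ^ 'n::{finite,linorder}) set"
  assumes lam: "lam > 1" and B: "B \<in> sets borel"
  shows "emeasure (distr (polydisc_measure lam) borel symmetrization) B =
    fact CARD('n) * (\<integral>\<^sup>+z. indicator (sector id) z * ennreal (disc_weight lam z) * indicator B (symmetrization z)
      \<partial>(lborel :: (complex ^ 'n::{finite,linorder}) measure))"
proof -
  note [measurable] = B
  let ?L = "lborel :: (complex ^ 'n::{finite,linorder}) measure"
  let ?h = "\<lambda>z::complex ^ 'n::{finite,linorder}. ennreal (disc_weight lam z) * indicator B (symmetrization z)"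
  have h_meas: "?h \<in> borel_measurable borel" by measurable
  have piece: "(\<integral>\<^sup>+z. indicator (sector p) z * ?h z \<partial>?L) = (\<integral>\<^sup>+z. indicator (sector id) z * ?h z \<partial>?L)"
    if p: "p permutes UNIV" for p
  proof -
    have [measurable]: "(\<lambda>z::complex ^ 'n::{finite,linorder}. \<chi> i. z $ p i) \<in> borel_measurable borel"
      by (rule borel_measurable_vec_complex) simp
    have "(\<integral>\<^sup>+z. indicator (sector p) z * ?h z \<partial>?L) =
        (\<integral>\<^sup>+z. indicator (sector p) z * ?h z \<partial>distr lborel borel (\<lambda>z. \<chi> i. z $ p i))"
      by (simp only: distr_permute_lborel[OF p])
    also have "\<dots> = (\<integral>\<^sup>+z. indicator (sector p) (\<chi> i. z $ p i) * ?h (\<chi> i. z $ p i) \<partial>?L)"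
      by (rule nn_integral_distr) measurable
    also have "\<dots> = (\<integral>\<^sup>+z. indicator (sector id) z * ?h z \<partial>?L)"
    proof (rule nn_integral_cong)
      fix z :: "complex ^ 'n::{finite,linorder}"
      have "indicator (sector p) (\<chi> i. z $ p i) = (indicator (sector id) z :: ennreal)"
        using permute_in_sector[OF p permutes_id, of z] by (simp add: indicator_def)
      then show "indicator (sector p) (\<chi> i. z $ p i) * ?h (\<chi> i. z $ p i) = indicator (sector id) z * ?h z"
        by (simp add: disc_weight_permute[OF p] symmetrization_permute[OF p])
    qed
    finally show ?thesis .
  qed
  have "emeasure (distr (polydisc_measure lam) borel symmetrization) B =
      emeasure (polydisc_measure lam) (symmetrization -` B)"
    by (subst emeasure_distr) auto
  also have "\<dots> = (\<integral>\<^sup>+z. indicator polydisc z * ?h z \<partial>?L)"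
    unfolding polydisc_measure_def using measurable_sets[OF measurable_symmetrization B]
    by (subst emeasure_density) (auto intro!: nn_integral_cong simp: indicator_def)
  also have "\<dots> = (\<integral>\<^sup>+z. (\<Sum>p | p permutes UNIV. indicator (sector p) z * ?h z) \<partial>?L)"
  proof (rule nn_integral_cong_AE)
    show "AE z in ?L. indicator polydisc z * ?h z = (\<Sum>p | p permutes UNIV. indicator (sector p) z * ?h z)"
      using AE_not_in[OF diagonals_null_sets]
    proof eventually_elim
      case (elim z)
      have "(\<Sum>p | p permutes UNIV. indicator (sector p) z) = (indicator polydisc z :: ennreal)"
      proof (cases "z \<in> polydisc")
        case True
        then obtain q where q: "q permutes UNIV" "z \<in> sector q" "\<And>p. p permutes UNIV \<Longrightarrow> z \<in> sector p \<Longrightarrow> p = q"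
          using ex1_sector[of z] elim by auto
        have "(\<Sum>p | p permutes UNIV. indicator (sector p) z) = (\<Sum>p | p permutes UNIV. if p = q then 1 else 0 :: ennreal)"
        proof (intro sum.cong refl)
          fix p :: "'n \<Rightarrow> 'n" assume "p \<in> {p. p permutes UNIV}"
          then have "z \<in> sector p \<longleftrightarrow> p = q" using q by blast
          then show "indicator (sector p) z = (if p = q then 1 else 0 :: ennreal)"
            by (simp add: indicator_def)
        qed
        then show ?thesis using True q(1) by simp
      next
        case False
        then have "z \<notin> sector p" for p by (simp add: sector_def)
        then show ?thesis using False by simp
      qed
      then show ?case by (simp only: sum_distrib_right[symmetric])
    qed
  qed
  also have "\<dots> = (\<Sum>p | p permutes UNIV. \<integral>\<^sup>+z. indicator (sector p) z * ?h z \<partial>?L)"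
    by (rule nn_integral_sum) (use h_meas in measurable)
  also have "\<dots> = (\<Sum>p | p permutes (UNIV :: 'n set). \<integral>\<^sup>+z. indicator (sector id) z * ?h z \<partial>?L)"
    by (intro sum.cong refl piece) simp
  also have "\<dots> = fact CARD('n) * (\<integral>\<^sup>+z. indicator (sector id) z * ?h z \<partial>?L)"
    by (simp add: card_permutations)
  finally show ?thesis by (simp only: mult.assoc)
qed

text \<open>
On one sector the symmetrization is injective with full image, and its Jacobian determinant cancels
the denominator of \<open>\<rho>\<^sub>1\<close>. The number of sectors gives the factor \<open>d!\<close>.
\<close>

lemma distr_symmetrization:
  fixes \<rho>\<^sub>1 :: "complex ^ 'n::{finite,linorder} \<Rightarrow> real"
  assumes lam: "lam > 1"
    and cont: "continuous_on (symmetrized_polydisc - symmetrization ` diagonals) \<rho>\<^sub>1"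
    and pos: "\<And>S. S \<in> symmetrized_polydisc - symmetrization ` diagonals \<Longrightarrow> 0 < \<rho>\<^sub>1 S"
    and weight: "\<And>z. z \<in> polydisc - diagonals \<Longrightarrow>
      (\<Prod>(i, j) \<in> {(i, j). i < j}. (norm (z $ i - z $ j))\<^sup>2) * \<rho>\<^sub>1 (symmetrization z) = polydisc_weight lam z"
  shows "distr (polydisc_measure lam) borel symmetrization = density normalized_volume
    (\<lambda>S. ennreal (fact CARD('n) * (indicator (symmetrized_polydisc - symmetrization ` diagonals) S * \<rho>\<^sub>1 S)))"
    (is "?L = ?R")
proof (rule measure_eqI)
  let ?GE = "symmetrized_polydisc - symmetrization ` (diagonals :: (complex ^ 'n::{finite,linorder}) set)"
  let ?J = "\<lambda>z::complex ^ 'n::{finite,linorder}. \<Prod>(i, j) \<in> {(i, j). i < j}. (norm (z $ i - z $ j))\<^sup>2"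
  define r where "r S = indicator ?GE S * \<rho>\<^sub>1 S" for S
  have GE [measurable]: "?GE \<in> sets borel"
    by (rule borel_open[OF open_symmetrized_polydisc_minus_diagonals])
  have r [measurable]: "r \<in> borel_measurable borel"
    unfolding r_def using borel_measurable_continuous_on_indicator[OF GE cont] by simp
  have r0: "0 \<le> r S" for S
    using pos[of S] by (cases "S \<in> ?GE") (auto simp: r_def)
  have J [measurable]: "?J \<in> borel_measurable borel"
    unfolding split_beta by measurable
  show "sets ?L = sets ?R" by (simp add: normalized_volume_eq)
  fix B assume "B \<in> sets ?L"
  then have B [measurable]: "B \<in> sets borel" by simp
  let ?U = "sector id :: (complex ^ 'n::{finite,linorder}) set"
  have cv: "density lborel (indicator (symmetrization ` ?U)) =
      distr (density lborel (\<lambda>z. indicator (sector id) z * ennreal (?J z))) borel symmetrization"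
  proof (rule change_of_variables_complex_vec)
    show "bounded (symmetrization ` ?U)"
      unfolding symmetrization_image_sector
      by (rule bounded_subset[OF bounded_symmetrized_polydisc]) auto
    show "symmetrization ` ?U \<in> sets borel"
      unfolding symmetrization_image_sector by (rule GE)
    show "rdet (symmetrization_deriv z) = ?J z" if "z \<in> ?U" for z
      by (rule rdet_symmetrization_deriv) (use that in \<open>auto simp: sector_def diagonals_def\<close>)
  qed (auto intro: symmetrization_has_derivative inj_on_symmetrization_sector)
  have "emeasure ?R B = (\<integral>\<^sup>+S. ennreal (1 / pi ^ CARD('n)) * (ennreal (fact CARD('n) * r S) * indicator B S) \<partial>lborel)"
    unfolding normalized_volume_eq r_def[symmetric]
    by (subst emeasure_density) (auto simp: nn_integral_density)
  also have "\<dots> = (\<integral>\<^sup>+S. indicator ?GE S * (ennreal (1 / pi ^ CARD('n)) * (ennreal (fact CARD('n) * r S) * indicator B S)) \<partial>lborel)"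
    by (intro nn_integral_cong) (auto simp: r_def indicator_def)
  also have "\<dots> = (\<integral>\<^sup>+S. ennreal (1 / pi ^ CARD('n)) * (ennreal (fact CARD('n) * r S) * indicator B S) \<partial>density lborel (indicator ?GE))"
    by (subst nn_integral_density) auto
  also have "\<dots> = (\<integral>\<^sup>+z. ennreal (1 / pi ^ CARD('n)) * (ennreal (fact CARD('n) * r (symmetrization z)) * indicator B (symmetrization z))
      \<partial>density lborel (\<lambda>z. indicator (sector id) z * ennreal (?J z)))"
    unfolding cv[unfolded symmetrization_image_sector] by (subst nn_integral_distr) auto
  also have "\<dots> = (\<integral>\<^sup>+z. indicator (sector id) z * ennreal (?J z) *
      (ennreal (1 / pi ^ CARD('n)) * (ennreal (fact CARD('n) * r (symmetrization z)) * indicator B (symmetrization z))) \<partial>lborel)"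
    by (subst nn_integral_density) auto
  also have "\<dots> = (\<integral>\<^sup>+z. fact CARD('n) *
      (indicator (sector id) z * ennreal (disc_weight lam z) * indicator B (symmetrization z)) \<partial>lborel)"
  proof (rule nn_integral_cong)
    fix z :: "complex ^ 'n::{finite,linorder}"
    show "indicator (sector id) z * ennreal (?J z) *
      (ennreal (1 / pi ^ CARD('n)) * (ennreal (fact CARD('n) * r (symmetrization z)) * indicator B (symmetrization z))) =
      fact CARD('n) * (indicator (sector id) z * ennreal (disc_weight lam z) * indicator B (symmetrization z))"
    proof (cases "z \<in> sector id")
      case True
      then have z: "z \<in> polydisc - diagonals" by (simp add: sector_def)
      have "r (symmetrization z) = \<rho>\<^sub>1 (symmetrization z)"
        using z by (simp add: r_def symmetrization_in_polydisc_image symmetrization_in_diagonals_image)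
      then have "?J z * (1 / pi ^ CARD('n) * (fact CARD('n) * r (symmetrization z))) = fact CARD('n) * disc_weight lam z"
        using weight[OF z] polydisc_weight_eq[of lam z] by (simp add: field_simps)
      moreover have "0 \<le> ?J z" by (intro prod_nonneg) auto
      ultimately have "ennreal (?J z) * (ennreal (1 / pi ^ CARD('n)) * ennreal (fact CARD('n) * r (symmetrization z))) =
          fact CARD('n) * ennreal (disc_weight lam z)"
        by (simp add: ennreal_mult[symmetric] r0 disc_weight_nonneg lam ennreal_fact[symmetric])
      then show ?thesis using True by (simp add: mult_ac)
    qed simp
  qed
  also have "\<dots> = fact CARD('n) * (\<integral>\<^sup>+z.
      (indicator (sector id) z * ennreal (disc_weight lam z) * indicator B (symmetrization z)) \<partial>lborel)"
    by (rule nn_integral_cmult) measurable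
  also have "\<dots> = emeasure ?L B"
    by (rule distr_sector[OF lam B, symmetric])
  finally show "emeasure ?L B = emeasure ?R B" ..
qed

section \<open>The Bergman kernel of the symmetrized polydisc\<close>

lemma vec_holomorphic_on_elem_sym: "(\<lambda>z. elem_sym m z) vec_holomorphic_on S"
  unfolding vec_holomorphic_on_def
proof
  fix z :: "complex ^ 'n"
  show "\<exists>D. (elem_sym m has_derivative D) (at z) \<and> (\<forall>c v. D (c *s v) = c * D v)"
    by (intro exI[of _ "\<lambda>v. \<Sum>A | card A = m. \<Sum>i\<in>A. v $ i * (\<Prod>j\<in>A - {i}. z $ j)"] conjI allI
        elem_sym_has_derivative)
       (simp add: sum_distrib_left mult.assoc)
qed

lemma vec_holomorphic_on_symmetrization:
  assumes "f vec_holomorphic_on symmetrized_polydisc"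
  shows "(\<lambda>z. f (symmetrization z)) vec_holomorphic_on polydisc"
proof (rule vec_holomorphic_on_compose[OF assms])
  show "(\<lambda>z. symmetrization z $ i) vec_holomorphic_on polydisc" for i :: 'a
    unfolding symmetrization_def vec_lambda_beta by (rule vec_holomorphic_on_elem_sym)
qed (auto simp: symmetrized_polydisc_def)

definition symmetrized_kernel :: "real \<Rightarrow> complex ^ 'n \<Rightarrow> complex ^ 'n \<Rightarrow> complex" where
  "symmetrized_kernel lam z w = permanent (\<chi> i j. (1 - z $ i * cnj (w $ j)) powr (- complex_of_real lam))"

lemma symmetrized_kernel_eq_sum:
  "symmetrized_kernel lam z w = (\<Sum>p | p permutes UNIV. polydisc_kernel lam z (\<chi> i. w $ p i))"
  by (simp add: symmetrized_kernel_def permanent_def polydisc_kernel_def)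

lemma symmetrized_kernel_permute:
  assumes q: "q permutes UNIV"
  shows "symmetrized_kernel lam z (\<chi> i. w $ q i) = symmetrized_kernel lam z w"
  unfolding symmetrized_kernel_eq_sum
  by (rule sum.reindex_bij_witness[of _ "\<lambda>p. inv q \<circ> p" "\<lambda>p. q \<circ> p"])
     (auto simp: fun_eq_iff permutes_inverses[OF q] intro: permutes_compose permutes_inv q)

lemma symmetrized_kernel_descends:
  fixes w :: "complex ^ 'n::{finite,linorder}"
  assumes "w \<in> polydisc"
  shows "descends (\<lambda>z. symmetrized_kernel lam z w)"
  unfolding symmetrized_kernel_def
  using descends_permanent[of "\<lambda>j x. (1 - x * cnj (w $ j)) powr (- complex_of_real lam)"]
    holomorphic_kernel_factor assms
  by (simp add: polydisc_def)

text \<open>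
For a fixed \<open>T\<close> the function of \<open>S\<close> is chosen as a whole, so as to be holomorphic. Permuting the
coordinates of \<open>w\<close> preserves the permanent, so on the symmetrized polydisc the value does not
depend on which preimage \<open>w\<close> of \<open>T\<close> is chosen.
\<close>

definition bergman_kernel :: "real \<Rightarrow> complex ^ 'n::{finite,linorder} \<Rightarrow> complex ^ 'n::{finite,linorder} \<Rightarrow> complex"
  where
  "bergman_kernel lam S T = (SOME f. f vec_holomorphic_on symmetrized_polydisc \<and>
     (\<forall>z\<in>polydisc. f (symmetrization z) =
        symmetrized_kernel lam z (SOME w. w \<in> polydisc \<and> symmetrization w = T))) S"

lemma bergman_kernel:
  fixes w :: "complex ^ 'n::{finite,linorder}"
  assumes w: "w \<in> polydisc"
  shows "(\<lambda>S. bergman_kernel lam S (symmetrization w)) vec_holomorphic_on symmetrized_polydisc"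
    and "z \<in> polydisc \<Longrightarrow> bergman_kernel lam (symmetrization z) (symmetrization w) = symmetrized_kernel lam z w"
proof -
  define w' where "w' = (SOME w'. w' \<in> polydisc \<and> symmetrization w' = symmetrization w)"
  have w': "w' \<in> polydisc \<and> symmetrization w' = symmetrization w"
    unfolding w'_def by (rule someI[of _ w]) (use w in auto)
  then obtain p where p: "p permutes UNIV" "w' = (\<chi> i. w $ p i)"
    using symmetrization_eqD[of w w'] by metis
  have perm: "symmetrized_kernel lam z w' = symmetrized_kernel lam z w" for z
    unfolding p(2) by (rule symmetrized_kernel_permute[OF p(1)])
  define f where "f = (SOME f. f vec_holomorphic_on symmetrized_polydisc \<and>
     (\<forall>z\<in>polydisc. f (symmetrization z) = symmetrized_kernel lam z w'))"
  have "f vec_holomorphic_on symmetrized_polydisc \<and>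
     (\<forall>z\<in>polydisc. f (symmetrization z) = symmetrized_kernel lam z w')"
    unfolding f_def using symmetrized_kernel_descends[of w' lam] w'
    by (intro someI_ex[of "\<lambda>f. f vec_holomorphic_on symmetrized_polydisc \<and> _ f"]) (simp add: descends_def)
  moreover have "bergman_kernel lam S (symmetrization w) = f S" for S
    unfolding bergman_kernel_def f_def w'_def ..
  ultimately show "(\<lambda>S. bergman_kernel lam S (symmetrization w)) vec_holomorphic_on symmetrized_polydisc"
    and "z \<in> polydisc \<Longrightarrow> bergman_kernel lam (symmetrization z) (symmetrization w) = symmetrized_kernel lam z w"
    by (simp_all add: perm)
qed

lemma symmetrized_kernel_bounded:
  assumes "lam > 0" "w \<in> polydisc"
  obtains B where "\<And>z. z \<in> polydisc \<Longrightarrow> norm (symmetrized_kernel lam z w) \<le> B"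
proof
  fix z :: "complex ^ 'a" assume "z \<in> polydisc"
  then show "norm (symmetrized_kernel lam z w) \<le>
      (\<Sum>p | p permutes UNIV. \<Prod>i\<in>UNIV. (1 - norm ((\<chi> i. w $ p i) $ i)) powr (- lam))"
    unfolding symmetrized_kernel_eq_sum
    using assms by (intro sum_norm_le norm_polydisc_kernel_le) (auto simp: permute_in_polydisc)
qed

lemma bergman_inner_commute: "bergman_inner \<Omega> E \<rho> f g = cnj (bergman_inner \<Omega> E \<rho> g f)"
  unfolding bergman_inner_def set_lebesgue_integral_def Bochner_Integration.integral_cnj[symmetric]
  by (rule Bochner_Integration.integral_cong) (simp_all add: mult_ac)

text \<open>
Either kernel reproduces the functions of the other, so \<open>K S T\<close> is the conjugate of \<open>K' T S\<close>. The
case \<open>K = K'\<close> says that a reproducing kernel is Hermitian.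
\<close>

lemma bergman_kernel_unique:
  assumes "is_bergman_kernel \<Omega> E \<rho> K" "is_bergman_kernel \<Omega> E \<rho> K'" "S \<in> \<Omega>" "T \<in> \<Omega>"
  shows "K S T = K' S T"
proof -
  have conj: "K S T = cnj (K' T S)"
    if "is_bergman_kernel \<Omega> E \<rho> K" "is_bergman_kernel \<Omega> E \<rho> K'" for K K'
  proof -
    have "K S T = bergman_inner \<Omega> E \<rho> (\<lambda>z. K z T) (\<lambda>z. K' z S)"
      using that assms(3,4) by (simp add: is_bergman_kernel_def is_reproducing_kernel_def)
    also have "\<dots> = cnj (bergman_inner \<Omega> E \<rho> (\<lambda>z. K' z S) (\<lambda>z. K z T))"
      by (rule bergman_inner_commute)
    also have "bergman_inner \<Omega> E \<rho> (\<lambda>z. K' z S) (\<lambda>z. K z T) = K' T S"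
      using that assms(3,4) by (simp add: is_bergman_kernel_def is_reproducing_kernel_def)
    finally show ?thesis .
  qed
  show ?thesis
    using conj[OF assms(1,2)] conj[OF assms(2,2)] by simp
qed

text \<open>
Norms and inner products on the symmetrized polydisc are \<open>1 / d!\<close> times those of the pullbacks to the
polydisc. There the kernel function is the sum of the polydisc kernels at the permutations of \<open>w\<close>,
each of which reproduces the value of the symmetric function \<open>F\<close> at a permutation of \<open>w\<close>.
\<close>

lemma is_bergman_kernel_bergman_kernel:
  fixes \<rho>\<^sub>1 :: "complex ^ 'n::{finite,linorder} \<Rightarrow> real"
  assumes lam: "lam > 1"
    and cont: "continuous_on (symmetrized_polydisc - symmetrization ` diagonals) \<rho>\<^sub>1"
    and pos: "\<And>S. S \<in> symmetrized_polydisc - symmetrization ` diagonals \<Longrightarrow> 0 < \<rho>\<^sub>1 S"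
    and weight: "\<And>z. z \<in> polydisc - diagonals \<Longrightarrow>
      (\<Prod>(i, j) \<in> {(i, j). i < j}. (norm (z $ i - z $ j))\<^sup>2) * \<rho>\<^sub>1 (symmetrization z) = polydisc_weight lam z"
  shows "is_bergman_kernel symmetrized_polydisc (symmetrization ` diagonals) \<rho>\<^sub>1 (bergman_kernel lam)"
proof -
  let ?G = "symmetrized_polydisc :: (complex ^ 'n::{finite,linorder}) set"
  let ?GE = "?G - symmetrization ` diagonals"
  let ?M = "polydisc_measure lam :: (complex ^ 'n::{finite,linorder}) measure"
  let ?N = "normalized_volume :: (complex ^ 'n::{finite,linorder}) measure"
  define r where "r S = indicator ?GE S * \<rho>\<^sub>1 S" for S
  interpret M: finite_measure ?M using lam by (rule finite_measure_polydisc_measure)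
  have GE [measurable]: "?GE \<in> sets borel"
    by (rule borel_open[OF open_symmetrized_polydisc_minus_diagonals])
  have r [measurable]: "r \<in> borel_measurable borel"
    unfolding r_def using borel_measurable_continuous_on_indicator[OF GE cont] by simp
  have r0: "0 \<le> r S" for S
    using pos[of S] by (cases "S \<in> ?GE") (auto simp: r_def)
  have sets_N [simp, measurable_cong]: "sets ?N = sets borel"
    by (simp add: normalized_volume_eq)
  have push: "distr ?M borel symmetrization = density ?N (\<lambda>S. ennreal (fact CARD('n) * r S))"
    unfolding r_def by (rule distr_symmetrization[OF lam cont pos weight])
  have ext_meas: "(\<lambda>S. indicator ?G S *\<^sub>R f S) \<in> borel_measurable borel"
    if "f vec_holomorphic_on ?G" for f
    using vec_holomorphic_on_imp_continuous_on[OF that] borel_open[OF open_symmetrized_polydisc]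
    by (intro borel_measurable_continuous_on_indicator)

  \<comment> \<open>Functions holomorphic on \<open>G\<close> may fail to be measurable elsewhere, so they are cut off before they are integrated.\<close>
  have nn: "(\<integral>\<^sup>+ z. ennreal ((norm (f (symmetrization z)))\<^sup>2) * indicator polydisc z \<partial>?M) =
      fact CARD('n) * (\<integral>\<^sup>+ S \<in> ?GE. ennreal ((norm (f S))\<^sup>2 * \<rho>\<^sub>1 S) \<partial>?N)"
    if f: "f vec_holomorphic_on ?G" for f
  proof -
    define f0 where "f0 S = indicator ?G S *\<^sub>R f S" for S
    have [measurable]: "f0 \<in> borel_measurable borel"
      unfolding f0_def by (rule ext_meas[OF f])
    have "(\<integral>\<^sup>+ z. ennreal ((norm (f (symmetrization z)))\<^sup>2) * indicator polydisc z \<partial>?M) =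
        (\<integral>\<^sup>+ z. ennreal ((norm (f0 (symmetrization z)))\<^sup>2) \<partial>?M)"
      by (intro nn_integral_cong) (simp add: f0_def symmetrization_in_polydisc_image indicator_def)
    also have "\<dots> = (\<integral>\<^sup>+ S. ennreal ((norm (f0 S))\<^sup>2) \<partial>distr ?M borel symmetrization)"
      by (rule nn_integral_distr[symmetric]) measurable
    also have "\<dots> = (\<integral>\<^sup>+ S. ennreal (fact CARD('n) * r S) * ennreal ((norm (f0 S))\<^sup>2) \<partial>?N)"
      unfolding push by (rule nn_integral_density) measurable
    also have "\<dots> = (\<integral>\<^sup>+ S. fact CARD('n) * (ennreal (r S * (norm (f0 S))\<^sup>2)) \<partial>?N)"
      by (intro nn_integral_cong) (simp add: ennreal_mult r0 mult.assoc ennreal_fact[symmetric])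
    also have "\<dots> = fact CARD('n) * (\<integral>\<^sup>+ S. ennreal (r S * (norm (f0 S))\<^sup>2) \<partial>?N)"
      by (rule nn_integral_cmult) measurable
    also have "(\<integral>\<^sup>+ S. ennreal (r S * (norm (f0 S))\<^sup>2) \<partial>?N) = (\<integral>\<^sup>+ S \<in> ?GE. ennreal ((norm (f S))\<^sup>2 * \<rho>\<^sub>1 S) \<partial>?N)"
      by (intro nn_integral_cong) (auto simp: r_def f0_def indicator_def mult.commute)
    finally show ?thesis .
  qed
  have fact_fin: "fact CARD('n) * x < \<infinity> \<longleftrightarrow> x < \<infinity>" for x :: ennreal
    by (cases "x = 0") (simp_all add: ennreal_mult_less_top ennreal_fact[symmetric])

  have inner: "bergman_inner ?G (symmetrization ` diagonals) \<rho>\<^sub>1 f g =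
      (1 / fact CARD('n)) * integral\<^sup>L ?M (\<lambda>z. indicator polydisc z *\<^sub>R (f (symmetrization z) * cnj (g (symmetrization z))))"
    if f: "f vec_holomorphic_on ?G" and g: "g vec_holomorphic_on ?G" for f g
  proof -
    define h where "h S = (indicator ?G S *\<^sub>R f S) * cnj (indicator ?G S *\<^sub>R g S)" for S
    have cnj_meas: "cnj \<in> borel_measurable borel"
      by (intro borel_measurable_continuous_onI continuous_intros)
    have [measurable]: "h \<in> borel_measurable borel"
      unfolding h_def
      by (intro borel_measurable_times measurable_compose[OF _ cnj_meas] ext_meas f g)
    have "integral\<^sup>L ?M (\<lambda>z. indicator polydisc z *\<^sub>R (f (symmetrization z) * cnj (g (symmetrization z)))) =
        integral\<^sup>L ?M (\<lambda>z. h (symmetrization z))"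
      by (intro Bochner_Integration.integral_cong refl)
         (simp add: h_def symmetrization_in_polydisc_image indicator_def)
    also have "\<dots> = integral\<^sup>L (distr ?M borel symmetrization) h"
      by (rule integral_distr[symmetric]) measurable
    also have "\<dots> = integral\<^sup>L ?N (\<lambda>S. (fact CARD('n) * r S) *\<^sub>R h S)"
      unfolding push by (rule integral_density) (auto simp: r0)
    also have "\<dots> = integral\<^sup>L ?N (\<lambda>S. fact CARD('n) * (indicator ?GE S *\<^sub>R (f S * cnj (g S) * complex_of_real (\<rho>\<^sub>1 S))))"
      by (intro Bochner_Integration.integral_cong refl)
         (auto simp: r_def h_def indicator_def scaleR_conv_of_real)
    also have "\<dots> = fact CARD('n) * bergman_inner ?G (symmetrization ` diagonals) \<rho>\<^sub>1 f g"
      unfolding bergman_inner_def set_lebesgue_integral_def by (rule integral_mult_right_zero)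
    finally show ?thesis by simp
  qed

  show ?thesis
    unfolding is_bergman_kernel_def is_reproducing_kernel_def
  proof (intro ballI conjI)
    fix T assume "T \<in> ?G"
    then obtain w where w: "w \<in> polydisc" "T = symmetrization w"
      by (auto simp: symmetrized_polydisc_def)
    let ?k = "\<lambda>S. bergman_kernel lam S T"
    have k_holo: "?k vec_holomorphic_on ?G"
      unfolding w(2) by (rule bergman_kernel(1)[OF w(1)])
    have k_eq: "?k (symmetrization z) = symmetrized_kernel lam z w" if "z \<in> polydisc" for z
      unfolding w(2) by (rule bergman_kernel(2)[OF w(1) that])
    show "?k \<in> bergman_space ?G (symmetrization ` diagonals) \<rho>\<^sub>1"
    proof -
      obtain B where B: "\<And>z. z \<in> polydisc \<Longrightarrow> norm (symmetrized_kernel lam z w) \<le> B"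
        using symmetrized_kernel_bounded[of lam w] lam w(1) by auto
      have "(\<integral>\<^sup>+ z. ennreal ((norm (?k (symmetrization z)))\<^sup>2) * indicator polydisc z \<partial>?M) \<le> (\<integral>\<^sup>+ z. ennreal (B\<^sup>2) \<partial>?M)"
        using B by (intro nn_integral_mono) (auto simp: indicator_def k_eq power_mono)
      also have "\<dots> < \<infinity>"
        using emeasure_polydisc_measure_space[OF lam, where 'n='n] by simp
      finally have "(\<integral>\<^sup>+ S \<in> ?GE. ennreal ((norm (?k S))\<^sup>2 * \<rho>\<^sub>1 S) \<partial>?N) < \<infinity>"
        unfolding nn[OF k_holo] fact_fin .
      then show ?thesis
        unfolding bergman_space_def using k_holo by simp
    qed
    fix f assume "f \<in> bergman_space ?G (symmetrization ` diagonals) \<rho>\<^sub>1"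
    then have f: "f vec_holomorphic_on ?G"
      and f_fin: "(\<integral>\<^sup>+ S \<in> ?GE. ennreal ((norm (f S))\<^sup>2 * \<rho>\<^sub>1 S) \<partial>?N) < \<infinity>"
      by (auto simp: bergman_space_def)
    define F where "F z = f (symmetrization z)" for z
    have F: "F vec_holomorphic_on polydisc"
      unfolding F_def by (rule vec_holomorphic_on_symmetrization[OF f])
    have ext_F [measurable]: "(\<lambda>z. indicator polydisc z *\<^sub>R F z) \<in> borel_measurable borel"
      by (intro borel_measurable_on_polydisc vec_holomorphic_on_imp_continuous_on F)
    have int: "integrable ?M (\<lambda>z. indicator polydisc z *\<^sub>R (F z * cnj (polydisc_kernel lam z v)))"
      if v: "v \<in> polydisc" for v
    proof -
      \<comment> \<open>The kernel is bounded on the polydisc, and \<open>F\<close> is integrable because it is dominated by \<open>1 + |F|\<^sup>2\<close>.\<close>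
      define C where "C = (\<Prod>i\<in>UNIV. (1 - norm (v $ i)) powr (- lam))"
      have kern: "norm (polydisc_kernel lam z v) \<le> C" if "z \<in> polydisc" for z
        unfolding C_def by (rule norm_polydisc_kernel_le) (use that v lam in auto)
      have "0 \<le> C" by (simp add: C_def prod_nonneg)
      have "integrable ?M (\<lambda>z. (norm (indicator polydisc z *\<^sub>R F z))\<^sup>2)"
      proof (rule integrableI_nonneg)
        have "(\<integral>\<^sup>+ z. ennreal ((norm (indicator polydisc z *\<^sub>R F z))\<^sup>2) \<partial>?M) =
            (\<integral>\<^sup>+ z. ennreal ((norm (f (symmetrization z)))\<^sup>2) * indicator polydisc z \<partial>?M)"
          by (intro nn_integral_cong) (auto simp: F_def indicator_def)
        also have "\<dots> < \<infinity>"
          unfolding nn[OF f] fact_fin by (rule f_fin)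
        finally show "(\<integral>\<^sup>+ z. ennreal ((norm (indicator polydisc z *\<^sub>R F z))\<^sup>2) \<partial>?M) < \<infinity>" .
        show "(\<lambda>z. (norm (indicator polydisc z *\<^sub>R F z))\<^sup>2) \<in> borel_measurable ?M"
          unfolding measurable_cong_sets[OF sets_polydisc_measure refl]
          by (intro borel_measurable_power measurable_compose[OF ext_F borel_measurable_norm])
      qed auto
      then have dom: "integrable ?M (\<lambda>z. C * (1 + (norm (indicator polydisc z *\<^sub>R F z))\<^sup>2))"
        by (intro integrable_mult_right integrable_add) auto
      show ?thesis
      proof (rule Bochner_Integration.integrable_bound[OF dom])
        show "(\<lambda>z. indicator polydisc z *\<^sub>R (F z * cnj (polydisc_kernel lam z v))) \<in> borel_measurable ?M"
          unfolding measurable_cong_sets[OF sets_polydisc_measure refl]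
          by (intro borel_measurable_on_polydisc continuous_on_mult continuous_on_cnj
              vec_holomorphic_on_imp_continuous_on F vec_holomorphic_polydisc_kernel v)
        show "AE z in ?M. norm (indicator polydisc z *\<^sub>R (F z * cnj (polydisc_kernel lam z v)))
            \<le> norm (C * (1 + (norm (indicator polydisc z *\<^sub>R F z))\<^sup>2))"
        proof (rule AE_I2)
          fix z
          have amgm: "norm (F z) \<le> 1 + (norm (F z))\<^sup>2"
            using sum_squares_bound[of 1 "norm (F z)"] by (simp add: power2_eq_square) (smt (verit) norm_ge_zero)
          show "norm (indicator polydisc z *\<^sub>R (F z * cnj (polydisc_kernel lam z v)))
            \<le> norm (C * (1 + (norm (indicator polydisc z *\<^sub>R F z))\<^sup>2))"
          proof (cases "z \<in> polydisc")
            case True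
            have "norm (F z) * norm (polydisc_kernel lam z v) \<le> (1 + (norm (F z))\<^sup>2) * C"
              by (rule mult_mono) (use amgm kern[OF True] in auto)
            then show ?thesis using True \<open>0 \<le> C\<close> by (simp add: norm_mult mult.commute)
          qed (use \<open>0 \<le> C\<close> in simp)
        qed
      qed
    qed
    have "bergman_inner ?G (symmetrization ` diagonals) \<rho>\<^sub>1 f ?k =
        (1 / fact CARD('n)) * integral\<^sup>L ?M (\<lambda>z. indicator polydisc z *\<^sub>R (F z * cnj (?k (symmetrization z))))"
      unfolding F_def by (rule inner[OF f k_holo])
    also have "integral\<^sup>L ?M (\<lambda>z. indicator polydisc z *\<^sub>R (F z * cnj (?k (symmetrization z)))) =
        integral\<^sup>L ?M (\<lambda>z. \<Sum>p | p permutes UNIV. indicator polydisc z *\<^sub>R (F z * cnj (polydisc_kernel lam z (\<chi> i. w $ p i))))"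
    proof (intro Bochner_Integration.integral_cong refl)
      fix z :: "complex ^ 'n::{finite,linorder}"
      show "indicator polydisc z *\<^sub>R (F z * cnj (?k (symmetrization z))) =
        (\<Sum>p | p permutes UNIV. indicator polydisc z *\<^sub>R (F z * cnj (polydisc_kernel lam z (\<chi> i. w $ p i))))"
        by (cases "z \<in> polydisc") (simp_all add: k_eq symmetrized_kernel_eq_sum sum_distrib_left)
    qed
    also have "\<dots> = (\<Sum>p | p permutes UNIV. integral\<^sup>L ?M (\<lambda>z. indicator polydisc z *\<^sub>R (F z * cnj (polydisc_kernel lam z (\<chi> i. w $ p i)))))"
      by (rule Bochner_Integration.integral_sum) (use int w(1) in \<open>auto simp: permute_in_polydisc\<close>)
    also have "\<dots> = (\<Sum>p | p permutes (UNIV :: 'n set). F w)"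
    proof (intro sum.cong refl)
      fix p :: "'n \<Rightarrow> 'n" assume "p \<in> {p. p permutes UNIV}"
      then have p: "p permutes UNIV" by simp
      then have wp: "(\<chi> i. w $ p i) \<in> polydisc" using w(1) by (simp add: permute_in_polydisc)
      have "integral\<^sup>L ?M (\<lambda>z. indicator polydisc z *\<^sub>R (F z * cnj (polydisc_kernel lam z (\<chi> i. w $ p i)))) = F (\<chi> i. w $ p i)"
        by (rule polydisc_kernel_reproducing[OF lam F wp int[OF wp]])
      also have "\<dots> = F w" by (simp add: F_def symmetrization_permute[OF p])
      finally show "integral\<^sup>L ?M (\<lambda>z. indicator polydisc z *\<^sub>R (F z * cnj (polydisc_kernel lam z (\<chi> i. w $ p i)))) = F w" .
    qed
    also have "\<dots> = fact CARD('n) * f T"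
      by (simp add: card_permutations F_def w(2))
    finally show "f T = bergman_inner ?G (symmetrization ` diagonals) \<rho>\<^sub>1 f ?k"
      by simp
  qed
qed

theorem proposition5p3:
  fixes lam :: real
    and \<rho> \<rho>\<^sub>1 :: "complex ^ 'n::{finite,linorder} \<Rightarrow> real"
  assumes "lam > 1"
    and "\<rho> \<in> symmetrized_polydisc \<rightarrow> {0<..}"
    and "continuous_on symmetrized_polydisc \<rho>"
    and "\<And>z. z \<in> polydisc \<Longrightarrow> polydisc_weight lam z = \<rho> (symmetrization z)"
    and "\<rho>\<^sub>1 \<in> symmetrized_polydisc - symmetrization ` diagonals \<rightarrow> {0<..}"
    and "continuous_on (symmetrized_polydisc - symmetrization ` diagonals) \<rho>\<^sub>1"
    and "\<And>z. z \<in> polydisc - diagonals \<Longrightarrow>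
           \<rho>\<^sub>1 (symmetrization z) =
             1 / (\<Prod>(i, j) \<in> {(i, j). i < j}. (norm (z $ i - z $ j))\<^sup>2) * \<rho> (symmetrization z)"
  shows "(\<exists>K. is_bergman_kernel symmetrized_polydisc (symmetrization ` diagonals) \<rho>\<^sub>1 K) \<and>
    (\<forall>K. is_bergman_kernel symmetrized_polydisc (symmetrization ` diagonals) \<rho>\<^sub>1 K \<longrightarrow>
      (\<forall>z\<in>polydisc. \<forall>w\<in>polydisc.
         K (symmetrization z) (symmetrization w) =
           permanent (\<chi> i j. (1 - z $ i * cnj (w $ j)) powr (- complex_of_real lam))))"
proof -
  have kernel: "is_bergman_kernel symmetrized_polydisc (symmetrization ` diagonals) \<rho>\<^sub>1 (bergman_kernel lam)"
  proof (rule is_bergman_kernel_bergman_kernel)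
    fix z :: "complex ^ 'n::{finite,linorder}" assume z: "z \<in> polydisc - diagonals"
    then have "z $ i \<noteq> z $ j" if "i < j" for i j
      using that z less_imp_neq[OF that] by (simp add: diagonals_def) blast
    then have "(\<Prod>(i, j) \<in> {(i, j). i < j}. (norm (z $ i - z $ j))\<^sup>2) \<noteq> 0"
      by (simp add: prod_zero_iff split_beta)
    then show "(\<Prod>(i, j) \<in> {(i, j). i < j}. (norm (z $ i - z $ j))\<^sup>2) * \<rho>\<^sub>1 (symmetrization z) = polydisc_weight lam z"
      using assms(4)[of z] assms(7)[OF z] z by simp
  qed (use assms in auto)
  show ?thesis
  proof (intro conjI exI[of _ "bergman_kernel lam"] kernel allI impI ballI)
    fix K and z w :: "complex ^ 'n::{finite,linorder}"
    assume K: "is_bergman_kernel symmetrized_polydisc (symmetrization ` diagonals) \<rho>\<^sub>1 K"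
      and zw: "z \<in> polydisc" "w \<in> polydisc"
    then have "K (symmetrization z) (symmetrization w) = bergman_kernel lam (symmetrization z) (symmetrization w)"
      by (intro bergman_kernel_unique[OF K kernel]) (simp_all add: symmetrization_in_polydisc_image)
    also have "\<dots> = symmetrized_kernel lam z w"
      by (rule bergman_kernel(2)[OF zw(2,1)])
    finally show "K (symmetrization z) (symmetrization w) =
        permanent (\<chi> i j. (1 - z $ i * cnj (w $ j)) powr (- complex_of_real lam))"
      by (simp only: symmetrized_kernel_def)
  qed
qed

end
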